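(* Let $(A,\mathfrak a)$ be a unital good pair over $\Bbbk$ with $A$ of finite rank over $\Bbbk$, and let $n\ge1$, $d\ge0$. If $\mathsf t$ is an $(A,\mathfrak a)$-symmetrizing form on $A$, then the algebra $T^A_{\mathfrak a}(n,d)$ is symmetric, with symmetrizing form $\mathsf t^T$, the $\Bbbk$-linear map $\mathsf t^T:T^A_{\mathfrak a}(n,d)\to\Bbbk$ given by $$\mathsf t^T(\eta^{\boldsymbol b}_{\boldsymbol r,\boldsymbol s})=\delta_{\boldsymbol r,\boldsymbol s}\,\mathsf t(b_1)\cdots\mathsf t(b_d)\qquad\text{for all }(\boldsymbol b,\boldsymbol r,\boldsymbol s)\in\mathrm{Tri}^B(n,d).$$
   Context: $\Bbbk$ is a commutative domain of characteristic $0$. Superalgebras are $\mathbb Z/2$-graded associative (not necessarily unital) $\Bbbk$-algebras $A=A_{\bar 0}\oplus A_{\bar 1}$; $\bar a$ denotes the parity of a homogeneous element $a$; tensor products of superalgebras carry the product $(x\otimes y)(z\otimes w)=(-1)^{\bar y\bar z}xz\otimes yw$. A good pair $(A,\mathfrak a)$ consists of a superalgebra $A$ with $A_{\bar 0},A_{\bar 1}$ free over $\Bbbk$ and a subalgebra $\mathfrak a\subseteq A_{\bar 0}$ such that $\mathfrak a$ and $A/\mathfrak a$ are free $\Bbbk$-modules; it is a unital good pair if $A$ and $\mathfrak a$ are unital with $1_{\mathfrak a}=1_A$. An $(A,\mathfrak a)$-basis is a $\Bbbk$-basis $B=B_{\mathfrak a}\sqcup B_{\mathfrak c}\sqcup B_{\bar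 1}$ of $A$, where $B_{\mathfrak a}$, $B_{\mathfrak c}$, $B_{\bar 1}$ are bases of $\mathfrak a$, of a chosen $\Bbbk$-module complement $\mathfrak c$ of $\mathfrak a$ in $A_{\bar 0}$, and of $A_{\bar 1}$, respectively; one such basis is fixed. For $a\in A$ put $\xi^a_{r,s}:=aE_{r,s}\in M_n(A)$ ($E_{r,s}$ the matrix units; $M_n(A)$ is a superalgebra via parities of entries). Write $[1,n]=\{1,\dots,n\}$. The symmetric group $\mathfrak S_d$ acts on the right on words by $(x_1\cdots x_d)\sigma=x_{\sigma 1}\cdots x_{\sigma d}$, diagonally on tuples of words, and on $M_n(A)^{\otimes d}$ by superalgebra automorphisms $(\xi^{a_1}_{r_1,s_1}\otimes\cdots\otimes\xi^{a_d}_{r_d,s_d})^\sigma=(-1)^{\langle\sigma;\boldsymbol a\rangle}\xi^{a_{\sigma1}}_{r_{\sigma1},s_{\sigma1}}\otimes\cdots\otimes\xi^{a_{\sigma d}}_{r_{\sigma d},s_{\sigma d}}$ for homogeneous $a_i$, where $\langle\sigma;\boldsymbol a\rangle=\#\{(k,l): k<l,\ \sigma^{-1}k>\sigma^{-1}l,\ a_k,a_l \text{ odd}\}$. Define $S^A(n,d):=(M_n(A)^{\otimes d})^{\mathfrak S_d}$. $\mathrm{Tri}^B(n,d)$ is the set of triples $(\boldsymbol b,\boldsymbol r,\boldsymbol s)\in B^d\times[1,n]^d\times[1,n]^d$ such that for $k\ne l$ the equality $(b_k,r_k,s_k)=(b_l,r_l,s_l)$ holds only if $b_k$ is even. For such a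 triple let $\xi^{\boldsymbol b}_{\boldsymbol r,\boldsymbol s}:=\sum_\sigma(\xi^{b_1}_{r_1,s_1}\otimes\cdots\otimes\xi^{b_d}_{r_d,s_d})^\sigma\in S^A(n,d)$, with $\sigma$ over representatives of the cosets $\mathfrak S_{\boldsymbol b,\boldsymbol r,\boldsymbol s}\backslash\mathfrak S_d$, where $\mathfrak S_{\boldsymbol b,\boldsymbol r,\boldsymbol s}$ is the stabilizer of the triple. Let $[\boldsymbol b,\boldsymbol r,\boldsymbol s]^b_{r,s}:=\#\{k: (b_k,r_k,s_k)=(b,r,s)\}$, $[\boldsymbol b,\boldsymbol r,\boldsymbol s]^!_{\mathfrak c}:=\prod_{b\in B_{\mathfrak c},\,r,s\in[1,n]}[\boldsymbol b,\boldsymbol r,\boldsymbol s]^b_{r,s}!$, and $\eta^{\boldsymbol b}_{\boldsymbol r,\boldsymbol s}:=[\boldsymbol b,\boldsymbol r,\boldsymbol s]^!_{\mathfrak c}\,\xi^{\boldsymbol b}_{\boldsymbol r,\boldsymbol s}$. Finally $T^A_{\mathfrak a}(n,d)$ is the $\Bbbk$-span of all $\eta^{\boldsymbol b}_{\boldsymbol r,\boldsymbol s}$ with $(\boldsymbol b,\boldsymbol r,\boldsymbol s)\in\mathrm{Tri}^B(n,d)$; it is a subalgebra of $S^A(n,d)$. Forms: for a superalgebra $C$ free of finite rank over $\Bbbk$, a central form is an even $\Bbbk$-linear map $\mathsf t:C\to\Bbbk$ (so $\mathsf t(C_{\bar1})=0$) with $\mathsf t(xy)=\mathsf t(yx)$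 for all $x,y\in C$; put $(x,y)_{\mathsf t}:=\mathsf t(xy)$. It is a symmetrizing form if $C\to\mathrm{Hom}_\Bbbk(C,\Bbbk)$, $x\mapsto(x,\cdot)_{\mathsf t}$, is an isomorphism; $C$ is symmetric if it has a symmetrizing form. A symmetrizing form $\mathsf t$ on $A$ is $(A,\mathfrak a)$-symmetrizing if $(\mathfrak a,\mathfrak a)_{\mathsf t}=0$ and the complement $\mathfrak c$ of $\mathfrak a$ in $A_{\bar0}$ can be chosen so that the restriction of $(\cdot,\cdot)_{\mathsf t}$ to $\mathfrak a\times\mathfrak c$ is a perfect pairing; in this case $\mathfrak c$ (and the $(A,\mathfrak a)$-basis $B$, with $B_{\mathfrak c}$ a basis of $\mathfrak c$) is always taken with this property. *)

theory Defs
  imports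
    "HOL-Analysis.Finite_Cartesian_Product"
    "HOL-Combinatorics.Permutations"
    "HOL-Library.Function_Algebras"
    "HOL-Library.FuncSet"
begin

section \<open>Superalgebras and forms\<close>

text \<open>
  A superalgebra is carried by a subset of a type that is an abelian group and on which the
  scalars act.  There is no field for a unit: superalgebras need not be unital.
\<close>

record ('k, 'm) superalg =
  carr :: "'m set"
  smul :: "'k \<Rightarrow> 'm \<Rightarrow> 'm"
  mul :: "'m \<Rightarrow> 'm \<Rightarrow> 'm"
  even_part :: "'m set"
  odd_part :: "'m set"

definition direct_sum :: "'m::ab_group_add set \<Rightarrow> 'm set \<Rightarrow> 'm set \<Rightarrow> bool" where
  "direct_sum Z X Y \<longleftrightarrow> Z = {x + y |x y. x \<in> X \<and> y \<in> Y} \<and> X \<inter> Y = {0}"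

definition superalgebra :: "('k::comm_ring_1, 'm::ab_group_add) superalg \<Rightarrow> bool" where
  "superalgebra M \<longleftrightarrow>
     module (smul M) \<and>
     module.subspace (smul M) (carr M) \<and>
     module.subspace (smul M) (even_part M) \<and>
     module.subspace (smul M) (odd_part M) \<and>
     direct_sum (carr M) (even_part M) (odd_part M) \<and>
     (\<forall>x\<in>carr M. \<forall>y\<in>carr M. mul M x y \<in> carr M) \<and>
     (\<forall>x\<in>carr M. \<forall>y\<in>carr M. \<forall>z\<in>carr M. mul M (x + y) z = mul M x z + mul M y z) \<and>
     (\<forall>x\<in>carr M. \<forall>y\<in>carr M. \<forall>z\<in>carr M. mul M x (y + z) = mul M x y + mul M x z) \<and>
     (\<forall>c. \<forall>x\<in>carr M. \<forall>y\<in>carr M. mul M (smul M c x) y = smul M c (mul M x y)) \<and>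
     (\<forall>c. \<forall>x\<in>carr M. \<forall>y\<in>carr M. mul M x (smul M c y) = smul M c (mul M x y)) \<and>
     (\<forall>x\<in>carr M. \<forall>y\<in>carr M. \<forall>z\<in>carr M. mul M (mul M x y) z = mul M x (mul M y z)) \<and>
     (\<forall>x\<in>even_part M. \<forall>y\<in>even_part M. mul M x y \<in> even_part M) \<and>
     (\<forall>x\<in>even_part M. \<forall>y\<in>odd_part M. mul M x y \<in> odd_part M) \<and>
     (\<forall>x\<in>odd_part M. \<forall>y\<in>even_part M. mul M x y \<in> odd_part M) \<and>
     (\<forall>x\<in>odd_part M. \<forall>y\<in>odd_part M. mul M x y \<in> even_part M)"

definition module_basis ::
  "('k::comm_ring_1 \<Rightarrow> 'm::ab_group_add \<Rightarrow> 'm) \<Rightarrow> 'm set \<Rightarrow> 'm set \<Rightarrow> bool" where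
  "module_basis s X E \<longleftrightarrow> \<not> module.dependent s E \<and> module.span s E = X"

definition free_module :: "('k::comm_ring_1 \<Rightarrow> 'm::ab_group_add \<Rightarrow> 'm) \<Rightarrow> 'm set \<Rightarrow> bool" where
  "free_module s X \<longleftrightarrow> (\<exists>E. module_basis s X E)"

definition free_finite_rank :: "('k::comm_ring_1 \<Rightarrow> 'm::ab_group_add \<Rightarrow> 'm) \<Rightarrow> 'm set \<Rightarrow> bool" where
  "free_finite_rank s X \<longleftrightarrow> (\<exists>E. finite E \<and> module_basis s X E)"

text \<open>
  Freeness of the quotient \<open>X / Y\<close>: the elements of \<open>E\<close> represent the elements of a basis of
  the quotient.
\<close>

definition free_quotient ::
  "('k::comm_ring_1 \<Rightarrow> 'm::ab_group_add \<Rightarrow> 'm) \<Rightarrow> 'm set \<Rightarrow> 'm set \<Rightarrow> bool" where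
  "free_quotient s X Y \<longleftrightarrow>
     (\<exists>E\<subseteq>X. (\<forall>x\<in>X. \<exists>e\<in>module.span s E. x - e \<in> Y) \<and>
             (\<forall>F c. finite F \<and> F \<subseteq> E \<and> (\<Sum>v\<in>F. s (c v) v) \<in> Y \<longrightarrow> (\<forall>v\<in>F. c v = 0)))"

definition linear_form :: "('k::comm_ring_1 \<Rightarrow> 'm::ab_group_add \<Rightarrow> 'm) \<Rightarrow> 'm set \<Rightarrow> ('m \<Rightarrow> 'k) \<Rightarrow> bool" where
  "linear_form s X f \<longleftrightarrow>
     (\<forall>x\<in>X. \<forall>y\<in>X. f (x + y) = f x + f y) \<and> (\<forall>c. \<forall>x\<in>X. f (s c x) = c * f x)"

text \<open>The dual module \<open>Hom(X, k)\<close>; its elements are the linear forms on \<open>X\<close>, extensional off \<open>X\<close>.\<close>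

definition dual_module :: "('k::comm_ring_1 \<Rightarrow> 'm::ab_group_add \<Rightarrow> 'm) \<Rightarrow> 'm set \<Rightarrow> ('m \<Rightarrow> 'k) set" where
  "dual_module s X = {f \<in> extensional X. linear_form s X f}"

definition central_form :: "('k::comm_ring_1, 'm::ab_group_add) superalg \<Rightarrow> ('m \<Rightarrow> 'k) \<Rightarrow> bool" where
  "central_form M t \<longleftrightarrow>
     superalgebra M \<and> free_finite_rank (smul M) (carr M) \<and>
     linear_form (smul M) (carr M) t \<and>
     (\<forall>x\<in>odd_part M. t x = 0) \<and>
     (\<forall>x\<in>carr M. \<forall>y\<in>carr M. t (mul M x y) = t (mul M y x))"

text \<open>The maps below are linear as soon as \<open>t\<close> is, so being an isomorphism means being bijective.\<close>

definition symmetrizing_form :: "('k::comm_ring_1, 'm::ab_group_add) superalg \<Rightarrow> ('m \<Rightarrow> 'k) \<Rightarrow> bool" where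
  "symmetrizing_form M t \<longleftrightarrow>
     central_form M t \<and>
     bij_betw (\<lambda>x. \<lambda>y\<in>carr M. t (mul M x y)) (carr M) (dual_module (smul M) (carr M))"

definition symmetric_superalgebra :: "('k::comm_ring_1, 'm::ab_group_add) superalg \<Rightarrow> bool" where
  "symmetric_superalgebra M \<longleftrightarrow> (\<exists>t. symmetrizing_form M t)"

definition perfect_pairing ::
  "('k::comm_ring_1, 'm::ab_group_add) superalg \<Rightarrow> ('m \<Rightarrow> 'k) \<Rightarrow> 'm set \<Rightarrow> 'm set \<Rightarrow> bool" where
  "perfect_pairing M t X Y \<longleftrightarrow>
     bij_betw (\<lambda>x. \<lambda>y\<in>Y. t (mul M x y)) X (dual_module (smul M) Y) \<and>
     bij_betw (\<lambda>y. \<lambda>x\<in>X. t (mul M x y)) Y (dual_module (smul M) X)"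


section \<open>Good pairs\<close>

definition good_pair :: "('k::comm_ring_1, 'a::ab_group_add) superalg \<Rightarrow> 'a set \<Rightarrow> bool" where
  "good_pair A \<aa> \<longleftrightarrow>
     superalgebra A \<and>
     free_module (smul A) (even_part A) \<and> free_module (smul A) (odd_part A) \<and>
     \<aa> \<subseteq> even_part A \<and> module.subspace (smul A) \<aa> \<and> (\<forall>x\<in>\<aa>. \<forall>y\<in>\<aa>. mul A x y \<in> \<aa>) \<and>
     free_module (smul A) \<aa> \<and> free_quotient (smul A) (carr A) \<aa>"

definition unital_good_pair :: "('k::comm_ring_1, 'a::ab_group_add) superalg \<Rightarrow> 'a set \<Rightarrow> bool" where
  "unital_good_pair A \<aa> \<longleftrightarrow>
     good_pair A \<aa> \<and> (\<exists>e\<in>\<aa>. \<forall>x\<in>carr A. mul A e x = x \<and> mul A x e = x)"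

definition pair_complement ::
  "('k::comm_ring_1, 'a::ab_group_add) superalg \<Rightarrow> 'a set \<Rightarrow> 'a set \<Rightarrow> bool" where
  "pair_complement A \<aa> \<cc> \<longleftrightarrow> module.subspace (smul A) \<cc> \<and> direct_sum (even_part A) \<aa> \<cc>"

definition pair_basis ::
  "('k::comm_ring_1, 'a::ab_group_add) superalg \<Rightarrow> 'a set \<Rightarrow> 'a set \<Rightarrow> 'a set \<Rightarrow> 'a set \<Rightarrow> 'a set \<Rightarrow> bool" where
  "pair_basis A \<aa> \<cc> B\<aa> B\<cc> B1 \<longleftrightarrow>
     pair_complement A \<aa> \<cc> \<and>
     module_basis (smul A) \<aa> B\<aa> \<and> module_basis (smul A) \<cc> B\<cc> \<and>
     module_basis (smul A) (odd_part A) B1"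

definition pair_symmetrizing_form ::
  "('k::comm_ring_1, 'a::ab_group_add) superalg \<Rightarrow> 'a set \<Rightarrow> ('a \<Rightarrow> 'k) \<Rightarrow> bool" where
  "pair_symmetrizing_form A \<aa> t \<longleftrightarrow>
     symmetrizing_form A t \<and>
     (\<forall>x\<in>\<aa>. \<forall>y\<in>\<aa>. t (mul A x y) = 0) \<and>
     (\<exists>\<cc>. pair_complement A \<aa> \<cc> \<and> perfect_pairing A t \<aa> \<cc>)"


section \<open>Tensor powers of a free superalgebra\<close>

text \<open>
  The \<open>d\<close>-th tensor power of a superalgebra \<open>M\<close> that is free with finite homogeneous basis \<open>E\<close>
  is the free module on the words of length \<open>d\<close> in \<open>E\<close>: its elements are the functions from
  words to scalars that vanish off \<open>words d E\<close>.  Then \<open>tens M E [x\<^sub>1, \<dots>, x\<^sub>d]\<close> is the pure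
  tensor of arbitrary \<open>x\<^sub>i\<close> in \<open>M\<close>; the lemmas \<open>tens_multilinear\<close> and \<open>tens_universal\<close> below
  give its universal property, and \<open>tensor_mul_tens\<close> and \<open>tensor_act_tens\<close> describe the product
  and the action of permutations on pure tensors of arbitrary homogeneous elements.  Positions
  in a word are numbered from \<open>0\<close>.
\<close>

definition words :: "nat \<Rightarrow> 'm set \<Rightarrow> 'm list set" where
  "words d E = {w. set w \<subseteq> E \<and> length w = d}"

definition fscale :: "'k::comm_ring_1 \<Rightarrow> ('i \<Rightarrow> 'k) \<Rightarrow> 'i \<Rightarrow> 'k" where
  "fscale c f = (\<lambda>w. c * f w)"

definition tens :: "('k::comm_ring_1, 'm::ab_group_add) superalg \<Rightarrow> 'm set \<Rightarrow> 'm list \<Rightarrow> 'm list \<Rightarrow> 'k" where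
  "tens M E xs = (\<lambda>w. if w \<in> words (length xs) E
                       then \<Prod>i<length xs. module.representation (smul M) E (xs ! i) (w ! i) else 0)"

text \<open>
  The sign of \<open>(u\<^sub>1 \<otimes> \<dots> \<otimes> u\<^sub>d)(v\<^sub>1 \<otimes> \<dots> \<otimes> v\<^sub>d)\<close>, obtained by iterating the rule for two factors:
  every \<open>v\<^sub>j\<close> moves past all \<open>u\<^sub>i\<close> with \<open>i > j\<close>.
\<close>

definition mul_sign :: "('k::comm_ring_1, 'm) superalg \<Rightarrow> 'm list \<Rightarrow> 'm list \<Rightarrow> 'k" where
  "mul_sign M u v =
     (- 1) ^ card {(i, j). j < i \<and> i < length u \<and> u ! i \<in> odd_part M \<and> v ! j \<in> odd_part M}"

definition tensor_mul ::
  "('k::comm_ring_1, 'm::ab_group_add) superalg \<Rightarrow> 'm set \<Rightarrow> nat \<Rightarrow> ('m list \<Rightarrow> 'k) \<Rightarrow> ('m list \<Rightarrow> 'k) \<Rightarrow> 'm list \<Rightarrow> 'k" where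
  "tensor_mul M E d f g =
     (\<Sum>u\<in>words d E. \<Sum>v\<in>words d E. fscale (f u * g v * mul_sign M u v) (tens M E (map2 (mul M) u v)))"

definition odd_count :: "('k, 'm) superalg \<Rightarrow> 'm list \<Rightarrow> nat" where
  "odd_count M w = card {i. i < length w \<and> w ! i \<in> odd_part M}"

definition tensor_power ::
  "('k::comm_ring_1, 'm::ab_group_add) superalg \<Rightarrow> 'm set \<Rightarrow> nat \<Rightarrow> ('k, 'm list \<Rightarrow> 'k) superalg" where
  "tensor_power M E d =
     \<lparr>carr = {f. \<forall>w. f w \<noteq> 0 \<longrightarrow> w \<in> words d E},
      smul = fscale,
      mul = tensor_mul M E d,
      even_part = {f. \<forall>w. f w \<noteq> 0 \<longrightarrow> w \<in> words d E \<and> even (odd_count M w)},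
      odd_part = {f. \<forall>w. f w \<noteq> 0 \<longrightarrow> w \<in> words d E \<and> odd (odd_count M w)}\<rparr>"

text \<open>The exponent \<open>\<langle>\<sigma>; x\<rangle>\<close> for a word of homogeneous letters.\<close>

definition inversions :: "('k, 'm) superalg \<Rightarrow> (nat \<Rightarrow> nat) \<Rightarrow> 'm list \<Rightarrow> nat" where
  "inversions M \<sigma> x =
     card {(k, l). k < l \<and> l < length x \<and> inv \<sigma> k > inv \<sigma> l \<and> x ! k \<in> odd_part M \<and> x ! l \<in> odd_part M}"

definition tensor_act ::
  "('k::comm_ring_1, 'm::ab_group_add) superalg \<Rightarrow> 'm set \<Rightarrow> nat \<Rightarrow> (nat \<Rightarrow> nat) \<Rightarrow> ('m list \<Rightarrow> 'k) \<Rightarrow> 'm list \<Rightarrow> 'k" where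
  "tensor_act M E d \<sigma> f =
     (\<Sum>u\<in>words d E. fscale (f u * (- 1) ^ inversions M \<sigma> u) (tens M E (permute_list \<sigma> u)))"

definition sub_superalg :: "('k, 'm) superalg \<Rightarrow> 'm set \<Rightarrow> ('k, 'm) superalg" where
  "sub_superalg M X = M\<lparr>carr := X, even_part := even_part M \<inter> X, odd_part := odd_part M \<inter> X\<rparr>"

definition tensor_invariants ::
  "('k::comm_ring_1, 'm::ab_group_add) superalg \<Rightarrow> 'm set \<Rightarrow> nat \<Rightarrow> ('k, 'm list \<Rightarrow> 'k) superalg" where
  "tensor_invariants M E d =
     sub_superalg (tensor_power M E d)
       {f \<in> carr (tensor_power M E d). \<forall>\<sigma>. \<sigma> permutes {..<d} \<longrightarrow> tensor_act M E d \<sigma> f = f}"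


section \<open>Matrices\<close>

text \<open>Matrix indices range over a finite type \<open>'n\<close>, so that \<open>n = CARD('n) \<ge> 1\<close>.\<close>

definition mat_superalg :: "('k, 'a::ab_group_add) superalg \<Rightarrow> ('k, 'a^'n::finite^'n) superalg" where
  "mat_superalg A =
     \<lparr>carr = {X. \<forall>i j. X $ i $ j \<in> carr A},
      smul = (\<lambda>c X. \<chi> i j. smul A c (X $ i $ j)),
      mul = (\<lambda>X Y. \<chi> i j. \<Sum>k\<in>UNIV. mul A (X $ i $ k) (Y $ k $ j)),
      even_part = {X. \<forall>i j. X $ i $ j \<in> even_part A},
      odd_part = {X. \<forall>i j. X $ i $ j \<in> odd_part A}\<rparr>"

definition munit :: "'a::zero \<Rightarrow> 'n \<Rightarrow> 'n \<Rightarrow> 'a^'n::finite^'n" where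
  "munit a r s = (\<chi> i j. if i = r \<and> j = s then a else 0)"

definition mat_basis :: "'a::zero set \<Rightarrow> ('a^'n::finite^'n) set" where
  "mat_basis B = {munit b r s |b r s. b \<in> B}"


section \<open>Generalized Schur superalgebras\<close>

definition schur_superalg ::
  "('k::comm_ring_1, 'a::ab_group_add) superalg \<Rightarrow> 'a set \<Rightarrow> nat \<Rightarrow>
   ('k, ('a^'n::finite^'n) list \<Rightarrow> 'k) superalg" where
  "schur_superalg A B d = tensor_invariants (mat_superalg A) (mat_basis B) d"

definition Tri ::
  "('k, 'a) superalg \<Rightarrow> 'a set \<Rightarrow> nat \<Rightarrow> ('a list \<times> 'n::finite list \<times> 'n list) set" where
  "Tri A B d =
     {(b, r, s). b \<in> words d B \<and> length r = d \<and> length s = d \<and>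
        (\<forall>k<d. \<forall>l<d. k \<noteq> l \<and> (b ! k, r ! k, s ! k) = (b ! l, r ! l, s ! l) \<longrightarrow> b ! k \<in> even_part A)}"

definition triple_stab :: "nat \<Rightarrow> 'a list \<Rightarrow> 'n list \<Rightarrow> 'n list \<Rightarrow> (nat \<Rightarrow> nat) set" where
  "triple_stab d b r s =
     {\<sigma>. \<sigma> permutes {..<d} \<and> permute_list \<sigma> b = b \<and> permute_list \<sigma> r = r \<and> permute_list \<sigma> s = s}"

text \<open>
  The cosets \<open>H\<sigma>\<close> of the stabilizer \<open>H\<close>.  On a triple in \<open>Tri\<close> the group \<open>H\<close> acts without
  signs, so the sum in \<open>xi\<close> does not depend on the representatives.
\<close>

definition stab_cosets :: "nat \<Rightarrow> 'a list \<Rightarrow> 'n list \<Rightarrow> 'n list \<Rightarrow> (nat \<Rightarrow> nat) set set" where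
  "stab_cosets d b r s = {(\<lambda>\<tau>. \<tau> \<circ> \<sigma>) ` triple_stab d b r s |\<sigma>. \<sigma> permutes {..<d}}"

definition xi_tensor ::
  "('k::comm_ring_1, 'a::ab_group_add) superalg \<Rightarrow> 'a set \<Rightarrow> 'a list \<Rightarrow> 'n::finite list \<Rightarrow> 'n list \<Rightarrow>
   ('a^'n^'n) list \<Rightarrow> 'k" where
  "xi_tensor A B b r s =
     tens (mat_superalg A) (mat_basis B) (map (\<lambda>(b, r, s). munit b r s) (zip b (zip r s)))"

definition xi ::
  "('k::comm_ring_1, 'a::ab_group_add) superalg \<Rightarrow> 'a set \<Rightarrow> nat \<Rightarrow> 'a list \<Rightarrow> 'n::finite list \<Rightarrow> 'n list \<Rightarrow>
   ('a^'n^'n) list \<Rightarrow> 'k" where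
  "xi A B d b r s =
     (\<Sum>K\<in>stab_cosets d b r s.
        tensor_act (mat_superalg A) (mat_basis B) d (SOME \<sigma>. \<sigma> \<in> K) (xi_tensor A B b r s))"

definition triple_count :: "'a list \<Rightarrow> 'n list \<Rightarrow> 'n list \<Rightarrow> 'a \<Rightarrow> 'n \<Rightarrow> 'n \<Rightarrow> nat" where
  "triple_count b r s x p q = card {k. k < length b \<and> (b ! k, r ! k, s ! k) = (x, p, q)}"

definition triple_fact :: "'a set \<Rightarrow> 'a list \<Rightarrow> 'n::finite list \<Rightarrow> 'n list \<Rightarrow> nat" where
  "triple_fact B\<cc> b r s = (\<Prod>x\<in>B\<cc>. \<Prod>p\<in>UNIV. \<Prod>q\<in>UNIV. fact (triple_count b r s x p q))"

definition eta ::
  "('k::comm_ring_1, 'a::ab_group_add) superalg \<Rightarrow> 'a set \<Rightarrow> 'a set \<Rightarrow> nat \<Rightarrow>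
   'a list \<Rightarrow> 'n::finite list \<Rightarrow> 'n list \<Rightarrow> ('a^'n^'n) list \<Rightarrow> 'k" where
  "eta A B B\<cc> d b r s = fscale (of_nat (triple_fact B\<cc> b r s)) (xi A B d b r s)"

text \<open>
  \<open>B\<close> is the whole basis of \<open>A\<close> and \<open>B\<cc>\<close> the part of it that spans the complement.  The span
  lies in \<open>schur_superalg\<close>, see \<open>T_superalg_in_schur\<close> below.
\<close>

definition T_superalg ::
  "('k::comm_ring_1, 'a::ab_group_add) superalg \<Rightarrow> 'a set \<Rightarrow> 'a set \<Rightarrow> nat \<Rightarrow>
   ('k, ('a^'n::finite^'n) list \<Rightarrow> 'k) superalg" where
  "T_superalg A B B\<cc> d =
     sub_superalg (schur_superalg A B d)
       (module.span fscale {eta A B B\<cc> d b r s |b r s. (b, r, s) \<in> Tri A B d})"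


section \<open>The tensor power and the span of the \<open>eta\<close> behave as intended\<close>

definition multilinear_on ::
  "('k::comm_ring_1 \<Rightarrow> 'm::ab_group_add \<Rightarrow> 'm) \<Rightarrow> 'm set \<Rightarrow> nat \<Rightarrow> ('k \<Rightarrow> 'l::ab_group_add \<Rightarrow> 'l) \<Rightarrow> ('m list \<Rightarrow> 'l) \<Rightarrow> bool" where
  "multilinear_on s X d s' f \<longleftrightarrow>
     (\<forall>xs\<in>words d X. \<forall>i<d. \<forall>x\<in>X. \<forall>y\<in>X. f (xs[i := x + y]) = f (xs[i := x]) + f (xs[i := y])) \<and>
     (\<forall>xs\<in>words d X. \<forall>i<d. \<forall>x\<in>X. \<forall>c. f (xs[i := s c x]) = s' c (f (xs[i := x])))"

lemma multilinear_onI: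
  assumes "\<And>xs i x y. xs \<in> words d X \<Longrightarrow> i < d \<Longrightarrow> x \<in> X \<Longrightarrow> y \<in> X \<Longrightarrow>
      f (xs[i := x + y]) = f (xs[i := x]) + f (xs[i := y])"
    and "\<And>xs i x c. xs \<in> words d X \<Longrightarrow> i < d \<Longrightarrow> x \<in> X \<Longrightarrow> f (xs[i := s c x]) = s' c (f (xs[i := x]))"
  shows "multilinear_on s X d s' f"
  using assms unfolding multilinear_on_def by blast

lemma module_fscale: "module (fscale :: 'k::comm_ring_1 \<Rightarrow> ('i \<Rightarrow> 'k) \<Rightarrow> 'i \<Rightarrow> 'k)"
  by unfold_locales (auto simp: fscale_def algebra_simps fun_eq_iff)

lemma fsum_apply: "(\<Sum>i\<in>I. f i) w = (\<Sum>i\<in>I. f i w)" for f :: "'i \<Rightarrow> 'j \<Rightarrow> 'k::comm_ring_1"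
  by (induction I rule: infinite_finite_induct) auto

lemma finite_words: "finite E \<Longrightarrow> finite (words d E)"
  unfolding words_def by (rule finite_lists_length_eq)

lemma words_0 [simp]: "words 0 E = {[]}"
  by (auto simp: words_def)

lemma words_Suc: "words (Suc d) E = (\<lambda>(e, w). e # w) ` (E \<times> words d E)"
proof -
  have "\<exists>e w'. w = e # w' \<and> e \<in> E \<and> set w' \<subseteq> E \<and> length w' = d"
    if "set w \<subseteq> E" "length w = Suc d" for w
    using that by (cases w) auto
  then show ?thesis
    by (fastforce simp: words_def)
qed

lemma sum_words_Suc:
  assumes "finite E"
  shows "(\<Sum>w\<in>words (Suc d) E. h w) = (\<Sum>e\<in>E. \<Sum>w\<in>words d E. h (e # w))"
proof -
  have "(\<Sum>w\<in>words (Suc d) E. h w) = (\<Sum>p\<in>E \<times> words d E. h (fst p # snd p))"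
    unfolding words_Suc by (subst sum.reindex) (auto simp: inj_on_def case_prod_unfold)
  then show ?thesis
    by (simp add: sum.cartesian_product case_prod_unfold)
qed

lemma tens_multilinear:
  assumes m: "module (smul M)" and b: "module_basis (smul M) (carr M) E"
  shows "multilinear_on (smul M) (carr M) d fscale (tens M E)"
proof -
  interpret module "smul M" by fact
  have E: "independent E" "span E = carr M"
    using b by (auto simp: module_basis_def)
  have split: "(\<Prod>j<d. representation E (xs[i := z] ! j) (w ! j)) =
      representation E z (w ! i) * (\<Prod>j\<in>{..<d} - {i}. representation E (xs ! j) (w ! j))"
    if "i < d" "length xs = d" for xs i z w
  proof -
    have "(\<Prod>j<d. representation E (xs[i := z] ! j) (w ! j)) =
        representation E (xs[i := z] ! i) (w ! i) *
        (\<Prod>j\<in>{..<d} - {i}. representation E (xs[i := z] ! j) (w ! j))"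
      using that by (subst prod.remove[of _ i]) auto
    also have "(\<Prod>j\<in>{..<d} - {i}. representation E (xs[i := z] ! j) (w ! j)) =
        (\<Prod>j\<in>{..<d} - {i}. representation E (xs ! j) (w ! j))"
      by (rule prod.cong) auto
    finally show ?thesis using that by simp
  qed
  have len: "length xs = d" if "xs \<in> words d (carr M)" for xs
    using that by (simp add: words_def)
  show ?thesis
    unfolding multilinear_on_def
  proof (intro conjI ballI allI impI)
    fix xs i x y assume "xs \<in> words d (carr M)" "i < d" "x \<in> carr M" "y \<in> carr M"
    with len[of xs] E show "tens M E (xs[i := x + y]) = tens M E (xs[i := x]) + tens M E (xs[i := y])"
      by (auto simp: tens_def fun_eq_iff split representation_add distrib_right)
  next
    fix xs i x c assume "xs \<in> words d (carr M)" "i < d" "x \<in> carr M"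
    with len[of xs] E show "tens M E (xs[i := smul M c x]) = fscale c (tens M E (xs[i := x]))"
      by (auto simp: tens_def fun_eq_iff split representation_scale fscale_def mult.assoc)
  qed
qed

lemma multilinear_on_Cons:
  assumes f: "multilinear_on s X (Suc d) s' f" and x: "x \<in> X"
  shows "multilinear_on s X d s' (\<lambda>ys. f (x # ys))"
  unfolding multilinear_on_def
proof (intro conjI ballI allI impI)
  fix xs i y z assume *: "xs \<in> words d X" "i < d" "y \<in> X" "z \<in> X"
  then have "x # xs \<in> words (Suc d) X" "Suc i < Suc d"
    using x by (auto simp: words_def)
  then have "f ((x # xs)[Suc i := y + z]) = f ((x # xs)[Suc i := y]) + f ((x # xs)[Suc i := z])"
    using f * unfolding multilinear_on_def by blast
  then show "f (x # xs[i := y + z]) = f (x # xs[i := y]) + f (x # xs[i := z])" by simp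
next
  fix xs i y c assume *: "xs \<in> words d X" "i < d" "y \<in> X"
  then have "x # xs \<in> words (Suc d) X" "Suc i < Suc d"
    using x by (auto simp: words_def)
  then have "f ((x # xs)[Suc i := s c y]) = s' c (f ((x # xs)[Suc i := y]))"
    using f * unfolding multilinear_on_def by blast
  then show "f (x # xs[i := s c y]) = s' c (f (x # xs[i := y]))" by simp
qed

lemma multilinear_expand:
  assumes m: "module s" and m': "module s'" and fin: "finite E"
    and b: "module_basis s X E"
    and f: "multilinear_on s X d s' f" and xs: "xs \<in> words d X"
  shows "f xs = (\<Sum>w\<in>words d E. s' (\<Prod>i<d. module.representation s E (xs ! i) (w ! i)) (f w))"
  using f xs
proof (induction d arbitrary: f xs)
  case 0
  interpret t: module s' by fact
  show ?case using 0 by simp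
next
  case (Suc d)
  interpret module s by fact
  interpret t: module s' by fact
  have E: "independent E" "span E = X"
    using b by (auto simp: module_basis_def)
  obtain x ys where xs: "xs = x # ys" "x \<in> X" "ys \<in> words d X"
    using Suc.prems(2) by (auto simp: words_Suc)
  have EX: "E \<subseteq> X" using span_superset E by auto
  have add: "f ((y + z) # ys) = f (y # ys) + f (z # ys)" if "y \<in> X" "z \<in> X" for y z
  proof -
    have "f ((x # ys)[0 := y + z]) = f ((x # ys)[0 := y]) + f ((x # ys)[0 := z])"
      using Suc.prems that xs unfolding multilinear_on_def by blast
    then show ?thesis by simp
  qed
  have sc: "f (s c y # ys) = s' c (f (y # ys))" if "y \<in> X" for y c
  proof -
    have "f ((x # ys)[0 := s c y]) = s' c (f ((x # ys)[0 := y]))"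
      using Suc.prems that xs unfolding multilinear_on_def by blast
    then show ?thesis by simp
  qed
  have X: "subspace X" using subspace_span E by metis
  have zero: "f (0 # ys) = 0"
    using sc[of 0 0] X by (auto simp: subspace_0)
  have lin: "f ((\<Sum>e\<in>F. s (c e) e) # ys) = (\<Sum>e\<in>F. s' (c e) (f (e # ys)))" if "F \<subseteq> E" for F c
    using finite_subset[OF that fin] that
  proof (induction F rule: finite_induct)
    case empty
    then show ?case by (simp add: zero)
  next
    case (insert e F)
    have "(\<Sum>e\<in>F. s (c e) e) \<in> X"
      using insert EX X by (intro subspace_sum subspace_scale) auto
    moreover have "s (c e) e \<in> X" "e \<in> X" using insert EX X by (auto intro: subspace_scale)
    ultimately show ?case using insert by (simp add: add sc)
  qed
  have "x = (\<Sum>e\<in>E. s (representation E x e) e)"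
    using sum_representation_eq[OF E(1) _ fin order_refl, of x] xs E by auto
  then have "f xs = f ((\<Sum>e\<in>E. s (representation E x e) e) # ys)" using xs by simp
  also have "\<dots> = (\<Sum>e\<in>E. s' (representation E x e) (f (e # ys)))"
    by (rule lin) simp
  also have "\<dots> = (\<Sum>e\<in>E. s' (representation E x e)
      (\<Sum>w\<in>words d E. s' (\<Prod>i<d. representation E (ys ! i) (w ! i)) (f (e # w))))"
    using Suc.IH[OF multilinear_on_Cons[OF Suc.prems(1)] xs(3)] EX by (intro sum.cong) auto
  also have "\<dots> = (\<Sum>e\<in>E. \<Sum>w\<in>words d E.
      s' (\<Prod>i<Suc d. representation E (xs ! i) ((e # w) ! i)) (f (e # w)))"
    by (simp add: t.scale_sum_right prod.lessThan_Suc_shift xs(1) del: prod.lessThan_Suc)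
  also have "\<dots> = (\<Sum>w\<in>words (Suc d) E. s' (\<Prod>i<Suc d. representation E (xs ! i) (w ! i)) (f w))"
    by (subst sum_words_Suc[OF fin]) simp
  finally show ?case .
qed

lemma tens_word:
  assumes m: "module (smul M)" and b: "module_basis (smul M) (carr M) E" and u: "u \<in> words d E"
  shows "tens M E u = (\<lambda>w. if w = u then 1 else 0)"
proof
  fix w
  interpret module "smul M" by fact
  have E: "independent E" using b by (auto simp: module_basis_def)
  have ui: "u ! i \<in> E" if "i < d" for i using u that by (auto simp: words_def)
  have len: "length u = d" using u by (auto simp: words_def)
  show "tens M E u w = (if w = u then 1 else 0)"
  proof (cases "w \<in> words d E")
    case True
    then have lw: "length w = d" by (auto simp: words_def)
    have "tens M E u w = (\<Prod>i<d. if w ! i = u ! i then 1 else 0)"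
      using True len ui by (auto simp: tens_def representation_basis[OF E] intro!: prod.cong)
    also have "\<dots> = (if w = u then 1 else 0)"
    proof (cases "w = u")
      case False
      then obtain i where "i < d" "w ! i \<noteq> u ! i" using lw len by (metis nth_equalityI)
      then have "(\<Prod>i<d. if w ! i = u ! i then 1 else (0::'a)) = 0"
        by (intro prod_zero) auto
      then show ?thesis using False by simp
    qed simp
    finally show ?thesis .
  next
    case False
    then show ?thesis using u len by (auto simp: tens_def)
  qed
qed

lemma tens_in_carr: "length xs = d \<Longrightarrow> tens M E xs \<in> carr (tensor_power M E d)"
  by (auto simp: tensor_power_def tens_def)

lemma tens_expand:
  assumes m: "module (smul M)" and b: "module_basis (smul M) (carr M) E" and fin: "finite E"
    and f: "f \<in> carr (tensor_power M E d)"
  shows "f = (\<Sum>u\<in>words d E. fscale (f u) (tens M E u))"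
proof
  fix w
  have "(\<Sum>u\<in>words d E. fscale (f u) (tens M E u)) w = (\<Sum>u\<in>words d E. if u = w then f u else 0)"
    unfolding fsum_apply by (intro sum.cong) (auto simp: fscale_def tens_word[OF m b])
  also have "\<dots> = f w"
    using f finite_words[OF fin] by (auto simp: tensor_power_def)
  finally show "f w = (\<Sum>u\<in>words d E. fscale (f u) (tens M E u)) w" by simp
qed

theorem tens_universal:
  fixes f :: "'m::ab_group_add list \<Rightarrow> 'l::ab_group_add"
  assumes m: "module (smul M)" and b: "module_basis (smul M) (carr M) E" and fin: "finite E"
    and m': "module s'" and f: "multilinear_on (smul M) (carr M) d s' f"
  shows "\<exists>!g. g \<in> extensional (carr (tensor_power M E d)) \<and>
    (\<forall>x\<in>carr (tensor_power M E d). \<forall>y\<in>carr (tensor_power M E d). g (x + y) = g x + g y) \<and>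
    (\<forall>c. \<forall>x\<in>carr (tensor_power M E d). g (fscale c x) = s' c (g x)) \<and>
    (\<forall>xs\<in>words d (carr M). g (tens M E xs) = f xs)"
    (is "\<exists>!g. ?P g")
proof -
  interpret module "smul M" by fact
  interpret t: module s' by fact
  let ?T = "carr (tensor_power M E d)"
  have EX: "E \<subseteq> carr M" using b span_superset by (auto simp: module_basis_def)
  define g where "g = (\<lambda>x\<in>?T. \<Sum>w\<in>words d E. s' (x w) (f w))"
  have addT: "x + y \<in> ?T" if "x \<in> ?T" "y \<in> ?T" for x y
    using that by (auto simp: tensor_power_def) (metis add.right_neutral)
  have scT: "fscale c x \<in> ?T" if "x \<in> ?T" for x c
  proof -
    have "x w \<noteq> 0" if "c * x w \<noteq> 0" for w using that by auto
    then show ?thesis using that by (auto simp: tensor_power_def fscale_def)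
  qed
  have gt: "g (tens M E xs) = f xs" if "xs \<in> words d (carr M)" for xs
  proof -
    have l: "length xs = d" using that by (auto simp: words_def)
    have "g (tens M E xs) =
        (\<Sum>w\<in>words d E. s' (\<Prod>i<d. representation E (xs ! i) (w ! i)) (f w))"
      using tens_in_carr[OF l] l by (auto simp: g_def tens_def intro!: sum.cong)
    then show ?thesis using multilinear_expand[OF m m' fin b f that] by simp
  qed
  show ?thesis
  proof (rule ex1I[of _ g])
    show "?P g"
      using gt addT scT
      by (simp add: g_def t.scale_left_distrib sum.distrib t.scale_sum_right fscale_def)
  next
    fix h assume h: "?P h"
    show "h = g"
    proof (rule extensionalityI[of _ ?T])
      show "h \<in> extensional ?T" using h by blast
      show "g \<in> extensional ?T" by (simp add: g_def)
      fix x assume x: "x \<in> ?T"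
      have ft: "tens M E u \<in> ?T" if "u \<in> words d E" for u
        by (rule tens_in_carr) (use that in \<open>auto simp: words_def\<close>)
      have 0: "0 \<in> ?T" by (auto simp: tensor_power_def)
      have h0: "h 0 = 0" using h 0 by (metis add_cancel_right_right)
      have "h (\<Sum>u\<in>F. fscale (x u) (tens M E u)) = (\<Sum>u\<in>F. s' (x u) (f u)) \<and>
            (\<Sum>u\<in>F. fscale (x u) (tens M E u)) \<in> ?T" if "finite F" "F \<subseteq> words d E" for F
        using that
      proof (induction F rule: finite_induct)
        case empty
        then show ?case using h0 0 by (simp add: zero_fun_def)
      next
        case (insert u F)
        have u: "u \<in> words d E" "u \<in> words d (carr M)" using insert EX by (auto simp: words_def)
        have hu: "h (fscale (x u) (tens M E u)) = s' (x u) (f u)"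
          using h ft[OF u(1)] u by simp
        have "h (fscale (x u) (tens M E u) + (\<Sum>u\<in>F. fscale (x u) (tens M E u))) =
            h (fscale (x u) (tens M E u)) + h (\<Sum>u\<in>F. fscale (x u) (tens M E u))"
          using insert h scT[OF ft[OF u(1)]] by blast
        also have "\<dots> = (\<Sum>u\<in>insert u F. s' (x u) (f u))"
          unfolding sum.insert[OF insert.hyps] hu using insert by simp
        finally have "h (\<Sum>u\<in>insert u F. fscale (x u) (tens M E u)) =
            (\<Sum>u\<in>insert u F. s' (x u) (f u))"
          unfolding sum.insert[OF insert.hyps] .
        moreover have "(\<Sum>u\<in>insert u F. fscale (x u) (tens M E u)) \<in> ?T"
          unfolding sum.insert[OF insert.hyps]
          by (rule addT[OF scT[OF ft[OF u(1)]]]) (use insert in blast)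
        ultimately show ?case by (rule conjI)
      qed
      from this[OF finite_words[OF fin] order_refl]
      have "h x = (\<Sum>u\<in>words d E. s' (x u) (f u))"
        using tens_expand[OF m b fin x] by simp
      then show "h x = g x" using x by (simp add: g_def)
    qed
  qed
qed


lemma representation_parity:
  assumes M: "superalgebra M" and b: "module_basis (smul M) (carr M) E" and fin: "finite E"
    and E: "E \<subseteq> even_part M \<union> odd_part M"
    and x: "x \<in> even_part M \<union> odd_part M"
    and e: "module.representation (smul M) E x e \<noteq> 0"
  shows "e \<in> odd_part M \<longleftrightarrow> x \<in> odd_part M"
proof -
  interpret module "smul M" using M by (simp add: superalgebra_def)
  have ind: "independent E" "span E = carr M" using b by (auto simp: module_basis_def)
  have sub: "subspace (even_part M)" "subspace (odd_part M)"
    and ds: "direct_sum (carr M) (even_part M) (odd_part M)"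
    using M by (auto simp: superalgebra_def)
  have disj: "even_part M \<inter> odd_part M = {0}" using ds by (simp add: direct_sum_def)
  have carr: "even_part M \<subseteq> carr M" "odd_part M \<subseteq> carr M"
    using ds subspace_0[OF sub(1)] subspace_0[OF sub(2)]
    by (auto simp: direct_sum_def) (metis add.right_neutral, metis add.left_neutral)
  have nz: "y \<noteq> 0" if "y \<in> E" for y using ind that dependent_zero by blast
  have key: "e \<in> X" if X: "subspace X" "subspace Y" "X \<inter> Y = {0}" "E \<subseteq> X \<union> Y" "x \<in> X" for X Y
  proof (rule ccontr)
    assume "e \<notin> X"
    let ?r = "representation E x"
    have eE: "e \<in> E" using e representation_ne_zero by blast
    have "x = (\<Sum>y\<in>E. smul M (?r y) y)"
      using sum_representation_eq[OF ind(1) _ fin order_refl, of x] x ind carr by auto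
    also have "\<dots> = (\<Sum>y\<in>E \<inter> X. smul M (?r y) y) + (\<Sum>y\<in>E - X. smul M (?r y) y)"
      using fin by (rule sum.Int_Diff)
    finally have "(\<Sum>y\<in>E - X. smul M (?r y) y) = x - (\<Sum>y\<in>E \<inter> X. smul M (?r y) y)"
      by (simp add: algebra_simps)
    also have "\<dots> \<in> X"
      using X by (intro subspace_diff subspace_sum subspace_scale) auto
    finally have 1: "(\<Sum>y\<in>E - X. smul M (?r y) y) \<in> X" .
    have "(\<Sum>y\<in>E - X. smul M (?r y) y) \<in> Y"
      using X by (intro subspace_sum subspace_scale) auto
    with 1 X have "(\<Sum>y\<in>E - X. smul M (?r y) y) = 0" by blast
    then have "?r e = 0"
      using independentD[OF ind(1), of "E - X" ?r e] fin eE \<open>e \<notin> X\<close> by auto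
    with e show False by simp
  qed
  have "e \<in> E" using e representation_ne_zero by blast
  show ?thesis
  proof (cases "x \<in> odd_part M")
    case True
    then show ?thesis using key[OF sub(2,1)] disj E by auto
  next
    case False
    then have "e \<in> even_part M" using key[OF sub disj E] x by auto
    then show ?thesis using False disj nz[OF \<open>e \<in> E\<close>] by auto
  qed
qed

lemma tens_parity:
  assumes M: "superalgebra M" and b: "module_basis (smul M) (carr M) E" and fin: "finite E"
    and E: "E \<subseteq> even_part M \<union> odd_part M"
    and xs: "xs \<in> words d (even_part M \<union> odd_part M)"
    and u: "tens M E xs u \<noteq> 0" and i: "i < d"
  shows "u ! i \<in> odd_part M \<longleftrightarrow> xs ! i \<in> odd_part M"
proof (rule representation_parity[OF M b fin E])
  show "xs ! i \<in> even_part M \<union> odd_part M" using xs i nth_mem by (fastforce simp: words_def)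
  have l: "length xs = d" using xs by (simp add: words_def)
  have "(\<Prod>i<d. module.representation (smul M) E (xs ! i) (u ! i)) \<noteq> 0"
    using u l by (auto simp: tens_def split: if_splits)
  then show "module.representation (smul M) E (xs ! i) (u ! i) \<noteq> 0"
    using i by (metis finite_lessThan lessThan_iff prod_zero)
qed

lemma homogeneous_in_carr:
  assumes M: "superalgebra M"
  shows "even_part M \<union> odd_part M \<subseteq> carr M"
proof -
  interpret module "smul M" using M by (simp add: superalgebra_def)
  have sub: "subspace (even_part M)" "subspace (odd_part M)"
    and ds: "direct_sum (carr M) (even_part M) (odd_part M)"
    using M by (auto simp: superalgebra_def)
  show ?thesis
    using ds subspace_0[OF sub(1)] subspace_0[OF sub(2)]
    by (auto simp: direct_sum_def) (metis add.right_neutral, metis add.left_neutral)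
qed

lemma multilinear_onD:
  assumes "multilinear_on s X d s' f" "xs \<in> words d X" "i < d" "x \<in> X"
  shows "y \<in> X \<Longrightarrow> f (xs[i := x + y]) = f (xs[i := x]) + f (xs[i := y])"
    and "f (xs[i := s c x]) = s' c (f (xs[i := x]))"
  using assms unfolding multilinear_on_def by blast+

lemma tens_expand_multilinear:
  assumes m: "module (smul M)" and b: "module_basis (smul M) (carr M) E" and fin: "finite E"
    and m': "module s'"
    and f: "multilinear_on (smul M) (carr M) d s' f" and xs: "xs \<in> words d (carr M)"
  shows "f xs = (\<Sum>u\<in>words d E. s' (tens M E xs u) (f u))"
  using multilinear_expand[OF m m' fin b f xs] xs
  by (auto simp: tens_def words_def intro!: sum.cong)

theorem tensor_mul_tens:
  assumes M: "superalgebra M" and b: "module_basis (smul M) (carr M) E" and fin: "finite E"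
    and E: "E \<subseteq> even_part M \<union> odd_part M"
    and xs: "xs \<in> words d (even_part M \<union> odd_part M)"
    and ys: "ys \<in> words d (even_part M \<union> odd_part M)"
  shows "tensor_mul M E d (tens M E xs) (tens M E ys) =
         fscale (mul_sign M xs ys) (tens M E (map2 (mul M) xs ys))"
proof -
  have m: "module (smul M)" using M by (simp add: superalgebra_def)
  interpret f: module "fscale :: 'a \<Rightarrow> ('b list \<Rightarrow> 'a) \<Rightarrow> 'b list \<Rightarrow> 'a" by (rule module_fscale)
  note hc = homogeneous_in_carr[OF M]
  note ml = tens_multilinear[OF m b, of d]
  have lxy: "length xs = d" "length ys = d" using xs ys by (auto simp: words_def)
  have xsc: "xs \<in> words d (carr M)" and ysc: "ys \<in> words d (carr M)"
    using xs ys hc by (auto simp: words_def)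
  have upd: "map2 (mul M) (us[i := z]) vs = (map2 (mul M) us vs)[i := mul M z (vs ! i)]"
    "map2 (mul M) us (vs[i := z]) = (map2 (mul M) us vs)[i := mul M (us ! i) z]"
    if "length us = d" "length vs = d" "i < d" for us vs z i
    using that by (auto intro!: nth_equalityI simp: nth_list_update)
  have bil: "\<forall>x\<in>carr M. \<forall>y\<in>carr M. mul M x y \<in> carr M"
    "\<forall>x\<in>carr M. \<forall>y\<in>carr M. \<forall>z\<in>carr M. mul M (x + y) z = mul M x z + mul M y z"
    "\<forall>x\<in>carr M. \<forall>y\<in>carr M. \<forall>z\<in>carr M. mul M x (y + z) = mul M x y + mul M x z"
    "\<forall>c. \<forall>x\<in>carr M. \<forall>y\<in>carr M. mul M (smul M c x) y = smul M c (mul M x y)"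
    "\<forall>c. \<forall>x\<in>carr M. \<forall>y\<in>carr M. mul M x (smul M c y) = smul M c (mul M x y)"
    by (insert M, unfold superalgebra_def, (elim conjE, assumption)+)
  have nthc: "us ! i \<in> carr M" "length us = d" if "us \<in> words d (carr M)" "i < d" for us i
    using that by (auto simp: words_def)
  have mw: "map2 (mul M) us vs \<in> words d (carr M)"
    if that1: "us \<in> words d (carr M)" "vs \<in> words d (carr M)" for us vs
  proof -
    have "mul M (us ! i) (vs ! i) \<in> carr M" if "i < d" for i
      using bil(1) nthc(1)[OF that1(1) that] nthc(1)[OF that1(2) that] by blast
    then show ?thesis
      using that1 by (auto simp: words_def set_zip)
  qed
  have ml1: "multilinear_on (smul M) (carr M) d fscale (\<lambda>us. tens M E (map2 (mul M) us vs))"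
    if vs: "vs \<in> words d (carr M)" for vs
  proof (rule multilinear_onI)
    fix us i x y assume *: "us \<in> words d (carr M)" "i < d" "x \<in> carr M" "y \<in> carr M"
    note len = nthc(2)[OF *(1,2)] nthc(2)[OF vs *(2)] and nth = nthc(1)[OF vs *(2)]
    have eq: "mul M (x + y) (vs ! i) = mul M x (vs ! i) + mul M y (vs ! i)" and "mul M x (vs ! i) \<in> carr M" "mul M y (vs ! i) \<in> carr M"
      using bil nth * by blast+
    then show "tens M E (map2 (mul M) (us[i := x + y]) vs) =
        tens M E (map2 (mul M) (us[i := x]) vs) + tens M E (map2 (mul M) (us[i := y]) vs)"
      unfolding upd(1)[OF len *(2)] eq
      by (intro multilinear_onD(1)[OF ml] mw[OF *(1) vs] *(2))
  next
    fix us i x c assume *: "us \<in> words d (carr M)" "i < d" "x \<in> carr M"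
    note len = nthc(2)[OF *(1,2)] nthc(2)[OF vs *(2)] and nth = nthc(1)[OF vs *(2)]
    have eq: "mul M (smul M c x) (vs ! i) = smul M c (mul M x (vs ! i))" and "mul M x (vs ! i) \<in> carr M"
      using bil nth * by blast+
    then show "tens M E (map2 (mul M) (us[i := smul M c x]) vs) =
        fscale c (tens M E (map2 (mul M) (us[i := x]) vs))"
      unfolding upd(1)[OF len *(2)] eq
      by (intro multilinear_onD(2)[OF ml] mw[OF *(1) vs] *(2))
  qed
  have ml2: "multilinear_on (smul M) (carr M) d fscale (\<lambda>vs. tens M E (map2 (mul M) us vs))"
    if us: "us \<in> words d (carr M)" for us
  proof (rule multilinear_onI)
    fix vs i x y assume *: "vs \<in> words d (carr M)" "i < d" "x \<in> carr M" "y \<in> carr M"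
    note len = nthc(2)[OF *(1,2)] nthc(2)[OF us *(2)] and nth = nthc(1)[OF us *(2)]
    have eq: "mul M (us ! i) (x + y) = mul M (us ! i) x + mul M (us ! i) y" and "mul M (us ! i) x \<in> carr M" "mul M (us ! i) y \<in> carr M"
      using bil nth * by blast+
    then show "tens M E (map2 (mul M) us (vs[i := x + y])) =
        tens M E (map2 (mul M) us (vs[i := x])) + tens M E (map2 (mul M) us (vs[i := y]))"
      unfolding upd(2)[OF len(2,1) *(2)] eq
      by (intro multilinear_onD(1)[OF ml] mw[OF us *(1)] *(2))
  next
    fix vs i x c assume *: "vs \<in> words d (carr M)" "i < d" "x \<in> carr M"
    note len = nthc(2)[OF *(1,2)] nthc(2)[OF us *(2)] and nth = nthc(1)[OF us *(2)]
    have eq: "mul M (us ! i) (smul M c x) = smul M c (mul M (us ! i) x)" and "mul M (us ! i) x \<in> carr M"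
      using bil nth * by blast+
    then show "tens M E (map2 (mul M) us (vs[i := smul M c x])) =
        fscale c (tens M E (map2 (mul M) us (vs[i := x])))"
      unfolding upd(2)[OF len(2,1) *(2)] eq
      by (intro multilinear_onD(2)[OF ml] mw[OF us *(1)] *(2))
  qed
  have sgn: "mul_sign M u v = (mul_sign M xs ys :: 'a)"
    if "tens M E xs u \<noteq> 0" "tens M E ys v \<noteq> 0" "u \<in> words d E" for u v
  proof -
    have "{(i, j). j < i \<and> i < length u \<and> u ! i \<in> odd_part M \<and> v ! j \<in> odd_part M} =
          {(i, j). j < i \<and> i < length xs \<and> xs ! i \<in> odd_part M \<and> ys ! j \<in> odd_part M}"
      using tens_parity[OF M b fin E xs that(1)] tens_parity[OF M b fin E ys that(2)] that(3) lxy
      by (auto simp: words_def)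
    then show ?thesis by (simp add: mul_sign_def)
  qed
  have Ec: "u \<in> words d (carr M)" if "u \<in> words d E" for u
    using that E hc by (auto simp: words_def)
  have "tensor_mul M E d (tens M E xs) (tens M E ys) =
      (\<Sum>u\<in>words d E. \<Sum>v\<in>words d E. fscale (tens M E xs u * tens M E ys v * mul_sign M xs ys)
         (tens M E (map2 (mul M) u v)))"
    unfolding tensor_mul_def
  proof (intro sum.cong refl)
    fix u v assume "u \<in> words d E" "v \<in> words d E"
    then show "fscale (tens M E xs u * tens M E ys v * mul_sign M u v) (tens M E (map2 (mul M) u v)) =
      fscale (tens M E xs u * tens M E ys v * mul_sign M xs ys) (tens M E (map2 (mul M) u v))"
      using sgn[of u v] by (cases "tens M E xs u = 0 \<or> tens M E ys v = 0") auto
  qed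
  also have "\<dots> = fscale (mul_sign M xs ys)
      (\<Sum>u\<in>words d E. fscale (tens M E xs u)
        (\<Sum>v\<in>words d E. fscale (tens M E ys v) (tens M E (map2 (mul M) u v))))"
    by (simp only: f.scale_sum_right f.scale_scale ac_simps)
  also have "(\<Sum>u\<in>words d E. fscale (tens M E xs u)
        (\<Sum>v\<in>words d E. fscale (tens M E ys v) (tens M E (map2 (mul M) u v)))) =
      (\<Sum>u\<in>words d E. fscale (tens M E xs u) (tens M E (map2 (mul M) u ys)))"
    by (intro sum.cong refl arg_cong[where f = "fscale _"]
          tens_expand_multilinear[OF m b fin module_fscale ml2[OF Ec] ysc, symmetric])
  also have "\<dots> = tens M E (map2 (mul M) xs ys)"
    by (rule tens_expand_multilinear[OF m b fin module_fscale ml1[OF ysc] xsc, symmetric])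
  finally show ?thesis .
qed

lemma permute_list_words: "\<sigma> permutes {..<d} \<Longrightarrow> xs \<in> words d X \<Longrightarrow> permute_list \<sigma> xs \<in> words d X"
  by (auto simp: words_def)

theorem tensor_act_tens:
  assumes M: "superalgebra M" and b: "module_basis (smul M) (carr M) E" and fin: "finite E"
    and E: "E \<subseteq> even_part M \<union> odd_part M"
    and xs: "xs \<in> words d (even_part M \<union> odd_part M)" and \<sigma>: "\<sigma> permutes {..<d}"
  shows "tensor_act M E d \<sigma> (tens M E xs) =
         fscale ((- 1) ^ inversions M \<sigma> xs) (tens M E (permute_list \<sigma> xs))"
proof -
  have m: "module (smul M)" using M by (simp add: superalgebra_def)
  interpret f: module "fscale :: 'a \<Rightarrow> ('b list \<Rightarrow> 'a) \<Rightarrow> 'b list \<Rightarrow> 'a" by (rule module_fscale)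
  note hc = homogeneous_in_carr[OF M]
  note ml = tens_multilinear[OF m b, of d]
  have lx: "length xs = d" using xs by (auto simp: words_def)
  have xsc: "xs \<in> words d (carr M)" using xs hc by (auto simp: words_def)
  have upd: "permute_list \<sigma> (us[i := z]) = (permute_list \<sigma> us)[inv \<sigma> i := z]"
    if "us \<in> words d (carr M)" "i < d" for us z i
  proof (rule nth_equalityI)
    fix j assume j: "j < length (permute_list \<sigma> (us[i := z]))"
    have l: "length us = d" using that by (simp add: words_def)
    have sj: "\<sigma> j < d" using j l permutes_in_image[OF \<sigma>, of j] by simp
    have "inv \<sigma> i = j \<longleftrightarrow> i = \<sigma> j" using permutes_inverses[OF \<sigma>] by metis
    then show "permute_list \<sigma> (us[i := z]) ! j = (permute_list \<sigma> us)[inv \<sigma> i := z] ! j"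
      using j l \<sigma> sj by (auto simp: permute_list_nth nth_list_update)
  qed simp
  have inv: "inv \<sigma> i < d" if "i < d" for i
    using permutes_in_image[OF permutes_inv[OF \<sigma>], of i] that by simp
  have ml1: "multilinear_on (smul M) (carr M) d fscale (\<lambda>us. tens M E (permute_list \<sigma> us))"
  proof (rule multilinear_onI)
    fix us i x y assume *: "us \<in> words d (carr M)" "i < d" "x \<in> carr M" "y \<in> carr M"
    then show "tens M E (permute_list \<sigma> (us[i := x + y])) =
        tens M E (permute_list \<sigma> (us[i := x])) + tens M E (permute_list \<sigma> (us[i := y]))"
      unfolding upd[OF *(1,2)]
      by (intro multilinear_onD(1)[OF ml] permute_list_words[OF \<sigma>] inv)
  next
    fix us i x c assume *: "us \<in> words d (carr M)" "i < d" "x \<in> carr M"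
    then show "tens M E (permute_list \<sigma> (us[i := smul M c x])) =
        fscale c (tens M E (permute_list \<sigma> (us[i := x])))"
      unfolding upd[OF *(1,2)]
      by (intro multilinear_onD(2)[OF ml] permute_list_words[OF \<sigma>] inv)
  qed
  have sgn: "inversions M \<sigma> u = inversions M \<sigma> xs"
    if "tens M E xs u \<noteq> 0" "u \<in> words d E" for u
  proof -
    have "{(k, l). k < l \<and> l < length u \<and> inv \<sigma> k > inv \<sigma> l \<and> u ! k \<in> odd_part M \<and> u ! l \<in> odd_part M} =
      {(k, l). k < l \<and> l < length xs \<and> inv \<sigma> k > inv \<sigma> l \<and> xs ! k \<in> odd_part M \<and> xs ! l \<in> odd_part M}"
      using tens_parity[OF M b fin E xs that(1)] that(2) lx by (auto simp: words_def)
    then show ?thesis by (simp add: inversions_def)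
  qed
  have "tensor_act M E d \<sigma> (tens M E xs) =
      (\<Sum>u\<in>words d E. fscale (tens M E xs u * (- 1) ^ inversions M \<sigma> xs) (tens M E (permute_list \<sigma> u)))"
    unfolding tensor_act_def
  proof (intro sum.cong refl)
    fix u assume "u \<in> words d E"
    then show "fscale (tens M E xs u * (- 1) ^ inversions M \<sigma> u) (tens M E (permute_list \<sigma> u)) =
        fscale (tens M E xs u * (- 1) ^ inversions M \<sigma> xs) (tens M E (permute_list \<sigma> u))"
      using sgn[of u] by (cases "tens M E xs u = 0") auto
  qed
  also have "\<dots> = fscale ((- 1) ^ inversions M \<sigma> xs)
      (\<Sum>u\<in>words d E. fscale (tens M E xs u) (tens M E (permute_list \<sigma> u)))"
    by (simp only: f.scale_sum_right f.scale_scale ac_simps)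
  also have "\<dots> = fscale ((- 1) ^ inversions M \<sigma> xs) (tens M E (permute_list \<sigma> xs))"
    by (simp only: tens_expand_multilinear[OF m b fin module_fscale ml1 xsc, symmetric])
  finally show ?thesis .
qed


lemma superalgebraD:
  assumes "superalgebra M"
  shows "module (smul M)" "module.subspace (smul M) (carr M)"
    "module.subspace (smul M) (even_part M)" "module.subspace (smul M) (odd_part M)"
    "direct_sum (carr M) (even_part M) (odd_part M)"
    "x \<in> carr M \<Longrightarrow> y \<in> carr M \<Longrightarrow> mul M x y \<in> carr M"
    "x \<in> carr M \<Longrightarrow> y \<in> carr M \<Longrightarrow> z \<in> carr M \<Longrightarrow> mul M (x + y) z = mul M x z + mul M y z"
    "x \<in> carr M \<Longrightarrow> y \<in> carr M \<Longrightarrow> z \<in> carr M \<Longrightarrow> mul M x (y + z) = mul M x y + mul M x z"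
    "x \<in> carr M \<Longrightarrow> y \<in> carr M \<Longrightarrow> mul M (smul M c x) y = smul M c (mul M x y)"
    "x \<in> carr M \<Longrightarrow> y \<in> carr M \<Longrightarrow> mul M x (smul M c y) = smul M c (mul M x y)"
    "x \<in> carr M \<Longrightarrow> y \<in> carr M \<Longrightarrow> z \<in> carr M \<Longrightarrow> mul M (mul M x y) z = mul M x (mul M y z)"
    "x \<in> even_part M \<Longrightarrow> y \<in> even_part M \<Longrightarrow> mul M x y \<in> even_part M"
    "x \<in> even_part M \<Longrightarrow> y \<in> odd_part M \<Longrightarrow> mul M x y \<in> odd_part M"
    "x \<in> odd_part M \<Longrightarrow> y \<in> even_part M \<Longrightarrow> mul M x y \<in> odd_part M"
    "x \<in> odd_part M \<Longrightarrow> y \<in> odd_part M \<Longrightarrow> mul M x y \<in> even_part M"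
  using assms by (simp_all add: superalgebra_def)

lemma module_mat: "module (smul A) \<Longrightarrow> module (smul (mat_superalg A :: ('k::comm_ring_1, 'a::ab_group_add^'n::finite^'n) superalg))"
  by (auto simp: module_def mat_superalg_def vec_eq_iff)

lemma superalgebra_mat:
  assumes A: "superalgebra A"
  shows "superalgebra (mat_superalg A :: ('k::comm_ring_1, 'a::ab_group_add^'n::finite^'n) superalg)"
proof -
  interpret module "smul A" using superalgebraD(1)[OF A] .
  let ?M = "mat_superalg A :: ('k, 'a^'n^'n) superalg"
  note D = superalgebraD[OF A]
  have m: "module (smul ?M)" by (rule module_mat[OF D(1)])
  have zc: "0 \<in> carr A" by (rule subspace_0[OF D(2)])
  have m0: "mul A 0 y = 0" "mul A y 0 = 0" if "y \<in> carr A" for y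
    using D(9)[of 0 y 0] D(10)[of y 0 0] that zc by auto
  have sumL: "mul A (\<Sum>k\<in>K. f k) y = (\<Sum>k\<in>K. mul A (f k) y)"
    and sumR: "mul A y (\<Sum>k\<in>K. f k) = (\<Sum>k\<in>K. mul A y (f k))"
    if "y \<in> carr A" "\<And>k. f k \<in> carr A" for y f and K :: "'n set"
  proof -
    have "mul A (\<Sum>k\<in>K. f k) y = (\<Sum>k\<in>K. mul A (f k) y) \<and>
          mul A y (\<Sum>k\<in>K. f k) = (\<Sum>k\<in>K. mul A y (f k))"
      by (induction K rule: infinite_finite_induct)
         (auto simp: m0 D(7,8) that subspace_sum[OF D(2)])
    then show "mul A (\<Sum>k\<in>K. f k) y = (\<Sum>k\<in>K. mul A (f k) y)"
      "mul A y (\<Sum>k\<in>K. f k) = (\<Sum>k\<in>K. mul A y (f k))" by auto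
  qed
  have sub: "module.subspace (smul ?M) {X. \<forall>i j. X $ i $ j \<in> S}" if "subspace S" for S
    unfolding module.subspace_def[OF m]
    using that by (auto simp: mat_superalg_def subspace_0 subspace_add subspace_scale)
  have sets: "carr ?M = {X. \<forall>i j. X $ i $ j \<in> carr A}"
    "even_part ?M = {X. \<forall>i j. X $ i $ j \<in> even_part A}"
    "odd_part ?M = {X. \<forall>i j. X $ i $ j \<in> odd_part A}"
    by (simp_all add: mat_superalg_def)
  have ds: "direct_sum (carr ?M) (even_part ?M) (odd_part ?M)"
    unfolding direct_sum_def
  proof
    show "carr ?M = {x + y |x y. x \<in> even_part ?M \<and> y \<in> odd_part ?M}"
    proof (intro equalityI subsetI)
      fix X assume "X \<in> carr ?M"
      then have "\<forall>i j. \<exists>x y. X $ i $ j = x + y \<and> x \<in> even_part A \<and> y \<in> odd_part A"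
        using D(5) unfolding sets direct_sum_def by auto
      then obtain f g where fg: "X $ i $ j = f i j + g i j" "f i j \<in> even_part A" "g i j \<in> odd_part A" for i j
        by metis
      have "X = (\<chi> i j. f i j) + (\<chi> i j. g i j)" by (simp add: vec_eq_iff fg(1))
      moreover have "(\<chi> i j. f i j) \<in> even_part ?M" "(\<chi> i j. g i j) \<in> odd_part ?M"
        using fg by (auto simp: sets)
      ultimately show "X \<in> {x + y |x y. x \<in> even_part ?M \<and> y \<in> odd_part ?M}" by blast
    next
      fix X assume "X \<in> {x + y |x y. x \<in> even_part ?M \<and> y \<in> odd_part ?M}"
      then obtain Y Z where YZ: "X = Y + Z" "Y \<in> even_part ?M" "Z \<in> odd_part ?M" by blast
      have "Y $ i $ j + Z $ i $ j \<in> carr A" for i j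
        using YZ(2,3) homogeneous_in_carr[OF A] subspace_add[OF D(2)] unfolding sets by blast
      then show "X \<in> carr ?M" unfolding YZ(1) sets by simp
    qed
    have eo: "x \<in> even_part A \<and> x \<in> odd_part A \<longleftrightarrow> x = 0" for x
      using D(5) unfolding direct_sum_def by blast
    have "X \<in> even_part ?M \<inter> odd_part ?M \<longleftrightarrow> (\<forall>i j. X $ i $ j = 0)" for X
      unfolding sets eo[symmetric] by blast
    then show "even_part ?M \<inter> odd_part ?M = {0}"
      by (simp add: set_eq_iff vec_eq_iff)
  qed
  have "even_part A \<subseteq> carr A" "odd_part A \<subseteq> carr A"
    using homogeneous_in_carr[OF A] by auto
  have assoc: "mul ?M (mul ?M X Y) Z = mul ?M X (mul ?M Y Z)"
    if "X \<in> carr ?M" "Y \<in> carr ?M" "Z \<in> carr ?M" for X Y Z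
  proof -
    have "(\<Sum>k\<in>UNIV. mul A (\<Sum>l\<in>UNIV. mul A (X $ i $ l) (Y $ l $ k)) (Z $ k $ j)) =
      (\<Sum>l\<in>UNIV. mul A (X $ i $ l) (\<Sum>k\<in>UNIV. mul A (Y $ l $ k) (Z $ k $ j)))" for i j
    proof -
      have "(\<Sum>k\<in>UNIV. mul A (\<Sum>l\<in>UNIV. mul A (X $ i $ l) (Y $ l $ k)) (Z $ k $ j)) =
          (\<Sum>k\<in>UNIV. \<Sum>l\<in>UNIV. mul A (X $ i $ l) (mul A (Y $ l $ k) (Z $ k $ j)))"
        using that by (simp add: sets sumL D(6,11))
      also have "\<dots> = (\<Sum>l\<in>UNIV. \<Sum>k\<in>UNIV. mul A (X $ i $ l) (mul A (Y $ l $ k) (Z $ k $ j)))"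
        by (rule sum.swap)
      also have "\<dots> = (\<Sum>l\<in>UNIV. mul A (X $ i $ l) (\<Sum>k\<in>UNIV. mul A (Y $ l $ k) (Z $ k $ j)))"
        using that by (simp add: sets sumR D(6))
      finally show ?thesis .
    qed
    then show ?thesis by (simp add: mat_superalg_def vec_eq_iff)
  qed
  have ops: "smul ?M c X = (\<chi> i j. smul A c (X $ i $ j))"
    "mul ?M X Y = (\<chi> i j. \<Sum>k\<in>UNIV. mul A (X $ i $ k) (Y $ k $ j))" for c X Y
    by (simp_all add: mat_superalg_def)
  have subs: "module.subspace (smul ?M) (carr ?M)" "module.subspace (smul ?M) (even_part ?M)"
    "module.subspace (smul ?M) (odd_part ?M)"
    unfolding sets using D(2,3,4) by (auto intro: sub)
  have closed: "mul ?M X Y \<in> carr ?M" if "X \<in> carr ?M" "Y \<in> carr ?M" for X Y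
    using that by (simp add: ops sets subspace_sum[OF D(2)] D(6))
  have parity: "X \<in> even_part ?M \<Longrightarrow> Y \<in> even_part ?M \<Longrightarrow> mul ?M X Y \<in> even_part ?M"
    "X \<in> even_part ?M \<Longrightarrow> Y \<in> odd_part ?M \<Longrightarrow> mul ?M X Y \<in> odd_part ?M"
    "X \<in> odd_part ?M \<Longrightarrow> Y \<in> even_part ?M \<Longrightarrow> mul ?M X Y \<in> odd_part ?M"
    "X \<in> odd_part ?M \<Longrightarrow> Y \<in> odd_part ?M \<Longrightarrow> mul ?M X Y \<in> even_part ?M" for X Y
    by (simp_all add: ops sets subspace_sum[OF D(3)] subspace_sum[OF D(4)] D(12-15))
  have distr: "mul ?M (X + Y) Z = mul ?M X Z + mul ?M Y Z" "mul ?M X (Y + Z) = mul ?M X Y + mul ?M X Z"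
    if "X \<in> carr ?M" "Y \<in> carr ?M" "Z \<in> carr ?M" for X Y Z
    using that by (simp_all add: ops sets vec_eq_iff D(7,8) sum.distrib)
  have scal: "mul ?M (smul ?M c X) Y = smul ?M c (mul ?M X Y)" "mul ?M X (smul ?M c Y) = smul ?M c (mul ?M X Y)"
    if "X \<in> carr ?M" "Y \<in> carr ?M" for X Y c
    using that by (simp_all add: ops sets vec_eq_iff D(9,10) scale_sum_right)
  show ?thesis
    unfolding superalgebra_def
    by (intro conjI ballI allI m subs ds assoc distr scal closed parity)
qed

lemma munit_nth: "munit b r s $ i $ j = (if i = r \<and> j = s then b else 0)"
  by (simp add: munit_def)

lemma module_basis_mat:
  assumes A: "superalgebra A" and b: "module_basis (smul A) (carr A) B" and fin: "finite B"
  shows "module_basis (smul (mat_superalg A)) (carr (mat_superalg A)) (mat_basis B :: ('a::ab_group_add^'n::finite^'n) set)"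
    and "finite (mat_basis B :: ('a^'n^'n) set)"
proof -
  interpret module "smul A" using superalgebraD(1)[OF A] .
  let ?M = "mat_superalg A :: (_, 'a^'n^'n) superalg"
  interpret m: module "smul ?M" by (rule module_mat[OF superalgebraD(1)[OF A]])
  have ind: "independent B" "span B = carr A" using b by (auto simp: module_basis_def)
  have nz: "y \<noteq> 0" if "y \<in> B" for y using ind that dependent_zero by blast
  have mb: "mat_basis B = (\<lambda>(b, r, s). munit b r s :: 'a^'n^'n) ` (B \<times> UNIV \<times> UNIV)"
    by (fastforce simp: mat_basis_def image_iff)
  show finm: "finite (mat_basis B :: ('a^'n^'n) set)"
    unfolding mb using fin by auto
  have inj: "inj_on (\<lambda>(b, r, s). munit b r s :: 'a^'n^'n) (B \<times> UNIV \<times> UNIV)"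
    using nz by (auto simp: inj_on_def munit_def vec_eq_iff)
  have entry: "(\<Sum>e\<in>mat_basis B. smul ?M (c e) e) $ i $ j = (\<Sum>b\<in>B. smul A (c (munit b i j)) b)" for c i j
  proof -
    have "(\<Sum>e\<in>mat_basis B. smul ?M (c e) e) $ i $ j =
        (\<Sum>b\<in>B. \<Sum>r\<in>UNIV. \<Sum>s\<in>UNIV. smul A (c (munit b r s)) (munit b r s $ i $ j))"
      unfolding mb sum.reindex[OF inj]
      by (simp add: sum.cartesian_product case_prod_unfold mat_superalg_def)
    also have "\<dots> = (\<Sum>b\<in>B. \<Sum>r\<in>UNIV. \<Sum>s\<in>UNIV. if r = i then (if s = j then smul A (c (munit b i j)) b else 0) else 0)"
      by (intro sum.cong) (auto simp: munit_nth)
    also have "\<dots> = (\<Sum>b\<in>B. \<Sum>r\<in>UNIV. if r = i then smul A (c (munit b i j)) b else 0)"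
      by (intro sum.cong) auto
    also have "\<dots> = (\<Sum>b\<in>B. smul A (c (munit b i j)) b)"
      by (intro sum.cong) auto
    finally show ?thesis .
  qed
  have "\<not> module.dependent (smul ?M) (mat_basis B)"
    unfolding m.dependent_finite[OF finm]
  proof (safe, goal_cases)
    case (1 c e)
    then have s: "(\<Sum>e\<in>mat_basis B. smul ?M (c e) e) = 0" and e: "e \<in> mat_basis B" and "c e \<noteq> 0"
      by auto
    obtain b i j where bij: "e = munit b i j" "b \<in> B" using e by (auto simp: mat_basis_def)
    have "(\<Sum>b\<in>B. smul A (c (munit b i j)) b) = 0" using entry[of c i j] s by simp
    then show False
      using \<open>c e \<noteq> 0\<close> independentD[OF ind(1) fin order_refl, of "\<lambda>b. c (munit b i j)" b] bij by simp
  qed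
  moreover have "module.span (smul ?M) (mat_basis B) = carr ?M"
  proof (rule m.span_unique[symmetric, THEN sym])
    show "mat_basis B \<subseteq> carr ?M"
      using span_superset[of B] ind span_zero[of B]
      by (auto simp: mat_basis_def mat_superalg_def munit_nth)
    show "m.subspace (carr ?M)" by (rule superalgebraD(2)[OF superalgebra_mat[OF A]])
    fix T assume T: "mat_basis B \<subseteq> T" "m.subspace T"
    show "carr ?M \<subseteq> T"
    proof
      fix X assume X: "X \<in> carr ?M"
      define c where "c e = (\<Sum>i\<in>UNIV. \<Sum>j\<in>UNIV. \<Sum>b\<in>B. if e = munit b i j then representation B (X $ i $ j) b else 0)"
        for e :: "'a^'n^'n"
      have ceq: "c (munit b i j) = representation B (X $ i $ j) b" if "b \<in> B" for b i j
      proof -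
        have "(munit b i j = (munit b' i' j' :: 'a^'n^'n)) \<longleftrightarrow> i' = i \<and> j' = j \<and> b' = b" if "b' \<in> B" for b' i' j'
          using inj_onD[OF inj, of "(b, i, j)" "(b', i', j')"] \<open>b \<in> B\<close> that by auto
        then have "c (munit b i j) = (\<Sum>i'\<in>UNIV. \<Sum>j'\<in>UNIV. \<Sum>b'\<in>B.
            if i' = i then if j' = j then if b' = b then representation B (X $ i $ j) b else 0 else 0 else 0)"
          unfolding c_def by (intro sum.cong) auto
        also have "\<dots> = (\<Sum>i'\<in>UNIV. \<Sum>j'\<in>UNIV. if i' = i then if j' = j then representation B (X $ i $ j) b else 0 else 0)"
          using fin that by (intro sum.cong refl) auto
        also have "\<dots> = (\<Sum>i'\<in>UNIV. if i' = i then representation B (X $ i $ j) b else 0)"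
          by (intro sum.cong refl) auto
        finally show ?thesis by simp
      qed
      have "X = (\<Sum>e\<in>mat_basis B. smul ?M (c e) e)"
      proof -
        have "X $ i $ j = (\<Sum>e\<in>mat_basis B. smul ?M (c e) e) $ i $ j" for i j
        proof -
          have "X $ i $ j \<in> span B" using X ind by (simp add: mat_superalg_def)
          then have "(\<Sum>b\<in>B. smul A (representation B (X $ i $ j) b) b) = X $ i $ j"
            using sum_representation_eq[OF ind(1) _ fin order_refl] by blast
          then show ?thesis unfolding entry using ceq by simp
        qed
        then show ?thesis by (simp add: vec_eq_iff)
      qed
      also have "\<dots> \<in> T" using T by (intro m.subspace_sum m.subspace_scale) auto
      finally show "X \<in> T" .
    qed
  qed
  ultimately show "module_basis (smul ?M) (carr ?M) (mat_basis B)"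
    by (simp add: module_basis_def)
qed

lemma inversions_sign:
  assumes "length u = d"
  shows "(- 1) ^ inversions M \<sigma> u =
    (\<Prod>(k, l)\<in>{(k, l). k < l \<and> l < d \<and> u ! k \<in> odd_part M \<and> u ! l \<in> odd_part M}.
      if inv \<sigma> l < inv \<sigma> k then - 1 else (1::'k::comm_ring_1))"
proof -
  let ?P = "{(k, l). k < l \<and> l < d \<and> u ! k \<in> odd_part M \<and> u ! l \<in> odd_part M}"
  have fin: "finite ?P" by (rule finite_subset[of _ "{..<d} \<times> {..<d}"]) auto
  have "(\<Prod>(k, l)\<in>?P. if inv \<sigma> l < inv \<sigma> k then - 1 else (1::'k)) =
    (\<Prod>p\<in>?P. if inv \<sigma> (snd p) < inv \<sigma> (fst p) then - 1 else 1)"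
    by (simp only: case_prod_unfold)
  also have "\<dots> = (\<Prod>p\<in>{p\<in>?P. inv \<sigma> (snd p) < inv \<sigma> (fst p)}. - 1)"
    by (rule prod.inter_filter[OF fin, symmetric])
  also have "\<dots> = (- 1) ^ card {p\<in>?P. inv \<sigma> (snd p) < inv \<sigma> (fst p)}" by simp
  also have "{p\<in>?P. inv \<sigma> (snd p) < inv \<sigma> (fst p)} =
     {(k, l). k < l \<and> l < length u \<and> inv \<sigma> k > inv \<sigma> l \<and> u ! k \<in> odd_part M \<and> u ! l \<in> odd_part M}"
    using assms by auto
  finally show ?thesis by (simp add: inversions_def)
qed

lemma inversions_comp:
  assumes l: "length u = d" and \<sigma>: "\<sigma> permutes {..<d}" and \<rho>: "\<rho> permutes {..<d}"
  shows "(- 1) ^ inversions M (\<sigma> \<circ> \<rho>) u =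
    (- 1) ^ inversions M \<sigma> u * (- 1 :: 'k::comm_ring_1) ^ inversions M \<rho> (permute_list \<sigma> u)"
proof -
  define P where "P v = {(k, l). k < l \<and> l < d \<and> v ! k \<in> odd_part M \<and> v ! l \<in> odd_part M}" for v
  define srt where "srt h = (\<lambda>(k, l). (min (h k) (h l), max (h k) (h l :: nat)))" for h :: "nat \<Rightarrow> nat"
  have inv\<sigma>: "inv \<sigma> permutes {..<d}" using permutes_inv[OF \<sigma>] .
  have lt: "\<sigma> k < d \<longleftrightarrow> k < d" "inv \<sigma> k < d \<longleftrightarrow> k < d" for k
    using permutes_in_image[OF \<sigma>] permutes_in_image[OF inv\<sigma>] by simp_all
  have io: "\<sigma> (inv \<sigma> k) = k" "inv \<sigma> (\<sigma> k) = k" for k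
    using permutes_inverses[OF \<sigma>] by auto
  have inj: "inv \<sigma> k = inv \<sigma> l \<longleftrightarrow> k = l" "\<sigma> k = \<sigma> l \<longleftrightarrow> k = l" for k l
    by (metis io)+
  have injr: "inv \<rho> k = inv \<rho> l \<longleftrightarrow> k = l" for k l
    using permutes_inverses[OF \<rho>] by metis
  have pn: "permute_list \<sigma> u ! k = u ! \<sigma> k" if "k < d" for k
    using that \<sigma> l by (simp add: permute_list_nth)
  have comp: "inv (\<sigma> \<circ> \<rho>) = inv \<rho> \<circ> inv \<sigma>"
    by (rule o_inv_distrib) (use \<sigma> \<rho> permutes_bij in auto)
  have 2: "(\<Prod>(k, l)\<in>P (permute_list \<sigma> u). if inv \<rho> l < inv \<rho> k then - 1 else (1::'k)) =
    (\<Prod>p\<in>P u. case srt (inv \<sigma>) p of (k, l) \<Rightarrow> if inv \<rho> l < inv \<rho> k then - 1 else 1)"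
  proof (rule prod.reindex_bij_witness[of _ "srt (inv \<sigma>)" "srt \<sigma>"])
    fix p assume p: "p \<in> P (permute_list \<sigma> u)"
    obtain k m where km: "p = (k, m)" "k < m" "m < d" "u ! \<sigma> k \<in> odd_part M" "u ! \<sigma> m \<in> odd_part M"
      using p by (auto simp: P_def pn)
    have ne: "\<sigma> k \<noteq> \<sigma> m" using km inj by auto
    show "srt (inv \<sigma>) (srt \<sigma> p) = p"
      using km io by (auto simp: srt_def min_def max_def)
    show "srt \<sigma> p \<in> P u"
      using km ne lt by (auto simp: srt_def P_def min_def max_def)
    show "(case srt (inv \<sigma>) (srt \<sigma> p) of (k, l) \<Rightarrow> if inv \<rho> l < inv \<rho> k then - 1 else (1::'k)) =
      (case p of (k, l) \<Rightarrow> if inv \<rho> l < inv \<rho> k then - 1 else 1)"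
      using \<open>srt (inv \<sigma>) (srt \<sigma> p) = p\<close> by simp
  next
    fix p assume p: "p \<in> P u"
    obtain k m where km: "p = (k, m)" "k < m" "m < d" "u ! k \<in> odd_part M" "u ! m \<in> odd_part M"
      using p by (auto simp: P_def)
    have ne: "inv \<sigma> k \<noteq> inv \<sigma> m" using km inj by auto
    show "srt \<sigma> (srt (inv \<sigma>) p) = p"
      using km io by (auto simp: srt_def min_def max_def)
    show "srt (inv \<sigma>) p \<in> P (permute_list \<sigma> u)"
      using km ne lt io by (auto simp: srt_def P_def min_def max_def pn)
  qed
  have "(\<Prod>(k, l)\<in>P u. if inv (\<sigma> \<circ> \<rho>) l < inv (\<sigma> \<circ> \<rho>) k then - 1 else (1::'k)) =
    (\<Prod>p\<in>P u. (case p of (k, l) \<Rightarrow> if inv \<sigma> l < inv \<sigma> k then - 1 else 1) *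
       (case srt (inv \<sigma>) p of (k, l) \<Rightarrow> if inv \<rho> l < inv \<rho> k then - 1 else 1))"
  proof (rule prod.cong[OF refl])
    fix p assume "p \<in> P u"
    then obtain k m where km: "p = (k, m)" "k < m" by (auto simp: P_def)
    have "inv \<sigma> k \<noteq> inv \<sigma> m" "inv \<rho> (inv \<sigma> k) \<noteq> inv \<rho> (inv \<sigma> m)"
      using km inj injr by auto
    then show "(case p of (k, l) \<Rightarrow> if inv (\<sigma> \<circ> \<rho>) l < inv (\<sigma> \<circ> \<rho>) k then - 1 else (1::'k)) =
      (case p of (k, l) \<Rightarrow> if inv \<sigma> l < inv \<sigma> k then - 1 else 1) *
       (case srt (inv \<sigma>) p of (k, l) \<Rightarrow> if inv \<rho> l < inv \<rho> k then - 1 else 1)"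
      using km by (auto simp: srt_def comp min_def max_def)
  qed
  then show ?thesis
    using 2 l by (simp add: inversions_sign[of u d] inversions_sign[of "permute_list \<sigma> u" d] P_def prod.distrib)
qed

lemma tensor_act_scale: "tensor_act M E d \<sigma> (fscale c f) = fscale c (tensor_act M E d \<sigma> f)"
  unfolding tensor_act_def fun_eq_iff fsum_apply fscale_def
  by (simp add: sum_distrib_left mult.assoc)

lemma tensor_act_add: "tensor_act M E d \<sigma> (f + g) = tensor_act M E d \<sigma> f + tensor_act M E d \<sigma> g"
  unfolding tensor_act_def fun_eq_iff plus_fun_apply fsum_apply fscale_def
  by (simp add: sum.distrib distrib_right)

lemma tensor_act_zero: "tensor_act M E d \<sigma> 0 = 0"
  unfolding tensor_act_def fun_eq_iff fsum_apply fscale_def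
  by simp

lemma tensor_act_sum:
  "finite I \<Longrightarrow> tensor_act M E d \<sigma> (\<Sum>i\<in>I. f i) = (\<Sum>i\<in>I. tensor_act M E d \<sigma> (f i))"
proof (induction I rule: finite_induct)
  case (insert i I)
  then show ?case unfolding sum.insert[OF insert.hyps] tensor_act_add by simp
qed (simp only: sum.empty tensor_act_zero)

lemma tensor_act_comp:
  assumes M: "superalgebra M" and b: "module_basis (smul M) (carr M) E" and fin: "finite E"
    and E: "E \<subseteq> even_part M \<union> odd_part M"
    and xs: "xs \<in> words d (even_part M \<union> odd_part M)"
    and \<sigma>: "\<sigma> permutes {..<d}" and \<rho>: "\<rho> permutes {..<d}"
  shows "tensor_act M E d \<rho> (tensor_act M E d \<sigma> (tens M E xs)) =
         tensor_act M E d (\<sigma> \<circ> \<rho>) (tens M E xs)"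
proof -
  have l: "length xs = d" using xs by (simp add: words_def)
  have p: "permute_list (\<sigma> \<circ> \<rho>) xs = permute_list \<rho> (permute_list \<sigma> xs)"
    using \<rho> l by (simp add: permute_list_compose)
  show ?thesis
    unfolding tensor_act_tens[OF M b fin E xs \<sigma>] tensor_act_scale
      tensor_act_tens[OF M b fin E permute_list_words[OF \<sigma> xs] \<rho>]
      tensor_act_tens[OF M b fin E xs permutes_compose[OF \<rho> \<sigma>]] inversions_comp[OF l \<sigma> \<rho>] p
    by (simp add: fscale_def mult.assoc)
qed

lemma permute_list_inv_fixed:
  assumes "\<sigma> permutes {..<length x}" "permute_list \<sigma> x = x"
  shows "permute_list (inv \<sigma>) x = x"
proof -
  have "permute_list (\<sigma> \<circ> inv \<sigma>) x = permute_list (inv \<sigma>) (permute_list \<sigma> x)"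
    using permutes_inv[OF assms(1)] by (simp add: permute_list_compose)
  then show ?thesis using permutes_inv_o[OF assms(1)] assms(2) by simp
qed

lemma triple_stab_group:
  assumes len: "length b = d" "length r = d" "length s = d"
  shows "id \<in> triple_stab d b r s"
    and "\<sigma> \<in> triple_stab d b r s \<Longrightarrow> \<tau> \<in> triple_stab d b r s \<Longrightarrow> \<sigma> \<circ> \<tau> \<in> triple_stab d b r s"
    and "\<sigma> \<in> triple_stab d b r s \<Longrightarrow> inv \<sigma> \<in> triple_stab d b r s"
proof -
  show "id \<in> triple_stab d b r s" by (simp add: triple_stab_def permutes_id)
  show "\<sigma> \<circ> \<tau> \<in> triple_stab d b r s" if "\<sigma> \<in> triple_stab d b r s" "\<tau> \<in> triple_stab d b r s"
    using that len by (auto simp: triple_stab_def permutes_compose permute_list_compose)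
  show "inv \<sigma> \<in> triple_stab d b r s" if "\<sigma> \<in> triple_stab d b r s"
  proof -
    have \<sigma>: "\<sigma> permutes {..<d}" using that by (simp add: triple_stab_def)
    show ?thesis
      using that len permutes_inv[OF \<sigma>] permute_list_inv_fixed[of \<sigma> b]
        permute_list_inv_fixed[of \<sigma> r] permute_list_inv_fixed[of \<sigma> s]
      by (simp add: triple_stab_def)
  qed
qed

lemma subspace_tensor_power: "module.subspace fscale (carr (tensor_power M E d))"
proof -
  interpret f: module "fscale :: 'a::comm_ring_1 \<Rightarrow> ('b list \<Rightarrow> 'a) \<Rightarrow> 'b list \<Rightarrow> 'a"
    by (rule module_fscale)
  have "x w \<noteq> 0 \<or> y w \<noteq> 0" if "x w + y w \<noteq> 0" for x y :: "'b list \<Rightarrow> 'a" and w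
    using that by auto
  moreover have "x w \<noteq> 0" if "c * x w \<noteq> 0" for c and x :: "'b list \<Rightarrow> 'a" and w
    using that by auto
  ultimately show ?thesis
    unfolding f.subspace_def by (simp add: tensor_power_def fscale_def zero_fun_def) blast
qed

lemma finite_stab_cosets: "finite (stab_cosets d b r s)"
proof -
  have "stab_cosets d b r s = (\<lambda>\<sigma>. (\<lambda>\<tau>. \<tau> \<circ> \<sigma>) ` triple_stab d b r s) ` {\<sigma>. \<sigma> permutes {..<d}}"
    by (auto simp: stab_cosets_def)
  then show ?thesis by (simp add: finite_permutations)
qed

text \<open>The elements \<open>xi\<close> are invariant, so that \<open>T_superalg\<close> lies in \<open>schur_superalg\<close>.\<close>

context
  fixes A :: "('k::comm_ring_1, 'a::ab_group_add) superalg" and B :: "'a set" and d :: nat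
    and b :: "'a list" and r s :: "'n::finite list"
  assumes A: "superalgebra A" and bas: "module_basis (smul A) (carr A) B" and fin: "finite B"
    and hom: "B \<subseteq> even_part A \<union> odd_part A"
    and tri: "(b, r, s) \<in> Tri A B d"
begin

private abbreviation "M \<equiv> mat_superalg A :: ('k, 'a^'n^'n) superalg"
private abbreviation "E \<equiv> mat_basis B :: ('a^'n^'n) set"
private abbreviation "w \<equiv> map (\<lambda>(b, r, s). munit b r s :: 'a^'n^'n) (zip b (zip r s))"

private lemma len: "length b = d" "length r = d" "length s = d" "length w = d"
  using tri by (auto simp: Tri_def words_def)

private lemma b_in: "k < d \<Longrightarrow> b ! k \<in> B"
  using tri by (auto simp: Tri_def words_def)

private lemma w_nth: "k < d \<Longrightarrow> w ! k = munit (b ! k) (r ! k) (s ! k)"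
  using len by simp

private lemma E_hom: "E \<subseteq> even_part M \<union> odd_part M"
proof -
  interpret module "smul A" using superalgebraD(1)[OF A] .
  show ?thesis
  proof
    fix e assume "e \<in> E"
    then obtain x i j where x: "e = munit x i j" "x \<in> B" by (auto simp: mat_basis_def)
    then have "x \<in> even_part A \<or> x \<in> odd_part A" using hom by blast
    then show "e \<in> even_part M \<union> odd_part M"
      using subspace_0[OF superalgebraD(3)[OF A]] subspace_0[OF superalgebraD(4)[OF A]] x(1)
      by (auto simp: mat_superalg_def munit_nth)
  qed
qed

private lemma w_words: "w \<in> words d (even_part M \<union> odd_part M)"
proof -
  have "w ! k \<in> E" if "k < d" for k
    using b_in[OF that] w_nth[OF that] by (auto simp: mat_basis_def)
  then have "w ! k \<in> even_part M \<union> odd_part M" if "k < d" for k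
    using E_hom that by blast
  then have "set w \<subseteq> even_part M \<union> odd_part M"
    using len(4) by (metis in_set_conv_nth subsetI)
  then show ?thesis
    unfolding words_def using len(4) by blast
qed

private lemmas Mfacts = superalgebra_mat[OF A] module_basis_mat[OF A bas fin] E_hom

private definition "F \<sigma> = tensor_act M E d \<sigma> (tens M E w)"

private lemma F_stab:
  assumes \<tau>: "\<tau> \<in> triple_stab d b r s"
  shows "F \<tau> = tens M E w"
proof -
  interpret module "smul A" using superalgebraD(1)[OF A] .
  have p: "\<tau> permutes {..<d}" using \<tau> by (simp add: triple_stab_def)
  have pl: "permute_list \<tau> w = w"
    using \<tau> p len by (simp add: triple_stab_def permute_list_map permute_list_zip[of _ "{..<d}"])
  have fix1: "inv \<tau> k = k" if k: "k < d" "w ! k \<in> odd_part M" for k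
  proof (rule ccontr)
    assume ne: "inv \<tau> k \<noteq> k"
    let ?j = "inv \<tau> k"
    have j: "?j < d" "\<tau> ?j = k"
      using permutes_in_image[OF permutes_inv[OF p], of k] k permutes_inverses[OF p] by auto
    have "permute_list \<tau> b ! ?j = b ! k" "permute_list \<tau> r ! ?j = r ! k" "permute_list \<tau> s ! ?j = s ! k"
      using j p len by (simp_all add: permute_list_nth)
    then have "(b ! k, r ! k, s ! k) = (b ! ?j, r ! ?j, s ! ?j)"
      using \<tau> by (simp add: triple_stab_def)
    then have ev: "b ! k \<in> even_part A"
      using tri ne j k unfolding Tri_def by (auto simp del: prod.inject)
    have "munit (b ! k) (r ! k) (s ! k) \<in> odd_part M" using k w_nth by simp
    then have "b ! k \<in> odd_part A"
      by (auto simp: mat_superalg_def munit_nth split: if_splits)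
    with ev have "b ! k = 0"
      using superalgebraD(5)[OF A] by (auto simp: direct_sum_def)
    moreover have "independent B" using bas by (simp add: module_basis_def)
    ultimately show False using b_in[OF k(1)] dependent_zero by metis
  qed
  have "{(k, l). k < l \<and> l < length w \<and> inv \<tau> k > inv \<tau> l \<and> w ! k \<in> odd_part M \<and> w ! l \<in> odd_part M} = {}"
  proof -
    have False if "k < l" "l < d" "inv \<tau> k > inv \<tau> l" "w ! k \<in> odd_part M" "w ! l \<in> odd_part M" for k l
      using that fix1[of k] fix1[of l] by simp
    then show ?thesis unfolding len(4) by blast
  qed
  then have "inversions M \<tau> w = 0" unfolding inversions_def by (simp only: card.empty)
  then show ?thesis
    unfolding F_def tensor_act_tens[OF Mfacts w_words p] pl by (simp add: fscale_def)
qed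

private lemma F_coset:
  assumes "\<tau> \<in> triple_stab d b r s" "\<sigma> permutes {..<d}"
  shows "F (\<tau> \<circ> \<sigma>) = F \<sigma>"
proof -
  have "\<tau> permutes {..<d}" using assms by (simp add: triple_stab_def)
  then have "F (\<tau> \<circ> \<sigma>) = tensor_act M E d \<sigma> (F \<tau>)"
    unfolding F_def using tensor_act_comp[OF Mfacts w_words _ assms(2)] by simp
  then show ?thesis using F_stab[OF assms(1)] by (simp add: F_def)
qed

private lemma F_coset_rep:
  assumes K: "K \<in> stab_cosets d b r s" and \<sigma>: "\<sigma> \<in> K" "\<sigma>' \<in> K"
  shows "F \<sigma> = F \<sigma>'" "\<sigma> permutes {..<d}"
proof -
  obtain \<rho> where \<rho>: "\<rho> permutes {..<d}" "K = (\<lambda>\<tau>. \<tau> \<circ> \<rho>) ` triple_stab d b r s"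
    using K by (auto simp: stab_cosets_def)
  show "F \<sigma> = F \<sigma>'" using \<rho> \<sigma> F_coset by auto
  show "\<sigma> permutes {..<d}"
    using \<rho> \<sigma> by (auto simp: triple_stab_def intro: permutes_compose)
qed

private lemma coset_ne: "K \<in> stab_cosets d b r s \<Longrightarrow> (SOME \<sigma>. \<sigma> \<in> K) \<in> K"
  using triple_stab_group(1)[OF len(1-3)] by (auto simp: stab_cosets_def some_in_eq)

private lemma coset_shift:
  assumes "K \<in> stab_cosets d b r s" "\<rho> permutes {..<d}"
  shows "(\<lambda>\<sigma>. \<sigma> \<circ> \<rho>) ` K \<in> stab_cosets d b r s"
proof -
  obtain \<sigma> where \<sigma>: "\<sigma> permutes {..<d}" "K = (\<lambda>\<tau>. \<tau> \<circ> \<sigma>) ` triple_stab d b r s"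
    using assms by (auto simp: stab_cosets_def)
  have "(\<lambda>\<sigma>. \<sigma> \<circ> \<rho>) ` K = (\<lambda>\<tau>. \<tau> \<circ> (\<sigma> \<circ> \<rho>)) ` triple_stab d b r s"
    unfolding \<sigma>(2) image_image by (simp add: o_assoc)
  then show ?thesis
    using permutes_compose[OF assms(2) \<sigma>(1)] unfolding stab_cosets_def by blast
qed

lemma xi_invariant:
  assumes \<rho>: "\<rho> permutes {..<d}"
  shows "tensor_act (mat_superalg A) (mat_basis B) d \<rho> (xi A B d b r s) = xi A B d b r s"
proof -
  let ?rep = "\<lambda>K. SOME \<sigma>::nat \<Rightarrow> nat. \<sigma> \<in> K"
  have xi: "xi A B d b r s = (\<Sum>K\<in>stab_cosets d b r s. F (?rep K))"
    unfolding xi_def xi_tensor_def F_def ..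
  have "tensor_act M E d \<rho> (xi A B d b r s) = (\<Sum>K\<in>stab_cosets d b r s. F (?rep K \<circ> \<rho>))"
    unfolding xi tensor_act_sum[OF finite_stab_cosets]
  proof (rule sum.cong[OF refl])
    fix K assume K: "K \<in> stab_cosets d b r s"
    show "tensor_act M E d \<rho> (F (?rep K)) = F (?rep K \<circ> \<rho>)"
      unfolding F_def
      by (rule tensor_act_comp[OF Mfacts w_words F_coset_rep(2)[OF K coset_ne[OF K] coset_ne[OF K]] \<rho>])
  qed
  also have "\<dots> = (\<Sum>K\<in>stab_cosets d b r s. F (?rep K))"
  proof (rule sum.reindex_bij_witness[of _ "\<lambda>K. (\<lambda>\<sigma>. \<sigma> \<circ> inv \<rho>) ` K" "\<lambda>K. (\<lambda>\<sigma>. \<sigma> \<circ> \<rho>) ` K"])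
    fix K assume K: "K \<in> stab_cosets d b r s"
    show "(\<lambda>\<sigma>. \<sigma> \<circ> inv \<rho>) ` (\<lambda>\<sigma>. \<sigma> \<circ> \<rho>) ` K = K"
      using permutes_inv_o(1)[OF \<rho>] by (simp add: image_image comp_assoc)
    show "(\<lambda>\<sigma>. \<sigma> \<circ> \<rho>) ` (\<lambda>\<sigma>. \<sigma> \<circ> inv \<rho>) ` K = K"
      using permutes_inv_o(2)[OF \<rho>] by (simp add: image_image comp_assoc)
    show 1: "(\<lambda>\<sigma>. \<sigma> \<circ> \<rho>) ` K \<in> stab_cosets d b r s" by (rule coset_shift[OF K \<rho>])
    show "(\<lambda>\<sigma>. \<sigma> \<circ> inv \<rho>) ` K \<in> stab_cosets d b r s" by (rule coset_shift[OF K permutes_inv[OF \<rho>]])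
    show "F (?rep ((\<lambda>\<sigma>. \<sigma> \<circ> \<rho>) ` K)) = F (?rep K \<circ> \<rho>)"
      by (rule F_coset_rep(1)[OF 1 coset_ne[OF 1]]) (use coset_ne[OF K] in blast)
  qed
  finally show ?thesis by (simp add: xi)
qed

lemma xi_in_schur: "xi A B d b r s \<in> carr (schur_superalg A B d)"
proof -
  interpret f: module "fscale :: 'k \<Rightarrow> (('a^'n^'n) list \<Rightarrow> 'k) \<Rightarrow> ('a^'n^'n) list \<Rightarrow> 'k"
    by (rule module_fscale)
  have sub: "f.subspace (carr (tensor_power M E d))"
    by (rule subspace_tensor_power)
  have "tensor_act M E d \<sigma> f \<in> carr (tensor_power M E d)" for \<sigma> f
    unfolding tensor_act_def
    by (intro f.subspace_sum[OF sub] f.subspace_scale[OF sub] tens_in_carr) (auto simp: words_def)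
  then have "xi A B d b r s \<in> carr (tensor_power M E d)"
    unfolding xi_def by (intro f.subspace_sum[OF sub])
  then show ?thesis
    using xi_invariant by (simp add: schur_superalg_def tensor_invariants_def sub_superalg_def)
qed

end

theorem T_superalg_in_schur:
  assumes A: "superalgebra A" and bas: "module_basis (smul A) (carr A) B" and fin: "finite B"
    and hom: "B \<subseteq> even_part A \<union> odd_part A"
  shows "carr (T_superalg A B B\<cc> d :: ('k::comm_ring_1, ('a::ab_group_add^'n::finite^'n) list \<Rightarrow> 'k) superalg)
     \<subseteq> carr (schur_superalg A B d)"
proof -
  interpret f: module "fscale :: 'k \<Rightarrow> (('a^'n^'n) list \<Rightarrow> 'k) \<Rightarrow> ('a^'n^'n) list \<Rightarrow> 'k"
    by (rule module_fscale)
  let ?M = "mat_superalg A :: ('k, 'a^'n^'n) superalg" and ?E = "mat_basis B :: ('a^'n^'n) set"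
  have c: "carr (schur_superalg A B d) =
      {f \<in> carr (tensor_power ?M ?E d). \<forall>\<sigma>. \<sigma> permutes {..<d} \<longrightarrow> tensor_act ?M ?E d \<sigma> f = f}"
    by (simp add: schur_superalg_def tensor_invariants_def sub_superalg_def)
  have sub0: "f.subspace (carr (tensor_power ?M ?E d))"
    by (rule subspace_tensor_power)
  have sub: "f.subspace (carr (schur_superalg A B d) :: (('a^'n^'n) list \<Rightarrow> 'k) set)"
    unfolding f.subspace_def c
    using sub0 by (auto simp only: f.subspace_def mem_Collect_eq tensor_act_zero tensor_act_add tensor_act_scale)
  have "eta A B B\<cc> d b r s \<in> carr (schur_superalg A B d)"
    if "(b, r, s) \<in> Tri A B d" for b and r s :: "'n list"
    unfolding eta_def by (rule f.subspace_scale[OF sub xi_in_schur[OF A bas fin hom that]])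
  then have "f.span {eta A B B\<cc> d b r s |b r (s :: 'n list). (b, r, s) \<in> Tri A B d} \<subseteq> carr (schur_superalg A B d)"
    by (intro f.span_minimal[OF _ sub]) auto
  then show ?thesis by (simp add: T_superalg_def sub_superalg_def)
qed

end

theory Submission
  imports Defs
begin

text \<open>
  Let \<open>M\<close> be the matrix superalgebra with its basis \<open>E\<close> of matrix units, and let \<open>Ea\<close>, \<open>Ec\<close>
  consist of the units with entry in \<open>B\<aa>\<close>, \<open>B\<cc>\<close>.  The span of the \<open>eta\<close> consists of the invariant
  tensors whose coefficient at every word \<open>w\<close> is divisible by the product of the factorials of the
  multiplicities in \<open>w\<close> of the letters of \<open>Ec\<close>.  Orbit counting for the group that permutes equal
  letters of \<open>Ec\<close> in \<open>w\<close> shows that this condition is preserved by products.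

  On this span the \<open>d\<close>-th tensor power \<open>\<Theta>\<close> of the trace form is \<open>d!\<close> times the required form
  \<open>tT\<close>: the form vanishes on \<open>Ea\<close>, so only words in \<open>Ec\<close> contribute.  If \<open>star\<close> denotes the basis
  dual to \<open>E\<close>, then \<open>star\<close> maps \<open>Ec\<close> into the span of \<open>Ea\<close>.  Hence the tensors \<open>star v\<^sub>1 \<otimes> \<dots> \<otimes> star v\<^sub>d\<close>,
  weighted by the factorials of the multiplicities in \<open>v\<close> of the letters of \<open>Ea\<close>, combine to elements
  of the span again, by the same orbit counting, and they represent all linear forms.
\<close>

section \<open>Words and permutations of equal letters\<close>

text \<open>The scalars form a domain in which d! and the factorials of multiplicities need not be
  invertible, and this shapes the proof. Nondegeneracy over the fraction field would not give a
  bijection onto the dual module, so elements representing linear forms have to be written down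
  integrally. Quotients by integers are formed only where divisibility is known; they are unique
  because these integers are nonzero in characteristic 0.

  The number d! arises because \<open>\<Theta>\<close> is invariant under permutations, so that
  summing over all of them multiplies its value by d!.

  The weight of the tensors of dual letters has two tasks. Summing a word \<open>v\<close> over all
  permutations gives its \<open>eta\<close> times the factorials for \<open>Ea\<close>, so the
  weight is the factor that cancels when the pairing with this \<open>eta\<close> is computed.
  Moreover, a letter of \<open>Ec\<close> can occur in the expansion of a dual letter
  \<open>star e\<close> only if \<open>e\<close> lies in \<open>Ea\<close>; hence the same weight
  supplies the factorials for \<open>Ec\<close> that are demanded of the coefficients.

  The unit is needed for the form to vanish on \<aa> itself, and not only on products from
  \<aa>.\<close>

definition letter_fact :: "'b set \<Rightarrow> 'b list \<Rightarrow> nat" where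
  "letter_fact C w = (\<Prod>c\<in>C. fact (count (mset w) c))"

text \<open>A Young subgroup: the direct product of the symmetric groups on the position sets of the
  single letters of \<open>C\<close>. All other positions are fixed, so for a set \<open>C\<close>
  of even letters it acts without signs.\<close>

definition letter_perms :: "'b set \<Rightarrow> 'b list \<Rightarrow> (nat \<Rightarrow> nat) set" where
  "letter_perms C w =
     {\<sigma>. \<sigma> permutes {i. i < length w \<and> w ! i \<in> C} \<and> (\<forall>i<length w. w ! \<sigma> i = w ! i)}"

lemma count_mset_card: "count (mset w) x = card {i. i < length w \<and> w ! i = x}"
  by (simp add: count_mset count_list_eq_length_filter length_filter_conv_card eq_commute[of x])

lemma letter_permsD:
  assumes "\<sigma> \<in> letter_perms C w"
  shows "\<sigma> permutes {..<length w}" "permute_list \<sigma> w = w"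
    "i < length w \<Longrightarrow> w ! \<sigma> i = w ! i" "i < length w \<Longrightarrow> w ! i \<notin> C \<Longrightarrow> \<sigma> i = i"
proof -
  have p: "\<sigma> permutes {i. i < length w \<and> w ! i \<in> C}" and e: "\<And>i. i < length w \<Longrightarrow> w ! \<sigma> i = w ! i"
    using assms by (auto simp: letter_perms_def)
  show q: "\<sigma> permutes {..<length w}" by (rule permutes_subset[OF p]) auto
  show "permute_list \<sigma> w = w"
    using e q by (auto intro!: nth_equalityI simp: permute_list_nth)
  show "i < length w \<Longrightarrow> w ! \<sigma> i = w ! i" by (rule e)
  show "i < length w \<Longrightarrow> w ! i \<notin> C \<Longrightarrow> \<sigma> i = i"
    using permutes_not_in[OF p] by auto
qed

lemma permute_list_eq_iff:
  assumes "\<sigma> permutes {..<length w}"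
  shows "permute_list \<sigma> w = w \<longleftrightarrow> (\<forall>i<length w. w ! \<sigma> i = w ! i)"
  using assms by (auto simp: list_eq_iff_nth_eq permute_list_nth)

lemma letter_permsI:
  assumes \<sigma>: "\<sigma> permutes {..<length w}" "permute_list \<sigma> w = w"
    and fix1: "\<And>i. i < length w \<Longrightarrow> w ! i \<notin> C \<Longrightarrow> \<sigma> i = i"
  shows "\<sigma> \<in> letter_perms C w"
proof -
  have "\<sigma> permutes {i. i < length w \<and> w ! i \<in> C}"
    by (rule permutes_superset[OF \<sigma>(1)]) (use fix1 in auto)
  then show ?thesis
    using permute_list_eq_iff[OF \<sigma>(1)] \<sigma>(2) by (simp add: letter_perms_def)
qed

lemma id_in_letter_perms: "id \<in> letter_perms C w"
  by (simp add: letter_perms_def permutes_id)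

lemma comp_in_letter_perms:
  assumes "\<sigma> \<in> letter_perms C w" "\<tau> \<in> letter_perms C w"
  shows "\<sigma> \<circ> \<tau> \<in> letter_perms C w"
proof (rule letter_permsI)
  note S = letter_permsD[OF assms(1)] and T = letter_permsD[OF assms(2)]
  show "\<sigma> \<circ> \<tau> permutes {..<length w}" using S(1) T(1) by (simp add: permutes_compose)
  show "permute_list (\<sigma> \<circ> \<tau>) w = w" using S T by (simp add: permute_list_compose)
  show "(\<sigma> \<circ> \<tau>) i = i" if "i < length w" "w ! i \<notin> C" for i using S(4) T(4) that by simp
qed

lemma inv_in_letter_perms:
  assumes "\<sigma> \<in> letter_perms C w"
  shows "inv \<sigma> \<in> letter_perms C w"
proof (rule letter_permsI)
  note S = letter_permsD[OF assms]
  show "inv \<sigma> permutes {..<length w}" using S(1) by (rule permutes_inv)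
  show "permute_list (inv \<sigma>) w = w" using S(1,2) by (rule permute_list_inv_fixed)
  show "inv \<sigma> i = i" if "i < length w" "w ! i \<notin> C" for i
    using S(4)[OF that] permutes_inverses(2)[OF S(1), of i] by simp
qed

lemma finite_letter_perms: "finite (letter_perms C w)"
  by (rule finite_subset[of _ "{\<sigma>. \<sigma> permutes {..<length w}}"])
     (auto simp: letter_permsD finite_permutations)

text \<open>An element of the group is a family of permutations, one of the position set
  \<open>P c\<close> for each letter \<open>c\<close> in \<open>C\<close>; \<open>glue\<close> and
  \<open>part\<close> translate between the two descriptions.\<close>

lemma card_letter_perms:
  assumes "finite C"
  shows "card (letter_perms C w) = letter_fact C w"
proof -
  define P where "P c = {i. i < length w \<and> w ! i = c}" for c
  define S where "S = {i. i < length w \<and> w ! i \<in> C}"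
  have finS: "finite S" by (simp add: S_def)
  define glue where "glue g = (\<lambda>i. if i \<in> S then g (w ! i) i else i)" for g :: "'a \<Rightarrow> nat \<Rightarrow> nat"
  define part where "part \<sigma> = (\<lambda>c\<in>C. \<lambda>i. if i \<in> P c then \<sigma> i else i)" for \<sigma> :: "nat \<Rightarrow> nat"
  have gP: "g (w ! i) i \<in> P (w ! i)" if "g \<in> (\<Pi>\<^sub>E c\<in>C. {\<tau>. \<tau> permutes P c})" "i \<in> S" for g i
  proof -
    have "g (w ! i) permutes P (w ! i)" using that by (auto simp: S_def)
    then show ?thesis using that permutes_in_image by (fastforce simp: P_def S_def)
  qed
  have "bij_betw glue (\<Pi>\<^sub>E c\<in>C. {\<tau>. \<tau> permutes P c}) (letter_perms C w)"
  proof (rule bij_betw_byWitness[where f' = part])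
    show "\<forall>g\<in>\<Pi>\<^sub>E c\<in>C. {\<tau>. \<tau> permutes P c}. part (glue g) = g"
    proof
      fix g assume g: "g \<in> (\<Pi>\<^sub>E c\<in>C. {\<tau>. \<tau> permutes P c})"
      show "part (glue g) = g"
      proof (rule ext)
        fix c
        show "part (glue g) c = g c"
        proof (cases "c \<in> C")
          case True
          then have "g c permutes P c" using g by auto
          from permutes_not_in[OF this] True show ?thesis
            by (auto simp: part_def glue_def P_def S_def fun_eq_iff)
        next
          case False
          then show ?thesis using g by (auto simp: part_def PiE_def extensional_def)
        qed
      qed
    qed
    show "\<forall>\<sigma>\<in>letter_perms C w. glue (part \<sigma>) = \<sigma>"
      by (auto simp: letter_perms_def glue_def part_def P_def S_def fun_eq_iff dest: permutes_not_in)
    show "glue ` (\<Pi>\<^sub>E c\<in>C. {\<tau>. \<tau> permutes P c}) \<subseteq> letter_perms C w"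
    proof
      fix \<sigma> assume "\<sigma> \<in> glue ` (\<Pi>\<^sub>E c\<in>C. {\<tau>. \<tau> permutes P c})"
      then obtain g where g: "g \<in> (\<Pi>\<^sub>E c\<in>C. {\<tau>. \<tau> permutes P c})" "\<sigma> = glue g" by blast
      have w: "w ! glue g i = w ! i" for i
        using gP[OF g(1)] by (auto simp: glue_def P_def)
      have "glue g permutes S"
      proof (rule inj_imp_permutes)
        show "inj_on (glue g) S"
        proof (rule inj_onI)
          fix i j assume ij: "i \<in> S" "j \<in> S" "glue g i = glue g j"
          then have e: "w ! i = w ! j" using w by metis
          have "g (w ! j) permutes P (w ! j)" using g ij by (auto simp: S_def)
          then show "i = j"
            using ij e permutes_inj[THEN injD] by (fastforce simp: glue_def)
        qed
        show "glue g i \<in> S" if "i \<in> S" for i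
          using gP[OF g(1) that] that by (auto simp: glue_def S_def P_def)
        show "finite S" by fact
        show "glue g i = i" if "i \<notin> S" for i using that by (simp add: glue_def)
      qed
      then show "\<sigma> \<in> letter_perms C w" using w g(2) by (simp add: letter_perms_def S_def)
    qed
    show "part ` letter_perms C w \<subseteq> (\<Pi>\<^sub>E c\<in>C. {\<tau>. \<tau> permutes P c})"
    proof clarify
      fix \<sigma> assume \<sigma>: "\<sigma> \<in> letter_perms C w"
      have "(\<lambda>i. if i \<in> P c then \<sigma> i else i) permutes P c" if "c \<in> C" for c
      proof (rule inj_imp_permutes)
        show "inj_on (\<lambda>i. if i \<in> P c then \<sigma> i else i) (P c)"
          using permutes_inj[OF letter_permsD(1)[OF \<sigma>]] by (auto simp: inj_on_def)
        show "(if i \<in> P c then \<sigma> i else i) \<in> P c" if "i \<in> P c" for i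
          using that letter_permsD(3)[OF \<sigma>] permutes_in_image[OF letter_permsD(1)[OF \<sigma>], of i]
          by (auto simp: P_def)
      qed (auto simp: P_def)
      then show "part \<sigma> \<in> (\<Pi>\<^sub>E c\<in>C. {\<tau>. \<tau> permutes P c})" by (auto simp: part_def)
    qed
  qed
  then have "card (letter_perms C w) = card (\<Pi>\<^sub>E c\<in>C. {\<tau>. \<tau> permutes P c})"
    by (simp add: bij_betw_same_card)
  also have "\<dots> = (\<Prod>c\<in>C. card {\<tau>. \<tau> permutes P c})"
    by (rule card_PiE[OF assms])
  also have "\<dots> = letter_fact C w"
    unfolding letter_fact_def count_mset_card P_def[symmetric]
    by (intro prod.cong refl card_permutations) (auto simp: P_def)
  finally show ?thesis .
qed

text \<open>The function \<open>h\<close> is constant on the orbit of \<open>z\<close>, whose size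
  is the order of \<open>G\<close> divided by that of the stabilizer. Since the latter order divides
  \<open>h z\<close>, the orbit contributes a multiple of the order of \<open>G\<close>. The action
  \<open>a\<close> is a right action.\<close>

lemma orbit_sum_dvd:
  fixes h :: "'z \<Rightarrow> 'k::comm_ring_1" and G :: "('g \<Rightarrow> 'g) set"
  assumes fin: "finite G" "finite Z"
    and G: "id \<in> G" "\<And>\<sigma> \<tau>. \<sigma> \<in> G \<Longrightarrow> \<tau> \<in> G \<Longrightarrow> \<sigma> \<circ> \<tau> \<in> G" "\<And>\<sigma>. \<sigma> \<in> G \<Longrightarrow> inv \<sigma> \<in> G"
      "\<And>\<sigma>. \<sigma> \<in> G \<Longrightarrow> bij \<sigma>"
    and a: "\<And>\<sigma> z. \<sigma> \<in> G \<Longrightarrow> z \<in> Z \<Longrightarrow> a \<sigma> z \<in> Z" "\<And>z. z \<in> Z \<Longrightarrow> a id z = z"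
      "\<And>\<sigma> \<tau> z. \<sigma> \<in> G \<Longrightarrow> \<tau> \<in> G \<Longrightarrow> z \<in> Z \<Longrightarrow> a \<tau> (a \<sigma> z) = a (\<sigma> \<circ> \<tau>) z"
    and h: "\<And>\<sigma> z. \<sigma> \<in> G \<Longrightarrow> z \<in> Z \<Longrightarrow> h (a \<sigma> z) = h z"
      "\<And>z. z \<in> Z \<Longrightarrow> of_nat (card {\<sigma>\<in>G. a \<sigma> z = z}) dvd h z"
  shows "of_nat (card G) dvd (\<Sum>z\<in>Z. h z)"
  using fin(2) a h
proof (induction "card Z" arbitrary: Z rule: less_induct)
  case less
  note Z = less.prems
  show ?case
  proof (cases "Z = {}")
    case False
    then obtain z where z: "z \<in> Z" by blast
    define Y where "Y = (\<lambda>\<sigma>. a \<sigma> z) ` G"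
    have YZ: "Y \<subseteq> Z" using Z(2) z by (auto simp: Y_def)
    have zY: "z \<in> Y" using Z(3)[OF z] G(1) by (force simp: Y_def)
    have finY: "finite Y" using fin(1) by (simp add: Y_def)
    \<comment> \<open>The complement of an orbit is stable, so the induction hypothesis applies to
      it.\<close>
    have out: "a \<sigma> y \<notin> Y" if "\<sigma> \<in> G" "y \<in> Z - Y" for \<sigma> y
    proof
      assume "a \<sigma> y \<in> Y"
      then obtain \<tau> where \<tau>: "\<tau> \<in> G" "a \<sigma> y = a \<tau> z" by (auto simp: Y_def)
      have "\<sigma> \<circ> inv \<sigma> = id" using G(4)[OF that(1)] by (metis bij_is_surj surj_iff)
      then have "y = a (inv \<sigma>) (a \<sigma> y)" using Z(3,4) that G(3) by auto
      also have "\<dots> = a (\<tau> \<circ> inv \<sigma>) z" using \<tau> Z(4) z that G(3) by simp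
      finally have "y \<in> Y" using G(2)[OF \<tau>(1) G(3)[OF that(1)]] by (auto simp: Y_def)
      then show False using that by simp
    qed
    have "card (Z - Y) < card Z"
      using Z(1) zY z by (intro psubset_card_mono) auto
    from less.hyps[OF this] have rest: "of_nat (card G) dvd (\<Sum>z\<in>Z - Y. h z)"
      using Z out by auto
    \<comment> \<open>The fibres of the orbit map are the translates of the stabilizer by an element
      that carries \<open>z\<close> to \<open>y\<close>.\<close>
    have fiber: "card {\<sigma>\<in>G. a \<sigma> z = y} = card {\<sigma>\<in>G. a \<sigma> z = z}" if y: "y \<in> Y" for y
    proof -
      obtain \<tau> where \<tau>: "\<tau> \<in> G" "y = a \<tau> z" using y unfolding Y_def by blast
      have ti: "\<tau> \<circ> inv \<tau> = id" "inv \<tau> \<circ> \<tau> = id"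
        using G(4)[OF \<tau>(1)] by (metis bij_is_surj surj_iff, metis bij_is_inj inj_iff)
      have "bij_betw (\<lambda>\<sigma>. \<sigma> \<circ> \<tau>) {\<sigma>\<in>G. a \<sigma> z = z} {\<sigma>\<in>G. a \<sigma> z = y}"
      proof (rule bij_betw_byWitness[where f' = "\<lambda>\<sigma>. \<sigma> \<circ> inv \<tau>"])
        show "(\<lambda>\<sigma>. \<sigma> \<circ> \<tau>) ` {\<sigma>\<in>G. a \<sigma> z = z} \<subseteq> {\<sigma>\<in>G. a \<sigma> z = y}"
          using \<tau> Z(4) z G(2) by (auto simp flip: Z(4))
        show "(\<lambda>\<sigma>. \<sigma> \<circ> inv \<tau>) ` {\<sigma>\<in>G. a \<sigma> z = y} \<subseteq> {\<sigma>\<in>G. a \<sigma> z = z}"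
        proof safe
          fix \<sigma> assume \<sigma>: "\<sigma> \<in> G" "y = a \<sigma> z"
          show "\<sigma> \<circ> inv \<tau> \<in> G" using \<sigma> \<tau> G by simp
          have "a (\<sigma> \<circ> inv \<tau>) z = a (inv \<tau>) (a \<tau> z)" using \<sigma> \<tau> Z(4) z G(3) by metis
          also have "\<dots> = z" using Z(3,4) \<tau> z G(3) ti by simp
          finally show "a (\<sigma> \<circ> inv \<tau>) z = z" .
        qed
      qed (auto simp: comp_assoc ti)
      then show ?thesis by (simp add: bij_betw_same_card)
    qed
    have "card G = (\<Sum>y\<in>Y. card {\<sigma>\<in>G. a \<sigma> z = y})"
      using sum.group[OF fin(1) finY, of "\<lambda>\<sigma>. a \<sigma> z" "\<lambda>_. 1::nat"] by (simp add: Y_def)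
    also have "\<dots> = card Y * card {\<sigma>\<in>G. a \<sigma> z = z}" using fiber by simp
    finally have cG: "card G = card Y * card {\<sigma>\<in>G. a \<sigma> z = z}" .
    have "(\<Sum>y\<in>Y. h y) = (\<Sum>y\<in>Y. h z)"
      using Z(5) z by (intro sum.cong) (auto simp: Y_def)
    then have "of_nat (card G) dvd (\<Sum>y\<in>Y. h y)"
      using Z(6)[OF z] unfolding cG by (simp add: mult_dvd_mono)
    moreover have "(\<Sum>z\<in>Z. h z) = (\<Sum>z\<in>Z - Y. h z) + (\<Sum>y\<in>Y. h y)"
      using Z(1) YZ by (rule sum.subset_diff[rotated])
    ultimately show ?thesis using rest by simp
  qed simp
qed

text \<open>Orbit counting for the coefficient at \<open>w\<close> of a sum indexed by words
  \<open>z\<close>: permutations of equal letters of \<open>w\<close> act on the positions of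
  \<open>z\<close>.\<close>

lemma letter_fact_dvd_sum:
  fixes h :: "'z list \<Rightarrow> 'k::comm_ring_1"
  assumes fin: "finite C" "finite Z" and w: "length w = d"
    and inv: "\<And>\<sigma> z. \<sigma> \<in> letter_perms C w \<Longrightarrow> z \<in> words d Z \<Longrightarrow> h (permute_list \<sigma> z) = h z"
    and dvd: "\<And>z. z \<in> words d Z \<Longrightarrow> of_nat (letter_fact (C \<times> Z) (zip w z)) dvd h z"
  shows "of_nat (letter_fact C w) dvd (\<Sum>z\<in>words d Z. h z)"
  unfolding card_letter_perms[OF fin(1), symmetric]
proof (rule orbit_sum_dvd[where a = permute_list, OF finite_letter_perms finite_words[OF fin(2)] id_in_letter_perms
      comp_in_letter_perms inv_in_letter_perms _ _ _ _ inv])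
  show "bij \<sigma>" if "\<sigma> \<in> letter_perms C w" for \<sigma>
    using permutes_bij[OF letter_permsD(1)[OF that]] .
  show "permute_list \<sigma> z \<in> words d Z" if "\<sigma> \<in> letter_perms C w" "z \<in> words d Z" for \<sigma> z
    using letter_permsD(1)[OF that(1)] that(2) w by (intro permute_list_words) simp
  show "permute_list \<tau> (permute_list \<sigma> z) = permute_list (\<sigma> \<circ> \<tau>) z"
    if "\<sigma> \<in> letter_perms C w" "\<tau> \<in> letter_perms C w" "z \<in> words d Z" for \<sigma> \<tau> z
    using letter_permsD(1)[OF that(2)] that(3) w by (simp add: permute_list_compose words_def)
  show "of_nat (card {\<sigma> \<in> letter_perms C w. permute_list \<sigma> z = z}) dvd h z" if z: "z \<in> words d Z" for z
  proof -
    have l: "length z = d" "set z \<subseteq> Z" using z by (auto simp: words_def)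
    \<comment> \<open>Preserving both \<open>w\<close> and \<open>z\<close> means permuting
      positions that carry equal pairs, so the stabilizer is a group of the same kind and its order
      is again a product of factorials.\<close>
    have "letter_perms (C \<times> Z) (zip w z) = {\<sigma> \<in> letter_perms C w. permute_list \<sigma> z = z}"
    proof safe
      fix \<sigma> assume \<sigma>: "\<sigma> \<in> letter_perms (C \<times> Z) (zip w z)"
      note D = letter_permsD[OF \<sigma>]
      have p: "\<sigma> permutes {..<d}" using D(1) l w by simp
      then have \<sigma>d: "\<sigma> i < d" if "i < d" for i using permutes_in_image[OF p] that by simp
      have e: "w ! \<sigma> i = w ! i \<and> z ! \<sigma> i = z ! i" if "i < d" for i
        using D(3)[of i] \<sigma>d that l w by simp
      show "\<sigma> \<in> letter_perms C w"
        by (rule letter_permsI) (use p w e l D(4) in \<open>auto simp: permute_list_eq_iff\<close>)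
      show "permute_list \<sigma> z = z" using p l e by (simp add: permute_list_eq_iff)
    next
      fix \<sigma> assume \<sigma>: "\<sigma> \<in> letter_perms C w" "permute_list \<sigma> z = z"
      note D = letter_permsD[OF \<sigma>(1)]
      have zi: "z ! i \<in> Z" if "i < d" for i using l that by (metis nth_mem subsetD)
      show "\<sigma> \<in> letter_perms (C \<times> Z) (zip w z)"
      proof (rule letter_permsI)
        show "permute_list \<sigma> (zip w z) = zip w z"
          using D(1,2) \<sigma>(2) l w by (simp add: permute_list_zip[of _ "{..<d}"])
        show "\<sigma> i = i" if "i < length (zip w z)" "zip w z ! i \<notin> C \<times> Z" for i
          using that zi D(4)[of i] l w by auto
      qed (use D(1) l w in simp)
    qed
    then show ?thesis
      using dvd[OF z] card_letter_perms[of "C \<times> Z" "zip w z"] fin by simp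
  qed
qed simp_all

section \<open>Divisibility of factorials by multinomial denominators\<close>

lemma prod_fact_dvd_fact_sum: "(\<Prod>i\<in>I. fact (a i)) dvd (fact (\<Sum>i\<in>I. a i) :: nat)"
proof (induction I rule: infinite_finite_induct)
  case (insert i I)
  then show ?case
    using dvd_trans[OF mult_dvd_mono[OF dvd_refl insert.IH] fact_fact_dvd_fact] by simp
qed simp_all

text \<open>The map \<open>f\<close> merges letters, and the factorials of the multiplicities merged
  into one letter divide the factorial of their sum.\<close>

lemma letter_fact_map_dvd:
  assumes fin: "finite Y" "finite X" and f: "f ` Y \<subseteq> X"
  shows "letter_fact Y w dvd letter_fact X (map f w)"
proof -
  have "letter_fact Y w = (\<Prod>x\<in>X. \<Prod>y\<in>{y\<in>Y. f y = x}. fact (count (mset w) y))"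
    unfolding letter_fact_def by (rule prod.group[OF fin f, symmetric])
  also have "\<dots> dvd letter_fact X (map f w)"
    unfolding letter_fact_def
  proof (rule prod_dvd_prod)
    fix x
    have "(\<Sum>y\<in>{y\<in>Y. f y = x}. count (mset w) y) =
        (\<Sum>y\<in>{y\<in>Y. f y = x} \<inter> set_mset (mset w). count (mset w) y)"
      using fin(1) by (intro sum.mono_neutral_right) (auto simp: count_eq_zero_iff)
    \<comment> \<open>Letters of \<open>w\<close> outside \<open>Y\<close> may have the same image,
      hence only an inequality; the smaller factorial still divides the larger one.\<close>
    also have "\<dots> \<le> (\<Sum>y\<in>f -` {x} \<inter> set_mset (mset w). count (mset w) y)"
      by (rule sum_mono2) auto
    also have "\<dots> = count (mset (map f w)) x" by (simp add: count_image_mset)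
    finally show "(\<Prod>y\<in>{y\<in>Y. f y = x}. fact (count (mset w) y)) dvd (fact (count (mset (map f w)) x) :: nat)"
      using dvd_trans[OF prod_fact_dvd_fact_sum fact_dvd] by blast
  qed
  finally show ?thesis .
qed

lemma letter_fact_permute_list:
  "\<sigma> permutes {..<length w} \<Longrightarrow> letter_fact C (permute_list \<sigma> w) = letter_fact C w"
  by (simp add: letter_fact_def)

lemma letter_fact_nonzero: "letter_fact C w \<noteq> 0"
  by (cases "finite C") (simp_all add: letter_fact_def)

section \<open>Signs and the tensor power\<close>

text \<open>
  Signs are computed from parity functions on positions instead of from the letters themselves:
  the letter 0 is both even and odd, so the parity of a product of letters is not determined by
  its value.
\<close>

definition koszul :: "nat \<Rightarrow> (nat \<Rightarrow> bool) \<Rightarrow> (nat \<Rightarrow> bool) \<Rightarrow> 'k::comm_ring_1" where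
  "koszul d p q = (\<Prod>(i, j)\<in>{(i, j). j < i \<and> i < d}. if p i \<and> q j then - 1 else 1)"

text \<open>Both signs are products over the same pairs (i, j) with j < i, so identities between
  them can be checked factor by factor, if necessary after reindexing.\<close>

definition crossing :: "nat \<Rightarrow> (nat \<Rightarrow> nat) \<Rightarrow> (nat \<Rightarrow> bool) \<Rightarrow> 'k::comm_ring_1" where
  "crossing d \<sigma> p =
     (\<Prod>(i, j)\<in>{(i, j). j < i \<and> i < d}. if inv \<sigma> i < inv \<sigma> j \<and> p i \<and> p j then - 1 else 1)"

lemma finite_index_pairs: "finite {(i, j). j < i \<and> i < (d::nat)}"
  by (rule finite_subset[of _ "{..<d} \<times> {..<d}"]) auto

lemma minus_one_power_card:
  assumes "finite P"
  shows "(- 1) ^ card {x\<in>P. Q x} = (\<Prod>x\<in>P. if Q x then - 1 else (1::'k::comm_ring_1))"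
proof -
  have "(\<Prod>x\<in>P. if Q x then - 1 else (1::'k)) = (\<Prod>x\<in>{x\<in>P. Q x}. - 1)"
    by (rule prod.inter_filter[OF assms, symmetric])
  then show ?thesis by simp
qed

lemma mul_sign_koszul:
  assumes "length u = d"
  shows "mul_sign M u v = koszul d (\<lambda>i. u ! i \<in> odd_part M) (\<lambda>i. v ! i \<in> odd_part M)"
proof -
  have "{(i, j). j < i \<and> i < length u \<and> u ! i \<in> odd_part M \<and> v ! j \<in> odd_part M} =
    {x\<in>{(i, j). j < i \<and> i < d}. u ! fst x \<in> odd_part M \<and> v ! snd x \<in> odd_part M}"
    using assms by auto
  then show ?thesis
    unfolding mul_sign_def koszul_def
    by (simp only: minus_one_power_card[OF finite_index_pairs, unfolded case_prod_unfold] case_prod_unfold)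
qed

lemma inversions_crossing:
  assumes "length u = d"
  shows "(- 1) ^ inversions M \<sigma> u = crossing d \<sigma> (\<lambda>i. u ! i \<in> odd_part M)"
proof -
  let ?S = "{x\<in>{(i, j). j < i \<and> i < d}. inv \<sigma> (fst x) < inv \<sigma> (snd x) \<and>
      u ! fst x \<in> odd_part M \<and> u ! snd x \<in> odd_part M}"
  have "inversions M \<sigma> u = card (prod.swap ` ?S)"
    unfolding inversions_def
    by (rule arg_cong[where f = card]) (use assms in \<open>force simp: image_iff\<close>)
  also have "\<dots> = card ?S" by (rule card_image) (auto simp: inj_on_def)
  finally show ?thesis
    unfolding crossing_def
    by (simp only: minus_one_power_card[OF finite_index_pairs, unfolded case_prod_unfold] case_prod_unfold)
qed

lemma koszul_cong:
  assumes "\<And>i. i < d \<Longrightarrow> p i = p' i" "\<And>i. i < d \<Longrightarrow> q i = q' i"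
  shows "koszul d p q = koszul d p' q'"
  unfolding koszul_def using assms by (intro prod.cong) auto

lemma crossing_cong:
  assumes "\<And>i. i < d \<Longrightarrow> p i = p' i"
  shows "crossing d \<sigma> p = crossing d \<sigma> p'"
  unfolding crossing_def using assms by (intro prod.cong) auto

text \<open>Inequality of Booleans is addition of parities. That the sign is bimultiplicative for it
  is what makes the tensor product associative.\<close>

lemma koszul_xor:
  "koszul d (\<lambda>i. p i \<noteq> q i) r = koszul d p r * koszul d q r"
  "koszul d r (\<lambda>i. p i \<noteq> q i) = koszul d r p * koszul d r q"
  unfolding koszul_def prod.distrib[symmetric] by (intro prod.cong; auto)+

lemma koszul_square: "koszul d p q * koszul d p q = 1"
  unfolding koszul_def prod.distrib[symmetric] by (intro prod.neutral) auto

lemma crossing_square: "crossing d \<sigma> p * crossing d \<sigma> p = 1"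
  unfolding crossing_def prod.distrib[symmetric] by (intro prod.neutral) auto

text \<open>Only pairs of positions with \<open>p\<close> contribute, and these positions do not
  move. This removes the signs from the action of \<open>letter_perms\<close> for even
  letters.\<close>

lemma crossing_eq_1:
  assumes \<sigma>: "\<sigma> permutes {..<d}" and fix1: "\<And>i. i < d \<Longrightarrow> p i \<Longrightarrow> \<sigma> i = i"
  shows "crossing d \<sigma> p = 1"
proof -
  have "inv \<sigma> i = i" if "i < d" "p i" for i
    using fix1[OF that] permutes_inverses(2)[OF \<sigma>, of i] by simp
  then show ?thesis unfolding crossing_def by (intro prod.neutral) auto
qed

text \<open>The inverted pairs are (l, k) itself and, for every position with \<open>p\<close>
  strictly between, one pair with \<open>k\<close> and one with \<open>l\<close>; their number is
  odd.\<close>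

lemma crossing_transpose:
  assumes kl: "k < l" "l < d" "p k" "p l"
  shows "crossing d (transpose k l) p = (- 1 :: 'k::comm_ring_1)"
proof -
  define J where "J = {j. k < j \<and> j < l \<and> p j}"
  have finJ: "finite J" by (simp add: J_def)
  have "{x\<in>{(i, j). j < i \<and> i < d}. transpose k l (fst x) < transpose k l (snd x) \<and> p (fst x) \<and> p (snd x)}
      = insert (l, k) ((\<lambda>j. (j, k)) ` J \<union> (\<lambda>j. (l, j)) ` J)" (is "?D = _")
    using kl by (auto simp: J_def transpose_def image_iff split: if_splits)
  also have "card \<dots> = Suc (card ((\<lambda>j. (j, k)) ` J \<union> (\<lambda>j. (l, j)) ` J))"
    using finJ by (subst card_insert_disjoint) (auto simp: J_def)
  also have "card ((\<lambda>j. (j, k)) ` J \<union> (\<lambda>j. (l, j)) ` J) = 2 * card J"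
    using finJ by (subst card_Un_disjoint) (auto simp: J_def card_image inj_on_def)
  finally have "(- 1 :: 'k) ^ card ?D = - 1" by simp
  then show ?thesis
    unfolding crossing_def
    by (simp only: minus_one_power_card[OF finite_index_pairs, unfolded case_prod_unfold] case_prod_unfold inv_transpose_eq)
qed

text \<open>The sign identity behind \<open>act_tmul\<close>, by which permutations act as algebra
  automorphisms.\<close>

lemma koszul_permute:
  assumes \<sigma>: "\<sigma> permutes {..<d}"
  shows "koszul d (\<lambda>i. p (\<sigma> i)) (\<lambda>i. q (\<sigma> i)) * crossing d \<sigma> p * crossing d \<sigma> q =
    koszul d p q * (crossing d \<sigma> (\<lambda>i. p i \<noteq> q i) :: 'k::comm_ring_1)"
proof -
  let ?P = "{(i, j). j < i \<and> i < d}"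
  define srt where "srt h = (\<lambda>(i, j). (max (h i) (h j), min (h i) (h j :: nat)))" for h :: "nat \<Rightarrow> nat"
  have io: "\<sigma> (inv \<sigma> k) = k" "inv \<sigma> (\<sigma> k) = k" for k
    using permutes_inverses[OF \<sigma>] by auto
  have lt: "\<sigma> k < d \<longleftrightarrow> k < d" "inv \<sigma> k < d \<longleftrightarrow> k < d" for k
    using permutes_in_image[OF \<sigma>] permutes_in_image[OF permutes_inv[OF \<sigma>]] by simp_all
  have inj: "inv \<sigma> k = inv \<sigma> l \<longleftrightarrow> k = l" "\<sigma> k = \<sigma> l \<longleftrightarrow> k = l" for k l
    by (metis io)+
  \<comment> \<open>Pairs are replaced by their images, sorted again by \<open>srt\<close>; where
    \<sigma> reverses the order of a pair, \<open>p\<close> and \<open>q\<close> exchange their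
    roles.\<close>
  have "koszul d (\<lambda>i. p (\<sigma> i)) (\<lambda>i. q (\<sigma> i)) =
      (\<Prod>(i, j)\<in>?P. if inv \<sigma> j < inv \<sigma> i then (if p i \<and> q j then - 1 else 1)
         else (if p j \<and> q i then - 1 else (1::'k)))"
    unfolding koszul_def
  proof (rule prod.reindex_bij_witness[of _ "srt (inv \<sigma>)" "srt \<sigma>"])
    fix x assume x: "x \<in> ?P"
    obtain i j where ij: "x = (i, j)" "j < i" "i < d" using x by auto
    have ne: "\<sigma> i \<noteq> \<sigma> j" "inv \<sigma> i \<noteq> inv \<sigma> j" using ij inj by auto
    show "srt (inv \<sigma>) (srt \<sigma> x) = x" "srt \<sigma> (srt (inv \<sigma>) x) = x"
      using ij io by (auto simp: srt_def min_def max_def)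
    show "srt \<sigma> x \<in> ?P" "srt (inv \<sigma>) x \<in> ?P"
      using ij ne lt by (auto simp: srt_def min_def max_def)
    show "(case srt \<sigma> x of (i, j) \<Rightarrow> if inv \<sigma> j < inv \<sigma> i then (if p i \<and> q j then - 1 else 1)
         else (if p j \<and> q i then - 1 else (1::'k))) =
      (case x of (i, j) \<Rightarrow> if p (\<sigma> i) \<and> q (\<sigma> j) then - 1 else 1)"
      using ij ne io by (auto simp: srt_def min_def max_def)
  qed
  then have "koszul d (\<lambda>i. p (\<sigma> i)) (\<lambda>i. q (\<sigma> i)) * crossing d \<sigma> p * crossing d \<sigma> q =
      (\<Prod>x\<in>?P. (case x of (i, j) \<Rightarrow> if inv \<sigma> j < inv \<sigma> i then (if p i \<and> q j then - 1 else 1)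
         else (if p j \<and> q i then - 1 else (1::'k))) *
       (case x of (i, j) \<Rightarrow> if inv \<sigma> i < inv \<sigma> j \<and> p i \<and> p j then - 1 else 1) *
       (case x of (i, j) \<Rightarrow> if inv \<sigma> i < inv \<sigma> j \<and> q i \<and> q j then - 1 else 1))"
    unfolding crossing_def by (simp only: prod.distrib)
  \<comment> \<open>On an inverted pair this is the expansion of (p i + q i)(p j + q j) modulo 2; on
    all other pairs the crossing factors are 1.\<close>
  also have "\<dots> = (\<Prod>x\<in>?P. (case x of (i, j) \<Rightarrow> if p i \<and> q j then - 1 else 1) *
       (case x of (i, j) \<Rightarrow> if inv \<sigma> i < inv \<sigma> j \<and> p i \<noteq> q i \<and> p j \<noteq> q j then - 1 else 1))"
  proof (rule prod.cong[OF refl])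
    fix x assume x: "x \<in> ?P"
    obtain i j where ij: "x = (i, j)" "j < i" "i < d" using x by auto
    then have "inv \<sigma> i \<noteq> inv \<sigma> j" using inj by auto
    then show "(case x of (i, j) \<Rightarrow> if inv \<sigma> j < inv \<sigma> i then (if p i \<and> q j then - 1 else 1)
         else (if p j \<and> q i then - 1 else (1::'k))) *
       (case x of (i, j) \<Rightarrow> if inv \<sigma> i < inv \<sigma> j \<and> p i \<and> p j then - 1 else 1) *
       (case x of (i, j) \<Rightarrow> if inv \<sigma> i < inv \<sigma> j \<and> q i \<and> q j then - 1 else 1) =
      (case x of (i, j) \<Rightarrow> if p i \<and> q j then - 1 else 1) *
       (case x of (i, j) \<Rightarrow> if inv \<sigma> i < inv \<sigma> j \<and> p i \<noteq> q i \<and> p j \<noteq> q j then - 1 else 1)"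
      unfolding ij(1) by (cases "inv \<sigma> i < inv \<sigma> j"; cases "p i"; cases "p j"; cases "q i"; cases "q j") auto
  qed
  finally show ?thesis unfolding koszul_def crossing_def by (simp only: prod.distrib)
qed

lemma even_card_xor:
  assumes "finite P"
  shows "even (card {i\<in>P. p i \<noteq> q i}) \<longleftrightarrow> (even (card {i\<in>P. p i}) \<longleftrightarrow> even (card {i\<in>P. q i}))"
proof -
  have "(- 1 :: int) ^ card {i\<in>P. p i \<noteq> q i} = (- 1) ^ card {i\<in>P. p i} * (- 1) ^ card {i\<in>P. q i}"
    unfolding minus_one_power_card[OF assms] prod.distrib[symmetric] by (intro prod.cong) auto
  then show ?thesis by (auto simp: minus_one_power_iff split: if_splits)
qed

section \<open>Tensor powers of a superalgebra with a finite homogeneous basis\<close>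

locale based_superalgebra =
  fixes M :: "('k::comm_ring_1, 'm::ab_group_add) superalg" and E :: "'m set" and d :: nat
  assumes superalg: "superalgebra M"
    and basis: "module_basis (smul M) (carr M) E"
    and finite_basis: "finite E"
    and homogeneous: "E \<subseteq> even_part M \<union> odd_part M"
begin

sublocale sc: module "smul M" using superalgebraD(1)[OF superalg] .

sublocale fn: module "fscale :: 'k \<Rightarrow> ('m list \<Rightarrow> 'k) \<Rightarrow> 'm list \<Rightarrow> 'k" by (rule module_fscale)

abbreviation "V \<equiv> tensor_power M E d"
abbreviation "tmul \<equiv> tensor_mul M E d"
abbreviation "act \<equiv> tensor_act M E d"
abbreviation "te \<equiv> tens M E"
abbreviation "par u \<equiv> (\<lambda>i. u ! i \<in> odd_part M)"

definition homog :: "(nat \<Rightarrow> bool) \<Rightarrow> 'm list \<Rightarrow> bool" where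
  "homog p xs \<longleftrightarrow> length xs = d \<and> (\<forall>i<d. xs ! i \<in> (if p i then odd_part M else even_part M))"

lemmas Mul = superalgebraD[OF superalg]

lemma independent_E: "sc.independent E" and span_E: "sc.span E = carr M"
  using basis by (auto simp: module_basis_def)

lemma E_carr: "E \<subseteq> carr M" using span_E sc.span_superset by blast

lemma E_nonzero: "e \<in> E \<Longrightarrow> e \<noteq> 0"
  using independent_E sc.dependent_zero by blast

lemma even_odd_zero: "x \<in> even_part M \<Longrightarrow> x \<in> odd_part M \<Longrightarrow> x = 0"
  using Mul(5) by (auto simp: direct_sum_def)

lemma zero_carr: "0 \<in> carr M" by (rule sc.subspace_0[OF Mul(2)])

lemma mul_zero: "x \<in> carr M \<Longrightarrow> mul M 0 x = 0" "x \<in> carr M \<Longrightarrow> mul M x 0 = 0"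
  using Mul(9)[OF zero_carr, of x 0] Mul(10)[OF _ zero_carr, of x 0] by simp_all

lemma fin_words: "finite (words d E)" by (rule finite_words[OF finite_basis])

lemma wordsD: "u \<in> words d X \<Longrightarrow> length u = d" "u \<in> words d X \<Longrightarrow> i < d \<Longrightarrow> u ! i \<in> X"
  by (auto simp: words_def)

lemma homogD:
  assumes "homog p xs"
  shows "length xs = d" "i < d \<Longrightarrow> xs ! i \<in> (if p i then odd_part M else even_part M)"
    "i < d \<Longrightarrow> xs ! i \<in> carr M" "xs \<in> words d (even_part M \<union> odd_part M)" "xs \<in> words d (carr M)"
proof -
  show l: "length xs = d" and h: "i < d \<Longrightarrow> xs ! i \<in> (if p i then odd_part M else even_part M)" for i
    using assms by (auto simp: homog_def)
  have h': "i < d \<Longrightarrow> xs ! i \<in> even_part M \<union> odd_part M" for i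
    using h[of i] by (auto split: if_splits)
  then show w: "xs \<in> words d (even_part M \<union> odd_part M)"
    using l by (force simp: words_def in_set_conv_nth)
  then show "xs \<in> words d (carr M)"
    using homogeneous_in_carr[OF superalg] by (auto simp: words_def)
  then show "i < d \<Longrightarrow> xs ! i \<in> carr M" by (rule wordsD)
qed

lemma homog_par_iff: "homog p xs \<Longrightarrow> i < d \<Longrightarrow> xs ! i \<noteq> 0 \<Longrightarrow> xs ! i \<in> odd_part M \<longleftrightarrow> p i"
  using homogD(2)[of p xs i] even_odd_zero by (auto split: if_splits)

lemma homog_word: "u \<in> words d E \<Longrightarrow> homog (par u) u"
  using homogeneous wordsD(2)[of u E] by (auto simp: homog_def wordsD(1))

lemma word_carr: "u \<in> words d E \<Longrightarrow> u \<in> words d (carr M)"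
  using E_carr by (auto simp: words_def)

lemma homog_mul:
  assumes "homog p xs" "homog q ys"
  shows "homog (\<lambda>i. p i \<noteq> q i) (map2 (mul M) xs ys)"
  unfolding homog_def
proof (intro conjI allI impI)
  fix i assume i: "i < d"
  show "map2 (mul M) xs ys ! i \<in> (if p i \<noteq> q i then odd_part M else even_part M)"
    using homogD(2)[OF assms(1) i] homogD(2)[OF assms(2) i] homogD(1)[OF assms(1)] homogD(1)[OF assms(2)] i
    by (auto intro: Mul(12-15) split: if_splits)
qed (use homogD(1) assms in simp)

lemma homog_permute:
  assumes \<sigma>: "\<sigma> permutes {..<d}" and "homog p xs"
  shows "homog (\<lambda>i. p (\<sigma> i)) (permute_list \<sigma> xs)"
  using assms permutes_in_image[OF \<sigma>] by (auto simp: homog_def permute_list_nth)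

lemma tens_zero: "i < length xs \<Longrightarrow> xs ! i = 0 \<Longrightarrow> te xs = 0"
  by (auto simp: tens_def fun_eq_iff sc.representation_zero intro!: prod_zero bexI[of _ i])

lemma tmul_add:
  "tmul (f + g) h = tmul f h + tmul g h" "tmul h (f + g) = tmul h f + tmul h g"
  unfolding tensor_mul_def fun_eq_iff plus_fun_apply fsum_apply fscale_def
  by (simp_all add: sum.distrib algebra_simps)

lemma tmul_scale:
  "tmul (fscale c f) h = fscale c (tmul f h)" "tmul h (fscale c f) = fscale c (tmul h f)"
  unfolding tensor_mul_def fun_eq_iff fsum_apply fscale_def
  by (simp_all add: sum_distrib_left algebra_simps)

lemma tmul_zero: "tmul 0 h = 0" "tmul h 0 = 0"
  unfolding tensor_mul_def fun_eq_iff fsum_apply fscale_def by simp_all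

text \<open>If a letter is zero, both sides vanish whatever \<open>p\<close> and \<open>q\<close>
  say. Otherwise the patterns are the actual parities, and the product formula for pure tensors
  applies.\<close>

lemma tmul_tens:
  assumes "homog p xs" "homog q ys"
  shows "tmul (te xs) (te ys) = fscale (koszul d p q) (te (map2 (mul M) xs ys))"
proof (cases "\<exists>i<d. xs ! i = 0 \<or> ys ! i = 0")
  case True
  then obtain i where i: "i < d" "xs ! i = 0 \<or> ys ! i = 0" by blast
  have l: "length xs = d" "length ys = d" using homogD(1) assms by auto
  have "map2 (mul M) xs ys ! i = 0"
    using i l homogD(3)[OF assms(1) i(1)] homogD(3)[OF assms(2) i(1)] mul_zero by auto
  then have "te (map2 (mul M) xs ys) = 0" using i l by (intro tens_zero) auto
  moreover have "te xs = 0 \<or> te ys = 0" using i l tens_zero by metis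
  ultimately show ?thesis by (auto simp: tmul_zero)
next
  case False
  have "mul_sign M xs ys = (koszul d p q :: 'k)"
    unfolding mul_sign_koszul[OF homogD(1)[OF assms(1)]]
    using False homog_par_iff[OF assms(1)] homog_par_iff[OF assms(2)] by (intro koszul_cong) auto
  then show ?thesis
    using tensor_mul_tens[OF superalg basis finite_basis homogeneous homogD(4)[OF assms(1)] homogD(4)[OF assms(2)]]
    by simp
qed

lemma act_tens:
  assumes xs: "homog p xs" and \<sigma>: "\<sigma> permutes {..<d}"
  shows "act \<sigma> (te xs) = fscale (crossing d \<sigma> p) (te (permute_list \<sigma> xs))"
proof (cases "\<exists>i<d. xs ! i = 0")
  case True
  then obtain i where i: "i < d" "xs ! i = 0" by blast
  have l: "length xs = d" using homogD(1) xs by auto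
  have "permute_list \<sigma> xs ! (inv \<sigma> i) = 0" "inv \<sigma> i < d"
    using i l \<sigma> permutes_inverses[OF \<sigma>] permutes_in_image[OF permutes_inv[OF \<sigma>], of i]
    by (auto simp: permute_list_nth)
  then have "te (permute_list \<sigma> xs) = 0" using l by (intro tens_zero) auto
  moreover have "te xs = 0" using i l tens_zero by metis
  ultimately show ?thesis by (simp add: tensor_act_zero)
next
  case False
  have "(- 1) ^ inversions M \<sigma> xs = (crossing d \<sigma> p :: 'k)"
    unfolding inversions_crossing[OF homogD(1)[OF xs]]
    using False homog_par_iff[OF xs] by (intro crossing_cong) auto
  then show ?thesis
    using tensor_act_tens[OF superalg basis finite_basis homogeneous homogD(4)[OF xs] \<sigma>] by simp
qed

lemma V_carr: "carr V = {f. \<forall>w. f w \<noteq> 0 \<longrightarrow> w \<in> words d E}"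
  and V_even: "even_part V = {f. \<forall>w. f w \<noteq> 0 \<longrightarrow> w \<in> words d E \<and> even (odd_count M w)}"
  and V_odd: "odd_part V = {f. \<forall>w. f w \<noteq> 0 \<longrightarrow> w \<in> words d E \<and> odd (odd_count M w)}"
  and V_smul: "smul V = fscale" and V_mul: "mul V = tmul"
  by (simp_all add: tensor_power_def)

lemma tens_word': "u \<in> words d E \<Longrightarrow> te u w = (if w = u then 1 else 0)"
  using tens_word[OF Mul(1) basis] by (simp add: fun_eq_iff)

lemma V_expand: "f \<in> carr V \<Longrightarrow> f = (\<Sum>u\<in>words d E. fscale (f u) (te u))"
  by (rule tens_expand[OF Mul(1) basis finite_basis])

lemma V_subspace: "fn.subspace (carr V)" by (rule subspace_tensor_power)

lemma te_carr: "length xs = d \<Longrightarrow> te xs \<in> carr V" by (rule tens_in_carr)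

text \<open>Reduces identities that are linear in \<open>f\<close> to tensors of basis
  words.\<close>

lemma V_induct [consumes 1, case_names zero add tens]:
  assumes f: "f \<in> carr V" and 0: "P 0" and add: "\<And>f g. P f \<Longrightarrow> P g \<Longrightarrow> P (f + g)"
    and sc: "\<And>c u. u \<in> words d E \<Longrightarrow> P (fscale c (te u))"
  shows "P f"
proof -
  have "P (\<Sum>u\<in>F. fscale (f u) (te u))" if "finite F" "F \<subseteq> words d E" for F
    using that
  proof (induction F rule: finite_induct)
    case empty
    then show ?case using 0 by (simp add: zero_fun_def)
  next
    case (insert u F)
    then show ?case unfolding sum.insert[OF insert.hyps] by (intro add sc) auto
  qed
  from this[OF fin_words order_refl] show ?thesis using V_expand[OF f] by simp
qed

lemma tmul_carr: "tmul f g \<in> carr V"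
  unfolding tensor_mul_def
  by (intro fn.subspace_sum[OF V_subspace] fn.subspace_scale[OF V_subspace] te_carr) (auto simp: words_def)

lemma act_carr: "act \<sigma> f \<in> carr V"
  unfolding tensor_act_def
  by (intro fn.subspace_sum[OF V_subspace] fn.subspace_scale[OF V_subspace] te_carr) (auto simp: words_def)

lemma tmul_assoc:
  assumes "f \<in> carr V" "g \<in> carr V" "h \<in> carr V"
  shows "tmul (tmul f g) h = tmul f (tmul g h)"
  using assms(1)
proof (induction f rule: V_induct)
  case (tens c u)
  have "tmul (tmul (te u) g) h = tmul (te u) (tmul g h)"
    using assms(2)
  proof (induction g rule: V_induct)
    case (tens c v)
    have "tmul (tmul (te u) (te v)) h = tmul (te u) (tmul (te v) h)"
      using assms(3)
    proof (induction h rule: V_induct)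
      case (tens c w)
      note W = homog_word[OF \<open>u \<in> words d E\<close>] homog_word[OF \<open>v \<in> words d E\<close>] homog_word[OF \<open>w \<in> words d E\<close>]
      have "map2 (mul M) (map2 (mul M) u v) w = map2 (mul M) u (map2 (mul M) v w)"
        using homogD(1)[OF W(1)] homogD(1)[OF W(2)] homogD(1)[OF W(3)] homogD(3)[OF W(1)] homogD(3)[OF W(2)] homogD(3)[OF W(3)]
        by (auto intro!: nth_equalityI Mul(11))
      then have "tmul (tmul (te u) (te v)) (te w) = tmul (te u) (tmul (te v) (te w))"
        unfolding tmul_tens[OF W(1,2)] tmul_tens[OF W(2,3)] tmul_scale
          tmul_tens[OF homog_mul[OF W(1,2)] W(3)] tmul_tens[OF W(1) homog_mul[OF W(2,3)]]
          fn.scale_scale koszul_xor by (simp only: ac_simps)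
      then show ?case by (simp only: tmul_scale)
    qed (simp_all only: tmul_zero tmul_add)
    then show ?case by (simp only: tmul_scale)
  qed (simp_all only: tmul_zero tmul_add)
  then show ?case by (simp only: tmul_scale)
qed (simp_all only: tmul_zero tmul_add)

lemma act_tmul:
  assumes \<sigma>: "\<sigma> permutes {..<d}" and "f \<in> carr V" "g \<in> carr V"
  shows "act \<sigma> (tmul f g) = tmul (act \<sigma> f) (act \<sigma> g)"
  using assms(2)
proof (induction f rule: V_induct)
  case (tens c u)
  have "act \<sigma> (tmul (te u) g) = tmul (act \<sigma> (te u)) (act \<sigma> g)"
    using assms(3)
  proof (induction g rule: V_induct)
    case (tens c v)
    note W = homog_word[OF \<open>u \<in> words d E\<close>] homog_word[OF \<open>v \<in> words d E\<close>]
    have l: "length u = d" "length v = d" using homogD(1) W by auto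
    have p: "permute_list \<sigma> (map2 (mul M) u v) = map2 (mul M) (permute_list \<sigma> u) (permute_list \<sigma> v)"
      using \<sigma> l by (simp add: permute_list_map permute_list_zip[of _ "{..<d}"])
    have "act \<sigma> (tmul (te u) (te v)) = tmul (act \<sigma> (te u)) (act \<sigma> (te v))"
      unfolding tmul_tens[OF W] tensor_act_scale act_tens[OF homog_mul[OF W] \<sigma>]
        act_tens[OF W(1) \<sigma>] act_tens[OF W(2) \<sigma>] tmul_scale
        tmul_tens[OF homog_permute[OF \<sigma> W(1)] homog_permute[OF \<sigma> W(2)]] p fn.scale_scale
        koszul_permute[OF \<sigma>, symmetric] by (simp only: ac_simps)
    then show ?case by (simp only: tmul_scale tensor_act_scale)
  qed (simp_all only: tmul_zero tmul_add tensor_act_add tensor_act_zero)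
  then show ?case by (simp only: tmul_scale tensor_act_scale)
qed (simp_all only: tmul_zero tmul_add tensor_act_add tensor_act_zero)

lemma act_act:
  assumes "f \<in> carr V" "\<sigma> permutes {..<d}" "\<rho> permutes {..<d}"
  shows "act \<rho> (act \<sigma> f) = act (\<sigma> \<circ> \<rho>) f"
  using assms(1)
proof (induction f rule: V_induct)
  case (tens c u)
  then show ?case
    unfolding tensor_act_scale
    using tensor_act_comp[OF superalg basis finite_basis homogeneous homogD(4)[OF homog_word] assms(2,3)] by simp
qed (simp_all only: tensor_act_add tensor_act_zero)

text \<open>Permuting positions is injective on words, so a single word contributes. Invariance of a
  tensor thereby becomes a condition on its coefficients.\<close>

lemma act_coeff:
  assumes u: "u \<in> words d E" and \<sigma>: "\<sigma> permutes {..<d}"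
  shows "act \<sigma> f (permute_list \<sigma> u) = crossing d \<sigma> (par u) * f u"
proof -
  have inj: "permute_list \<sigma> u = permute_list \<sigma> v \<longleftrightarrow> u = v" if "v \<in> words d E" for v
  proof
    assume "permute_list \<sigma> u = permute_list \<sigma> v"
    then have "permute_list (inv \<sigma>) (permute_list \<sigma> u) = permute_list (inv \<sigma>) (permute_list \<sigma> v)" by simp
    then have "permute_list (\<sigma> \<circ> inv \<sigma>) u = permute_list (\<sigma> \<circ> inv \<sigma>) v"
      using permutes_inv[OF \<sigma>] wordsD(1)[OF that] wordsD(1)[OF u] by (simp add: permute_list_compose)
    then show "u = v" using permutes_inv_o(1)[OF \<sigma>] by simp
  qed simp
  have "act \<sigma> f (permute_list \<sigma> u) =
      (\<Sum>v\<in>words d E. if v = u then f v * (- 1) ^ inversions M \<sigma> v else 0)"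
    unfolding tensor_act_def fsum_apply fscale_def
    using tens_word'[OF permute_list_words[OF \<sigma>]] inj by (intro sum.cong) auto
  also have "\<dots> = f u * (- 1) ^ inversions M \<sigma> u"
    using u fin_words by simp
  finally show ?thesis unfolding inversions_crossing[OF wordsD(1)[OF u]] by (simp only: ac_simps)
qed

lemma te_parity:
  assumes xs: "homog p xs" and w: "te xs w \<noteq> 0"
  shows "w \<in> words d E" "i < d \<Longrightarrow> w ! i \<in> odd_part M \<longleftrightarrow> p i"
    "odd_count M w = card {i\<in>{..<d}. p i}"
proof -
  show ww: "w \<in> words d E" using w homogD(1)[OF xs] by (auto simp: tens_def split: if_splits)
  have nz: "xs ! i \<noteq> 0" if "i < d" for i
    using w tens_zero[of i xs] homogD(1)[OF xs] that by auto
  show par: "w ! i \<in> odd_part M \<longleftrightarrow> p i" if "i < d" for i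
    using tens_parity[OF superalg basis finite_basis homogeneous homogD(4)[OF xs] w that]
      homog_par_iff[OF xs that nz[OF that]] by simp
  show "odd_count M w = card {i\<in>{..<d}. p i}"
    unfolding odd_count_def using par wordsD(1)[OF ww] by (intro arg_cong[where f = card]) auto
qed

lemma fn_subspace_support: "fn.subspace {f. \<forall>w. f w \<noteq> 0 \<longrightarrow> Q w}"
proof -
  have "x w \<noteq> 0 \<or> y w \<noteq> 0" if "x w + y w \<noteq> 0" for x y :: "'m list \<Rightarrow> 'k" and w
    using that by auto
  moreover have "x w \<noteq> 0" if "c * x w \<noteq> 0" for c and x :: "'m list \<Rightarrow> 'k" and w
    using that by auto
  ultimately show ?thesis
    unfolding fn.subspace_def by (simp add: fscale_def zero_fun_def) blast
qed

text \<open>The Booleans \<open>a\<close> and \<open>b\<close> say whether the factors are even.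
  Equality of Booleans is then the parity rule for products, which covers all four cases at
  once.\<close>

lemma tmul_parity:
  assumes f: "\<forall>w. f w \<noteq> 0 \<longrightarrow> w \<in> words d E \<and> even (odd_count M w) = a"
    and g: "\<forall>w. g w \<noteq> 0 \<longrightarrow> w \<in> words d E \<and> even (odd_count M w) = b"
  shows "\<forall>w. tmul f g w \<noteq> 0 \<longrightarrow> w \<in> words d E \<and> even (odd_count M w) = (a = b)"
proof -
  let ?S = "{f. \<forall>w. f w \<noteq> 0 \<longrightarrow> w \<in> words d E \<and> even (odd_count M w) = (a = b)}"
  have "fscale (f u * g v * mul_sign M u v) (te (map2 (mul M) u v)) \<in> ?S"
    if uv: "u \<in> words d E" "v \<in> words d E" for u v
  proof (cases "f u = 0 \<or> g v = 0")
    case True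
    then show ?thesis by (auto simp: fscale_def)
  next
    case False
    note W = homog_mul[OF homog_word[OF uv(1)] homog_word[OF uv(2)]]
    have "odd_count M u = card {i\<in>{..<d}. par u i}" "odd_count M v = card {i\<in>{..<d}. par v i}"
      using wordsD(1) uv by (auto simp: odd_count_def)
    then have "even (card {i\<in>{..<d}. par u i \<noteq> par v i}) = (a = b)"
      using f g False unfolding even_card_xor[OF finite_lessThan] by auto
    then have "te (map2 (mul M) u v) \<in> ?S" using te_parity(1,3)[OF W] by simp
    then show ?thesis by (rule fn.subspace_scale[OF fn_subspace_support])
  qed
  then have "tmul f g \<in> ?S"
    unfolding tensor_mul_def by (intro fn.subspace_sum[OF fn_subspace_support])
  then show ?thesis by simp
qed

end

section \<open>Invariants divisible by factorials\<close>

lemma letter_fact_restrict: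
  assumes "finite C" "Y \<subseteq> C" "\<And>c. c \<in> C - Y \<Longrightarrow> count (mset w) c \<le> 1"
  shows "letter_fact C w = letter_fact Y w"
  unfolding letter_fact_def
proof (rule prod.mono_neutral_right[OF assms(1,2)], rule ballI)
  fix c assume "c \<in> C - Y"
  then have "count (mset w) c = 0 \<or> count (mset w) c = 1" using assms(3)[of c] by linarith
  then show "fact (count (mset w) c) = (1::nat)" by (auto simp del: count_mset_0_iff count_eq_zero_iff)
qed

lemma letter_fact_Un_dvd:
  assumes "finite A" "finite B"
  shows "letter_fact (A \<union> B) w dvd letter_fact A w * letter_fact B w"
  unfolding letter_fact_def prod.union_inter[OF assms, symmetric] by simp

lemma of_nat_dvd: "a dvd b \<Longrightarrow> of_nat a dvd (of_nat b :: 'k::comm_semiring_1)"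
  by (auto elim!: dvdE)

lemma fscale_of_nat_cancel:
  fixes x y :: "'i \<Rightarrow> 'k::{idom,ring_char_0}"
  assumes "n \<noteq> 0" "fscale (of_nat n) x = fscale (of_nat n) y"
  shows "x = y"
  using assms by (auto simp: fscale_def fun_eq_iff)

lemma odd_count_permute_list:
  "\<sigma> permutes {..<length u} \<Longrightarrow> odd_count M (permute_list \<sigma> u) = odd_count M u"
proof -
  have "odd_count M u = size (filter_mset (\<lambda>x. x \<in> odd_part M) (mset u))" for u
    by (simp add: odd_count_def length_filter_conv_card flip: mset_filter)
  then show "\<sigma> permutes {..<length u} \<Longrightarrow> odd_count M (permute_list \<sigma> u) = odd_count M u" by simp
qed

text \<open>Of the subalgebra only its basis \<open>Ea\<close> is recorded; \<open>closed\<close> is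
  the property that keeps letters of \<open>Ec\<close> out of products of two letters of
  \<open>Ea\<close>.\<close>

locale divided_pair = based_superalgebra M E d
  for M :: "('k::{idom,ring_char_0}, 'm::ab_group_add) superalg" and E :: "'m set" and d :: nat +
  fixes Ea Ec :: "'m set"
  assumes even_E: "E \<inter> even_part M = Ea \<union> Ec"
    and disjoint: "Ea \<inter> Ec = {}"
    and closed: "x \<in> Ea \<Longrightarrow> y \<in> Ea \<Longrightarrow> mul M x y \<in> sc.span Ea"
begin

definition Inv :: "('m list \<Rightarrow> 'k) set" where
  "Inv = {f \<in> carr V. \<forall>\<sigma>. \<sigma> permutes {..<d} \<longrightarrow> act \<sigma> f = f}"

definition Tset :: "('m list \<Rightarrow> 'k) set" where
  "Tset = {f \<in> Inv. \<forall>w\<in>words d E. of_nat (letter_fact Ec w) dvd f w}"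

text \<open>The condition that defines \<open>Tri\<close>, for words of basis letters in place of
  triples.\<close>

definition odd_distinct :: "'m list \<Rightarrow> bool" where
  "odd_distinct w \<longleftrightarrow> (\<forall>i<d. \<forall>j<d. i \<noteq> j \<and> w ! i = w ! j \<longrightarrow> w ! i \<in> even_part M)"

lemma finite_Ea: "finite Ea" and finite_Ec: "finite Ec"
  using even_E finite_basis by (metis finite_Int finite_Un)+

lemma Ea_E: "Ea \<subseteq> E" and Ec_E: "Ec \<subseteq> E"
  using even_E by auto

lemma odd_iff: "e \<in> E \<Longrightarrow> e \<in> odd_part M \<longleftrightarrow> e \<notin> Ea \<union> Ec"
  using even_E homogeneous even_odd_zero[of e] E_nonzero[of e] by blast

lemma even_iff: "e \<in> E \<Longrightarrow> e \<in> even_part M \<longleftrightarrow> e \<in> Ea \<union> Ec"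
  using even_E by blast

lemma Inv_coeff:
  assumes "f \<in> Inv" "u \<in> words d E" "\<sigma> permutes {..<d}"
  shows "f (permute_list \<sigma> u) = crossing d \<sigma> (par u) * f u"
  using act_coeff[OF assms(2,3), of f] assms by (simp add: Inv_def)

lemma InvI:
  assumes f: "f \<in> carr V"
    and c: "\<And>u \<sigma>. u \<in> words d E \<Longrightarrow> \<sigma> permutes {..<d} \<Longrightarrow> f (permute_list \<sigma> u) = crossing d \<sigma> (par u) * f u"
  shows "f \<in> Inv"
proof -
  have "act \<sigma> f v = f v" if \<sigma>: "\<sigma> permutes {..<d}" for \<sigma> v
  proof (cases "v \<in> words d E")
    case True
    define u where "u = permute_list (inv \<sigma>) v"
    have u: "u \<in> words d E" using permute_list_words[OF permutes_inv[OF \<sigma>] True] by (simp add: u_def)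
    have "permute_list \<sigma> u = permute_list (inv \<sigma> \<circ> \<sigma>) v"
      using \<sigma> wordsD(1)[OF True] by (simp add: u_def permute_list_compose)
    then have "permute_list \<sigma> u = v" using permutes_inv_o(2)[OF \<sigma>] by simp
    then show ?thesis using act_coeff[OF u \<sigma>, of f] c[OF u \<sigma>] by simp
  next
    case False
    then have "act \<sigma> f v = 0" "f v = 0" using act_carr[of \<sigma> f] f by (auto simp: V_carr)
    then show ?thesis by simp
  qed
  then show ?thesis using f by (auto simp: Inv_def fun_eq_iff)
qed

text \<open>The transposition of two equal odd letters fixes the word and has sign -1. The
  coefficient therefore equals its negative and vanishes in characteristic 0.\<close>

lemma Inv_odd_distinct:
  assumes f: "f \<in> Inv" "f u \<noteq> 0"
  shows "odd_distinct u"
proof -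
  have u: "u \<in> words d E" using f by (auto simp: Inv_def V_carr)
  have *: "u ! k \<in> even_part M" if kl: "k < l" "l < d" "u ! k = u ! l" for k l
  proof (rule ccontr)
    assume "u ! k \<notin> even_part M"
    then have odd: "u ! k \<in> odd_part M" using wordsD(2)[OF u, of k] kl homogeneous by auto
    have p: "transpose k l permutes {..<d}" using kl by (intro permutes_swap_id) auto
    have "permute_list (transpose k l) u = u"
      using p kl wordsD(1)[OF u] by (auto simp: permute_list_eq_iff transpose_def)
    then have "f u = crossing d (transpose k l) (par u) * f u"
      using Inv_coeff[OF f(1) u p] by simp
    also have "\<dots> = - f u"
      unfolding crossing_transpose[where p = "par u", OF kl(1,2) odd odd[unfolded kl(3)]] by simp
    finally have "f u = - f u" .
    then have "2 * f u = 0" by (metis add.right_inverse mult_2)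
    then show False using f(2) by simp
  qed
  show ?thesis unfolding odd_distinct_def
  proof (intro allI impI, elim conjE)
    fix i j assume "i < d" "j < d" "i \<noteq> j" "u ! i = u ! j"
    then show "u ! i \<in> even_part M" using *[of i j] *[of j i] by (cases "i < j") auto
  qed
qed

lemma Inv_subspace: "fn.subspace Inv"
  using V_subspace unfolding fn.subspace_def Inv_def
  by (auto simp only: mem_Collect_eq tensor_act_zero tensor_act_add tensor_act_scale)

lemma Tset_subspace: "fn.subspace Tset"
  using Inv_subspace unfolding fn.subspace_def Tset_def
  by (auto simp: fscale_def)

text \<open>A pair of words is read as a word of pairs, so that \<open>letter_fact_dvd_sum\<close>
  becomes applicable to the coefficients of a product.\<close>

lemma sum_word_pairs:
  "(\<Sum>u\<in>words d E. \<Sum>v\<in>words d E. F u v) = (\<Sum>z\<in>words d (E \<times> E). F (map fst z) (map snd z))"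
  unfolding sum.cartesian_product
  by (rule sum.reindex_bij_witness[of _ "\<lambda>z. (map fst z, map snd z)" "\<lambda>(u, v). zip u v"])
     (auto simp: words_def zip_map_fst_snd dest: set_zip_leftD set_zip_rightD)

lemma te_nonzero_rep:
  assumes "length xs = d" "te xs w \<noteq> 0" "i < d"
  shows "sc.representation E (xs ! i) (w ! i) \<noteq> 0"
proof -
  have "(\<Prod>i<d. sc.representation E (xs ! i) (w ! i)) \<noteq> 0"
    using assms by (auto simp: tens_def split: if_splits)
  then show ?thesis using assms(3) by (metis finite_lessThan lessThan_iff prod_zero)
qed

lemma te_permute:
  assumes "length xs = d" "length w = d" and \<sigma>: "\<sigma> permutes {..<d}"
  shows "te (permute_list \<sigma> xs) (permute_list \<sigma> w) = te xs w"
proof -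
  have "(\<Prod>i<d. sc.representation E (permute_list \<sigma> xs ! i) (permute_list \<sigma> w ! i)) =
      (\<Prod>i<d. sc.representation E (xs ! \<sigma> i) (w ! \<sigma> i))"
    using assms by (intro prod.cong) (auto simp: permute_list_nth)
  also have "\<dots> = (\<Prod>i<d. sc.representation E (xs ! i) (w ! i))"
    using prod.permute[OF \<sigma>, of "\<lambda>i. sc.representation E (xs ! i) (w ! i)"] by (simp add: o_def)
  finally show ?thesis using assms \<sigma> by (simp add: tens_def words_def)
qed

lemma representation_span_Ea: "x \<in> sc.span Ea \<Longrightarrow> sc.representation E x e \<noteq> 0 \<Longrightarrow> e \<in> Ea"
  using sc.representation_extend[OF independent_E _ Ea_E] sc.representation_ne_zero by metis

lemma count_le_1I:
  assumes "\<And>i j. i < length z \<Longrightarrow> j < length z \<Longrightarrow> z ! i = x \<Longrightarrow> z ! j = x \<Longrightarrow> i = j"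
  shows "count (mset z) x \<le> 1"
  unfolding count_mset_card using assms by (auto simp: card_le_Suc0_iff_eq)

text \<open>
  If \<open>c \<in> Ec\<close> occurs in \<open>mul M x y\<close>, then \<open>x\<close> or \<open>y\<close> lies in \<open>Ec\<close>, or both are odd; odd letters do
  not repeat in words on which an invariant tensor is nonzero.  So the factorials in the order of
  the stabilizer of a pair of words are absorbed by the coefficients of the two factors.
\<close>

lemma tmul_Tset:
  assumes f: "f \<in> Tset" and g: "g \<in> Tset"
  shows "tmul f g \<in> Tset"
proof -
  have fI: "f \<in> Inv" "f \<in> carr V" and gI: "g \<in> Inv" "g \<in> carr V"
    using f g by (auto simp: Tset_def Inv_def)
  have "act \<sigma> (tmul f g) = tmul f g" if "\<sigma> permutes {..<d}" for \<sigma>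
    using act_tmul[OF that fI(2) gI(2)] fI(1) gI(1) that by (simp add: Inv_def)
  then have I: "tmul f g \<in> Inv" by (simp add: Inv_def tmul_carr)
  have "of_nat (letter_fact Ec w) dvd tmul f g w" if w: "w \<in> words d E" for w
  proof -
    define H where "H z = f (map fst z) * g (map snd z) *
        koszul d (par (map fst z)) (par (map snd z)) * te (map2 (mul M) (map fst z) (map snd z)) w" for z
    have lw: "length w = d" by (rule wordsD(1)[OF w])
    have zD: "map fst z \<in> words d E" "map snd z \<in> words d E" "length z = d"
      if "z \<in> words d (E \<times> E)" for z
      using that by (auto simp: words_def)
    have "tmul f g w = (\<Sum>u\<in>words d E. \<Sum>v\<in>words d E. f u * g v * koszul d (par u) (par v) * te (map2 (mul M) u v) w)"
      unfolding tensor_mul_def fsum_apply fscale_def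
      by (intro sum.cong refl) (simp add: mul_sign_koszul wordsD(1))
    also have "\<dots> = (\<Sum>z\<in>words d (E \<times> E). H z)"
      unfolding sum_word_pairs H_def ..
    finally have sum: "tmul f g w = (\<Sum>z\<in>words d (E \<times> E). H z)" .
    show ?thesis
      unfolding sum
    proof (rule letter_fact_dvd_sum[OF finite_Ec _ lw])
      show "finite (E \<times> E)" using finite_basis by simp
    next
      fix \<sigma> z assume \<sigma>: "\<sigma> \<in> letter_perms Ec w" and z: "z \<in> words d (E \<times> E)"
      define u v where "u = map fst z" and "v = map snd z"
      have uv: "u \<in> words d E" "v \<in> words d E" "length u = d" "length v = d" "length z = d"
        using zD[OF z] wordsD(1) by (auto simp: u_def v_def)
      note D = letter_permsD[OF \<sigma>, unfolded lw]
      note p = D(1)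
      have mz: "map fst (permute_list \<sigma> z) = permute_list \<sigma> u" "map snd (permute_list \<sigma> z) = permute_list \<sigma> v"
        using p uv by (simp_all add: u_def v_def permute_list_map)
      note W = homog_mul[OF homog_word[OF uv(1)] homog_word[OF uv(2)]]
      have ko: "koszul d (par (permute_list \<sigma> u)) (par (permute_list \<sigma> v)) = koszul d (\<lambda>i. par u (\<sigma> i)) (\<lambda>i. par v (\<sigma> i))"
        using p uv by (intro koszul_cong) (auto simp: permute_list_nth)
      have m2: "map2 (mul M) (permute_list \<sigma> u) (permute_list \<sigma> v) = permute_list \<sigma> (map2 (mul M) u v)"
        using p uv by (simp add: permute_list_map permute_list_zip[of _ "{..<d}"])
      have tp: "te (permute_list \<sigma> (map2 (mul M) u v)) w = te (map2 (mul M) u v) w"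
        using te_permute[OF homogD(1)[OF W] lw p] D(2) by simp
      have "H (permute_list \<sigma> z) = f u * g v * (koszul d (\<lambda>i. par u (\<sigma> i)) (\<lambda>i. par v (\<sigma> i)) *
          crossing d \<sigma> (par u) * crossing d \<sigma> (par v)) * te (map2 (mul M) u v) w"
        unfolding H_def mz Inv_coeff[OF fI(1) uv(1) p] Inv_coeff[OF gI(1) uv(2) p] ko m2 tp
        by (simp only: ac_simps)
      also have "\<dots> = f u * g v * (koszul d (par u) (par v) * crossing d \<sigma> (\<lambda>i. par u i \<noteq> par v i)) * te (map2 (mul M) u v) w"
        unfolding koszul_permute[OF p, where p = "par u" and q = "par v"] ..
      also have "\<dots> = H z"
      proof (cases "te (map2 (mul M) u v) w = 0")
        case False
        \<comment> \<open>The remaining sign concerns positions at which the product of the letters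
          is odd. There the letter of \<open>w\<close> is odd too, hence not in \<open>Ec\<close>,
          and \<sigma> fixes the position.\<close>
        have "\<sigma> i = i" if "i < d" "par u i \<noteq> par v i" for i
        proof -
          have "w ! i \<in> odd_part M" using te_parity(2)[OF W False that(1)] that(2) by simp
          then have "w ! i \<notin> Ec" using odd_iff wordsD(2)[OF w that(1)] by auto
          then show ?thesis using D(4) that by simp
        qed
        then have "crossing d \<sigma> (\<lambda>i. par u i \<noteq> par v i) = (1::'k)"
          by (rule crossing_eq_1[OF p])
        then show ?thesis by (simp add: H_def u_def v_def)
      qed (simp add: H_def u_def v_def)
      finally show "H (permute_list \<sigma> z) = H z" .
    next
      fix z assume z: "z \<in> words d (E \<times> E)"
      define u v where "u = map fst z" and "v = map snd z"
      have uv: "u \<in> words d E" "v \<in> words d E" "length u = d" "length v = d" "length z = d"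
        using zD[OF z] wordsD(1) by (auto simp: u_def v_def)
      note W = homog_mul[OF homog_word[OF uv(1)] homog_word[OF uv(2)]]
      show "of_nat (letter_fact (Ec \<times> E \<times> E) (zip w z)) dvd H z"
      proof (cases "H z = 0")
        case False
        then have nz: "f u \<noteq> 0" "g v \<noteq> 0" "te (map2 (mul M) u v) w \<noteq> 0"
          by (auto simp: H_def u_def v_def)
        \<comment> \<open>The triples in which the first or the second factor contributes a letter
          of \<open>Ec\<close>. The two sets may overlap, which \<open>letter_fact_Un_dvd\<close>
          allows.\<close>
        define A B where "A = Ec \<times> Ec \<times> E" and "B = Ec \<times> E \<times> Ec"
        have fin: "finite A" "finite B" using finite_Ec finite_basis by (auto simp: A_def B_def)
        have "letter_fact (Ec \<times> E \<times> E) (zip w z) = letter_fact (A \<union> B) (zip w z)"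
        proof (rule letter_fact_restrict)
          show "finite (Ec \<times> E \<times> E)" using finite_Ec finite_basis by auto
          show "A \<union> B \<subseteq> Ec \<times> E \<times> E" using Ec_E by (auto simp: A_def B_def)
          fix y assume "y \<in> Ec \<times> E \<times> E - (A \<union> B)"
          then obtain c e e' where y: "y = (c, e, e')" "c \<in> Ec" "e \<in> E" "e' \<in> E" "e \<notin> Ec" "e' \<notin> Ec"
            by (auto simp: A_def B_def)
          show "count (mset (zip w z)) y \<le> 1"
          proof (rule count_le_1I, rule ccontr)
            fix i j assume ij: "i < length (zip w z)" "j < length (zip w z)"
              "zip w z ! i = y" "zip w z ! j = y" "i \<noteq> j"
            have l: "i < d" "j < d" using ij lw uv by auto
            have wi: "w ! i = c" "u ! i = e" "u ! j = e" "v ! i = e'" "v ! j = e'"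
              using ij l lw uv(5) by (simp_all add: y(1) u_def v_def)
            \<comment> \<open>A repeated letter is even, and an even letter outside
              \<open>Ec\<close> lies in \<open>Ea\<close>.\<close>
            have "e \<in> even_part M" using Inv_odd_distinct[OF fI(1) nz(1)] l ij(5) wi
              unfolding odd_distinct_def by metis
            then have e: "e \<in> Ea" using even_iff y by auto
            have "e' \<in> even_part M" using Inv_odd_distinct[OF gI(1) nz(2)] l ij(5) wi
              unfolding odd_distinct_def by metis
            then have e': "e' \<in> Ea" using even_iff y by auto
            have "sc.representation E (mul M e e') c \<noteq> 0"
              using te_nonzero_rep[OF homogD(1)[OF W] nz(3) l(1)] wi l uv by simp
            then have "c \<in> Ea" using representation_span_Ea[OF closed[OF e e']] by simp
            then show False using y(2) disjoint by auto
          qed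
        qed
        also have "\<dots> dvd letter_fact A (zip w z) * letter_fact B (zip w z)"
          by (rule letter_fact_Un_dvd[OF fin])
        also have "\<dots> dvd letter_fact Ec u * letter_fact Ec v"
        proof (rule mult_dvd_mono)
          have mu: "map (fst \<circ> snd) (zip w z) = u" "map (snd \<circ> snd) (zip w z) = v"
            using lw uv by (simp_all add: u_def v_def flip: map_map)
          have sub: "(fst \<circ> snd) ` A \<subseteq> Ec" "(snd \<circ> snd) ` B \<subseteq> Ec" by (auto simp: A_def B_def)
          show "letter_fact A (zip w z) dvd letter_fact Ec u"
            using letter_fact_map_dvd[OF fin(1) finite_Ec sub(1), of "zip w z"] unfolding mu .
          show "letter_fact B (zip w z) dvd letter_fact Ec v"
            using letter_fact_map_dvd[OF fin(2) finite_Ec sub(2), of "zip w z"] unfolding mu .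
        qed
        finally have "(of_nat (letter_fact (Ec \<times> E \<times> E) (zip w z)) :: 'k) dvd
            of_nat (letter_fact Ec u) * of_nat (letter_fact Ec v)"
          by (metis of_nat_dvd of_nat_mult)
        also have "\<dots> dvd f u * g v"
          using f g uv by (intro mult_dvd_mono) (auto simp: Tset_def)
        also have "\<dots> dvd H z" unfolding H_def u_def v_def by (simp add: mult.assoc)
        finally show ?thesis .
      qed simp
    qed
  qed
  then show ?thesis using I by (simp add: Tset_def)
qed

end

section \<open>Orbit sums\<close>

context divided_pair
begin

text \<open>Summing over the whole group instead of coset representatives overcounts, but it gives a
  linear map on all tensors, which can also be applied to tensors of dual letters.\<close>

definition avg :: "('m list \<Rightarrow> 'k) \<Rightarrow> 'm list \<Rightarrow> 'k" where
  "avg f = (\<Sum>\<sigma>\<in>{\<sigma>. \<sigma> permutes {..<d}}. act \<sigma> f)"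

text \<open>
  If the odd letters of \<open>v\<close> are distinct, \<open>avg (te v)\<close> is the orbit sum of \<open>v\<close> times the order of
  the stabilizer, which is \<open>letter_fact Ea v * letter_fact Ec v\<close>.  Otherwise \<open>avg (te v)\<close> is zero.
\<close>

definition eta_word :: "'m list \<Rightarrow> 'm list \<Rightarrow> 'k" where
  "eta_word v = (\<lambda>u. THE c. of_nat (letter_fact Ea v) * c = avg (te v) u)"

definition T :: "('k, 'm list \<Rightarrow> 'k) superalg" where
  "T = sub_superalg V Tset"

lemma T_sel: "carr T = Tset" "smul T = fscale" "mul T = tmul"
  "even_part T = even_part V \<inter> Tset" "odd_part T = odd_part V \<inter> Tset"
  by (simp_all add: T_def sub_superalg_def V_smul V_mul)

lemma Tset_carr: "f \<in> Tset \<Longrightarrow> f \<in> carr V" and Tset_Inv: "f \<in> Tset \<Longrightarrow> f \<in> Inv"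
  by (simp_all add: Tset_def Inv_def)

lemma permutes_odd_count:
  "u \<in> words d E \<Longrightarrow> \<sigma> permutes {..<d} \<Longrightarrow> odd_count M (permute_list \<sigma> u) = odd_count M u"
  using odd_count_permute_list[of \<sigma> u M] by (simp add: wordsD(1))

text \<open>Permutations preserve the number of odd letters, so restricting a tensor to words of one
  parity keeps invariance and divisibility. This yields the decomposition into even and odd
  part.\<close>

lemma parity_part_Tset:
  assumes f: "f \<in> Tset"
  shows "(\<lambda>w. if even (odd_count M w) = a then f w else 0) \<in> Tset" (is "?f \<in> _")
proof -
  have "?f \<in> carr V" using Tset_carr[OF f] by (auto simp: V_carr)
  moreover have "?f (permute_list \<sigma> u) = crossing d \<sigma> (par u) * ?f u"
    if "u \<in> words d E" "\<sigma> permutes {..<d}" for u \<sigma>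
    using Inv_coeff[OF Tset_Inv[OF f] that] permutes_odd_count[OF that] by simp
  ultimately have "?f \<in> Inv" by (rule InvI)
  then show ?thesis using f by (auto simp: Tset_def)
qed

lemma superalgebra_T: "superalgebra T"
proof -
  have ev: "fn.subspace (even_part V)" "fn.subspace (odd_part V)"
    unfolding V_even V_odd by (rule fn_subspace_support)+
  have part: "f \<in> even_part V \<longleftrightarrow> (\<forall>w. f w \<noteq> 0 \<longrightarrow> w \<in> words d E \<and> even (odd_count M w) = True)"
    "f \<in> odd_part V \<longleftrightarrow> (\<forall>w. f w \<noteq> 0 \<longrightarrow> w \<in> words d E \<and> even (odd_count M w) = False)" for f
    unfolding V_even V_odd by simp_all
  have par: "f \<in> even_part V \<Longrightarrow> g \<in> even_part V \<Longrightarrow> tmul f g \<in> even_part V"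
    "f \<in> even_part V \<Longrightarrow> g \<in> odd_part V \<Longrightarrow> tmul f g \<in> odd_part V"
    "f \<in> odd_part V \<Longrightarrow> g \<in> even_part V \<Longrightarrow> tmul f g \<in> odd_part V"
    "f \<in> odd_part V \<Longrightarrow> g \<in> odd_part V \<Longrightarrow> tmul f g \<in> even_part V" for f g
    unfolding part by (drule (1) tmul_parity, simp)+
  have ds: "direct_sum Tset (even_part V \<inter> Tset) (odd_part V \<inter> Tset)"
    unfolding direct_sum_def
  proof
    show "Tset = {x + y |x y. x \<in> even_part V \<inter> Tset \<and> y \<in> odd_part V \<inter> Tset}"
    proof (intro equalityI subsetI)
      fix f assume f: "f \<in> Tset"
      let ?f = "\<lambda>a w. if even (odd_count M w) = a then f w else 0"
      have "f = ?f True + ?f False" by (auto simp: fun_eq_iff)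
      moreover have "?f True \<in> even_part V \<inter> Tset" "?f False \<in> odd_part V \<inter> Tset"
        using parity_part_Tset[OF f, of True] parity_part_Tset[OF f, of False] Tset_carr[OF f]
        by (auto simp only: part V_carr Int_iff mem_Collect_eq split: if_splits)
      ultimately show "f \<in> {x + y |x y. x \<in> even_part V \<inter> Tset \<and> y \<in> odd_part V \<inter> Tset}" by blast
    qed (use fn.subspace_add[OF Tset_subspace] in blast)
    have "f = 0" if "f \<in> even_part V" "f \<in> odd_part V" for f
      using that unfolding part by (auto simp: fun_eq_iff)
    then show "even_part V \<inter> Tset \<inter> (odd_part V \<inter> Tset) = {0}"
      using fn.subspace_0[OF ev(1)] fn.subspace_0[OF ev(2)] fn.subspace_0[OF Tset_subspace] by blast
  qed
  show ?thesis
    unfolding superalgebra_def T_sel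
    by (intro conjI ballI allI impI module_fscale Tset_subspace fn.subspace_inter ev ds tmul_Tset
        tmul_add tmul_scale tmul_assoc Tset_carr IntI par) auto
qed

section \<open>Averaging over the symmetric group\<close>

lemma act_Inv: "x \<in> Inv \<Longrightarrow> \<sigma> permutes {..<d} \<Longrightarrow> act \<sigma> x = x"
  by (simp add: Inv_def)

lemma finite_perms: "finite {\<sigma>. \<sigma> permutes {..<d}}" by (simp add: finite_permutations)

lemma avg_add: "avg (f + g) = avg f + avg g"
  unfolding avg_def tensor_act_add sum.distrib ..

lemma avg_scale: "avg (fscale c f) = fscale c (avg f)"
  unfolding avg_def tensor_act_scale fn.scale_sum_right ..

lemma avg_zero: "avg 0 = 0"
  unfolding avg_def tensor_act_zero by simp

lemma avg_Inv:
  assumes f: "f \<in> carr V"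
  shows "avg f \<in> Inv"
proof -
  have "act \<rho> (avg f) = avg f" if \<rho>: "\<rho> permutes {..<d}" for \<rho>
  proof -
    have "act \<rho> (avg f) = (\<Sum>\<sigma>\<in>{\<sigma>. \<sigma> permutes {..<d}}. act (\<sigma> \<circ> \<rho>) f)"
      unfolding avg_def tensor_act_sum[OF finite_perms]
      by (intro sum.cong refl act_act[OF f _ \<rho>]) simp
    then show ?thesis
      unfolding avg_def using sum_permutations_compose_right[OF \<rho>, of "\<lambda>\<sigma>. act \<sigma> f"] by simp
  qed
  moreover have "avg f \<in> carr V"
    unfolding avg_def by (intro fn.subspace_sum[OF V_subspace] act_carr)
  ultimately show ?thesis by (simp add: Inv_def)
qed

lemma avg_te_coeff:
  assumes v: "v \<in> words d E"
  shows "avg (te v) u = (\<Sum>\<sigma>\<in>{\<sigma>. \<sigma> permutes {..<d}}. if u = permute_list \<sigma> v then crossing d \<sigma> (par v) else 0)"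
  unfolding avg_def fsum_apply
  by (intro sum.cong refl)
     (simp add: act_tens[OF homog_word[OF v]] fscale_def tens_word'[OF permute_list_words[OF _ v]])

text \<open>The tensor of the permuted word is, up to sign, the image of the original tensor under
  the action, and averaging absorbs the permutation.\<close>

lemma avg_te_permute:
  assumes v: "v \<in> words d E" and \<sigma>: "\<sigma> permutes {..<d}"
  shows "avg (te (permute_list \<sigma> v)) = fscale (crossing d \<sigma> (par v)) (avg (te v))"
proof -
  have "te (permute_list \<sigma> v) = fscale (crossing d \<sigma> (par v)) (act \<sigma> (te v))"
    unfolding act_tens[OF homog_word[OF v] \<sigma>] fn.scale_scale crossing_square by simp
  moreover have "avg (act \<sigma> (te v)) = avg (te v)"
  proof -
    have "avg (act \<sigma> (te v)) = (\<Sum>\<rho>\<in>{\<rho>. \<rho> permutes {..<d}}. act (\<sigma> \<circ> \<rho>) (te v))"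
      unfolding avg_def
      by (intro sum.cong refl act_act[OF te_carr \<sigma>]) (simp_all add: wordsD(1)[OF v])
    then show ?thesis
      unfolding avg_def using setum_permutations_compose_left[OF \<sigma>, of "\<lambda>\<sigma>. act \<sigma> (te v)"] by simp
  qed
  ultimately show ?thesis by (simp only: avg_scale)
qed

lemma even_perm_crossing:
  assumes v: "v \<in> words d E" and \<tau>: "\<tau> \<in> letter_perms (Ea \<union> Ec) v"
  shows "crossing d \<tau> (par v) = (1::'k)"
proof (rule crossing_eq_1)
  note D = letter_permsD[OF \<tau>, unfolded wordsD(1)[OF v]]
  show "\<tau> permutes {..<d}" by (rule D(1))
  show "\<tau> i = i" if "i < d" "par v i" for i
    using D(4)[OF that(1)] that(2) odd_iff[OF wordsD(2)[OF v that(1)]] by simp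
qed

text \<open>
  The permutations that preserve \<open>v\<close> and fix the positions of its odd letters act freely on all
  permutations, and without signs.  This avoids a case distinction on repeated odd letters.
\<close>

lemma avg_te_dvd:
  assumes v: "v \<in> words d E"
  shows "of_nat (letter_fact (Ea \<union> Ec) v) dvd avg (te v) u"
  unfolding avg_te_coeff[OF v] card_letter_perms[OF finite_UnI[OF finite_Ea finite_Ec], symmetric]
\<comment> \<open>The inverse turns composition on the left into a right action, as
  \<open>orbit_sum_dvd\<close> requires.\<close>
proof (rule orbit_sum_dvd[where a = "\<lambda>\<tau> \<sigma>. inv \<tau> \<circ> \<sigma>", OF finite_letter_perms finite_perms
      id_in_letter_perms comp_in_letter_perms inv_in_letter_perms])
  note lv = wordsD(1)[OF v]
  note perm = letter_permsD(1)[of _ "Ea \<union> Ec" v, unfolded lv]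
  show "bij \<tau>" if "\<tau> \<in> letter_perms (Ea \<union> Ec) v" for \<tau>
    using permutes_bij[OF perm[OF that]] .
  show "inv \<tau> \<circ> \<sigma> \<in> {\<sigma>. \<sigma> permutes {..<d}}"
    if "\<tau> \<in> letter_perms (Ea \<union> Ec) v" "\<sigma> \<in> {\<sigma>. \<sigma> permutes {..<d}}" for \<tau> \<sigma>
    using that permutes_inv[OF perm[OF that(1)]] by (simp add: permutes_compose)
  show "inv \<tau> \<circ> (inv \<sigma> \<circ> \<rho>) = inv (\<sigma> \<circ> \<tau>) \<circ> \<rho>"
    if "\<sigma> \<in> letter_perms (Ea \<union> Ec) v" "\<tau> \<in> letter_perms (Ea \<union> Ec) v" for \<sigma> \<tau> \<rho>
    using o_inv_distrib[OF permutes_bij[OF perm[OF that(1)]] permutes_bij[OF perm[OF that(2)]]]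
    by (simp add: comp_assoc)
  fix \<tau>0 \<sigma> assume \<tau>0: "\<tau>0 \<in> letter_perms (Ea \<union> Ec) v" and "\<sigma> \<in> {\<sigma>. \<sigma> permutes {..<d}}"
  then have \<sigma>: "\<sigma> permutes {..<d}" by simp
  define \<tau> where "\<tau> = inv \<tau>0"
  have \<tau>: "\<tau> \<in> letter_perms (Ea \<union> Ec) v" using inv_in_letter_perms[OF \<tau>0] by (simp add: \<tau>_def)
  have p: "permute_list (\<tau> \<circ> \<sigma>) v = permute_list \<sigma> v"
    using \<sigma> lv letter_permsD(2)[OF \<tau>] by (simp add: permute_list_compose)
  have "crossing d (\<tau> \<circ> \<sigma>) (par v) = crossing d \<tau> (par v) * (crossing d \<sigma> (par v) :: 'k)"
  proof -
    have "(- 1) ^ inversions M (\<tau> \<circ> \<sigma>) v =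
        (- 1) ^ inversions M \<tau> v * (- 1 :: 'k) ^ inversions M \<sigma> (permute_list \<tau> v)"
      by (rule inversions_comp[OF lv perm[OF \<tau>] \<sigma>])
    then show ?thesis
      unfolding letter_permsD(2)[OF \<tau>] inversions_crossing[OF lv] .
  qed
  then have "crossing d (\<tau> \<circ> \<sigma>) (par v) = (crossing d \<sigma> (par v) :: 'k)"
    unfolding even_perm_crossing[OF v \<tau>] by simp
  then show "(if u = permute_list (inv \<tau>0 \<circ> \<sigma>) v then crossing d (inv \<tau>0 \<circ> \<sigma>) (par v) else 0) =
      (if u = permute_list \<sigma> v then crossing d \<sigma> (par v) else (0::'k))"
    using p by (simp add: \<tau>_def)
next
  fix \<sigma> :: "nat \<Rightarrow> nat" assume "\<sigma> \<in> {\<sigma>. \<sigma> permutes {..<d}}"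
  then have \<sigma>: "\<sigma> permutes {..<d}" by simp
  \<comment> \<open>Stabilizers are trivial, so the divisibility demanded of each summand is
    divisibility by 1.\<close>
  have "\<tau> = id" if \<tau>: "\<tau> \<in> letter_perms (Ea \<union> Ec) v" and e: "inv \<tau> \<circ> \<sigma> = \<sigma>" for \<tau>
  proof -
    note b = permutes_bij[OF letter_permsD(1)[OF \<tau>]]
    have "inv \<tau> \<circ> (\<sigma> \<circ> inv \<sigma>) = \<sigma> \<circ> inv \<sigma>" using e by (simp flip: comp_assoc)
    then have "inv \<tau> = id" using permutes_inv_o(1)[OF \<sigma>] by simp
    then show ?thesis using inv_inv_eq[OF b] by (metis inv_id)
  qed
  then have "{\<tau> \<in> letter_perms (Ea \<union> Ec) v. inv \<tau> \<circ> \<sigma> = \<sigma>} = {id}"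
    using id_in_letter_perms[of "Ea \<union> Ec" v] by (auto simp: inv_id)
  then show "of_nat (card {\<tau> \<in> letter_perms (Ea \<union> Ec) v. inv \<tau> \<circ> \<sigma> = \<sigma>}) dvd
      (if u = permute_list \<sigma> v then crossing d \<sigma> (par v) else (0::'k))" by simp
qed simp_all

lemma letter_fact_even: "letter_fact (Ea \<union> Ec) v = letter_fact Ea v * letter_fact Ec v"
  unfolding letter_fact_def by (rule prod.union_disjoint[OF finite_Ea finite_Ec disjoint])

text \<open>The divisor provided by \<open>avg_te_dvd\<close> is a product of a part for
  \<open>Ea\<close>, which is divided out, and a part for \<open>Ec\<close>, which is kept and is
  the factorial in \<open>eta\<close>.\<close>

lemma eta_word_coeff:
  assumes v: "v \<in> words d E"
  shows "of_nat (letter_fact Ea v) * eta_word v u = avg (te v) u"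
    and "of_nat (letter_fact Ec v) dvd eta_word v u"
proof -
  obtain k where k: "avg (te v) u = of_nat (letter_fact (Ea \<union> Ec) v) * k"
    using avg_te_dvd[OF v, of u] by (elim dvdE)
  have nz: "of_nat (letter_fact Ea v) \<noteq> (0::'k)" by (simp add: letter_fact_nonzero)
  have k': "of_nat (letter_fact Ea v) * (of_nat (letter_fact Ec v) * k) = avg (te v) u"
    unfolding k letter_fact_even by (simp add: mult.assoc)
  have "eta_word v u = of_nat (letter_fact Ec v) * k"
    unfolding eta_word_def
  proof (rule the_equality)
    show "of_nat (letter_fact Ea v) * (of_nat (letter_fact Ec v) * k) = avg (te v) u" by (rule k')
    fix c assume "of_nat (letter_fact Ea v) * c = avg (te v) u"
    then show "c = of_nat (letter_fact Ec v) * k" using k' nz by (metis mult_left_cancel)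
  qed
  then show "of_nat (letter_fact Ea v) * eta_word v u = avg (te v) u"
    "of_nat (letter_fact Ec v) dvd eta_word v u" using k' by simp_all
qed

lemma eta_word_avg:
  "v \<in> words d E \<Longrightarrow> fscale (of_nat (letter_fact Ea v)) (eta_word v) = avg (te v)"
  by (simp add: fscale_def fun_eq_iff eta_word_coeff(1))

lemma eta_word_unique:
  assumes "v \<in> words d E" "fscale (of_nat (letter_fact Ea v)) x = avg (te v)"
  shows "x = eta_word v"
  using fscale_of_nat_cancel[OF letter_fact_nonzero] eta_word_avg assms by metis

lemma eta_word_support:
  assumes v: "v \<in> words d E" and nz: "eta_word v u \<noteq> 0"
  shows "u \<in> words d E" "mset u = mset v"
proof -
  have "avg (te v) u \<noteq> 0"
    using nz eta_word_coeff(1)[OF v, of u, symmetric] by (simp add: letter_fact_nonzero)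
  then have "\<exists>\<sigma>. \<sigma> permutes {..<d} \<and> u = permute_list \<sigma> v"
    unfolding avg_te_coeff[OF v] by (rule contrapos_np) (auto intro!: sum.neutral)
  then show "u \<in> words d E" "mset u = mset v"
    using permute_list_words[OF _ v] wordsD(1)[OF v] by auto
qed

lemma eta_word_Tset:
  assumes v: "v \<in> words d E"
  shows "eta_word v \<in> Tset"
proof -
  have c: "eta_word v \<in> carr V" using eta_word_support(1)[OF v] by (auto simp: V_carr)
  have "act \<sigma> (eta_word v) = eta_word v" if "\<sigma> permutes {..<d}" for \<sigma>
  proof (rule eta_word_unique[OF v])
    show "fscale (of_nat (letter_fact Ea v)) (act \<sigma> (eta_word v)) = avg (te v)"
      unfolding tensor_act_scale[symmetric] eta_word_avg[OF v]
      by (rule act_Inv[OF avg_Inv[OF te_carr] that]) (rule wordsD(1)[OF v])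
  qed
  then have "eta_word v \<in> Inv" using c by (simp add: Inv_def)
  moreover have "of_nat (letter_fact Ec w) dvd eta_word v w" for w
  proof (cases "eta_word v w = 0")
    case False
    then have "letter_fact Ec w = letter_fact Ec v"
      using eta_word_support(2)[OF v False] by (simp add: letter_fact_def)
    then show ?thesis using eta_word_coeff(2)[OF v, of w] by simp
  qed simp
  ultimately show ?thesis by (simp add: Tset_def)
qed

text \<open>Averaged basis words are multiples of \<open>eta_word\<close>. Hence every tensor, once
  averaged, can be used to test elements of \<open>Tset\<close>.\<close>

lemma avg_Tset:
  assumes "f \<in> carr V"
  shows "avg f \<in> Tset"
  using assms
proof (induction f rule: V_induct)
  case (tens c u)
  then show ?case
    unfolding avg_scale using fn.subspace_scale[OF Tset_subspace fn.subspace_scale[OF Tset_subspace eta_word_Tset]]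
    by (metis eta_word_avg)
qed (simp_all only: avg_zero avg_add fn.subspace_0[OF Tset_subspace] fn.subspace_add[OF Tset_subspace])

text \<open>An odd letter occurs only once, so a permutation that preserves the word cannot move its
  position.\<close>

lemma odd_distinct_stabilizer:
  assumes w: "w \<in> words d E" "odd_distinct w"
  shows "{\<sigma>. \<sigma> permutes {..<d} \<and> permute_list \<sigma> w = w} = letter_perms (Ea \<union> Ec) w"
proof (intro equalityI subsetI)
  fix \<sigma> assume "\<sigma> \<in> {\<sigma>. \<sigma> permutes {..<d} \<and> permute_list \<sigma> w = w}"
  then have \<sigma>: "\<sigma> permutes {..<d}" "permute_list \<sigma> w = w" by auto
  note lw = wordsD(1)[OF w(1)]
  show "\<sigma> \<in> letter_perms (Ea \<union> Ec) w"
  proof (rule letter_permsI)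
    fix i assume i: "i < length w" "w ! i \<notin> Ea \<union> Ec"
    have "\<sigma> i < d" using permutes_in_image[OF \<sigma>(1), of i] i lw by simp
    moreover have "w ! \<sigma> i = w ! i" using \<sigma> i lw permute_list_eq_iff[of \<sigma> w] by simp
    moreover have "w ! i \<notin> even_part M" using even_iff wordsD(2)[OF w(1), of i] i lw by auto
    ultimately show "\<sigma> i = i" using w(2) i lw unfolding odd_distinct_def by metis
  qed (use \<sigma> lw in auto)
qed (use letter_permsD(1,2) wordsD(1)[OF w(1)] in auto)

text \<open>All permutations in the stabilizer have sign +1, so their contributions add up. Every
  element of \<open>Tset\<close> has at \<open>w\<close> a multiple of this value, which is what the
  elimination in \<open>Tset_span\<close> needs.\<close>

lemma eta_word_self:
  assumes w: "w \<in> words d E" "odd_distinct w"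
  shows "eta_word w w = of_nat (letter_fact Ec w)"
proof -
  have "avg (te w) w = (\<Sum>\<sigma>\<in>letter_perms (Ea \<union> Ec) w. crossing d \<sigma> (par w))"
    unfolding avg_te_coeff[OF w(1)] odd_distinct_stabilizer[OF w, symmetric]
    by (rule sum.mono_neutral_cong_right[OF finite_perms]) auto
  also have "\<dots> = of_nat (letter_fact (Ea \<union> Ec) w)"
    using even_perm_crossing[OF w(1)] card_letter_perms[OF finite_UnI[OF finite_Ea finite_Ec], of w]
    by simp
  finally have "of_nat (letter_fact Ea w) * eta_word w w = of_nat (letter_fact Ea w) * (of_nat (letter_fact Ec w) :: 'k)"
    unfolding letter_fact_even eta_word_coeff(1)[OF w(1)] by simp
  then show ?thesis by (simp add: letter_fact_nonzero)
qed

section \<open>Spanning by orbit sums and freeness\<close>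

definition rep_word :: "'m list \<Rightarrow> 'm list" where
  "rep_word w = (SOME v. mset v = mset w)"

lemma mset_rep_word: "mset (rep_word w) = mset w"
  unfolding rep_word_def by (rule someI[of _ w]) simp

text \<open>The choice depends on the multiset alone, and the multiset determines the orbit of a
  word.\<close>

lemma rep_word_cong: "mset v = mset w \<Longrightarrow> rep_word v = rep_word w"
  by (simp add: rep_word_def)

text \<open>One word from every orbit: words in the same orbit have \<open>eta_word\<close> equal up to sign.\<close>

definition rep_words :: "'m list set" where
  "rep_words = {w \<in> words d E. odd_distinct w \<and> rep_word w = w}"

text \<open>Coefficients within an orbit agree up to sign.\<close>

lemma Inv_nonzero_mset:
  assumes f: "f \<in> Inv" "f u \<noteq> 0" and e: "mset w = mset u"
  shows "f w \<noteq> 0"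
proof -
  have u: "u \<in> words d E" using f by (auto simp: Inv_def V_carr)
  obtain \<sigma> where \<sigma>: "\<sigma> permutes {..<d}" "permute_list \<sigma> u = w"
    using mset_eq_permutation[OF e] wordsD(1)[OF u] by metis
  have "f w = crossing d \<sigma> (par u) * f u" using Inv_coeff[OF f(1) u \<sigma>(1)] \<sigma>(2) by simp
  moreover have "crossing d \<sigma> (par u) * crossing d \<sigma> (par u) = (1::'k)" by (rule crossing_square)
  then have "crossing d \<sigma> (par u) \<noteq> (0::'k)" by auto
  ultimately show ?thesis using f(2) by simp
qed

text \<open>Induction on the size of the support. At the representative of an orbit in the support,
  divisibility permits subtracting a multiple of \<open>eta_word\<close> that clears the
  coefficient; the support does not grow, since it is a union of orbits.\<close>

lemma Tset_span: "f \<in> Tset \<Longrightarrow> f \<in> fn.span (eta_word ` rep_words)"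
proof (induction "card {u. f u \<noteq> 0}" arbitrary: f rule: less_induct)
  case less
  note I = Tset_Inv[OF less.prems]
  show ?case
  proof (cases "f = 0")
    case False
    then obtain u where u: "f u \<noteq> 0" by (auto simp: fun_eq_iff)
    define w where "w = rep_word u"
    have mw: "mset w = mset u" by (simp add: w_def mset_rep_word)
    have fw: "f w \<noteq> 0" by (rule Inv_nonzero_mset[OF I u mw])
    have w: "w \<in> words d E" using fw Tset_carr[OF less.prems] by (auto simp: V_carr)
    have dw: "odd_distinct w" by (rule Inv_odd_distinct[OF I fw])
    have "rep_word w = w" using rep_word_cong[OF mw] by (simp add: w_def)
    then have wr: "w \<in> rep_words" using w dw by (simp add: rep_words_def)
    obtain c where c: "f w = of_nat (letter_fact Ec w) * c"
      using less.prems w by (auto simp: Tset_def elim!: dvdE)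
    define g where "g = f - fscale c (eta_word w)"
    have g: "g \<in> Tset" unfolding g_def
      by (intro fn.subspace_diff[OF Tset_subspace] fn.subspace_scale[OF Tset_subspace] less.prems eta_word_Tset w)
    have gw: "g w = 0" using c eta_word_self[OF w dw] by (simp add: g_def fscale_def mult.commute)
    have "{u. g u \<noteq> 0} \<subseteq> {u. f u \<noteq> 0}"
    proof
      fix v assume "v \<in> {u. g u \<noteq> 0}"
      then have "f v \<noteq> 0 \<or> eta_word w v \<noteq> 0" by (auto simp: g_def fscale_def)
      then show "v \<in> {u. f u \<noteq> 0}"
        using Inv_nonzero_mset[OF I fw] eta_word_support(2)[OF w] by auto
    qed
    then have "{u. g u \<noteq> 0} \<subset> {u. f u \<noteq> 0}" using gw fw by blast
    moreover have "finite {u. f u \<noteq> 0}"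
      by (rule finite_subset[OF _ fin_words]) (use Tset_carr[OF less.prems] in \<open>auto simp: V_carr\<close>)
    ultimately have "card {u. g u \<noteq> 0} < card {u. f u \<noteq> 0}" by (rule psubset_card_mono[rotated])
    then have "g \<in> fn.span (eta_word ` rep_words)" by (rule less.hyps[OF _ g])
    moreover have "fscale c (eta_word w) \<in> fn.span (eta_word ` rep_words)"
      using wr by (intro fn.span_scale fn.span_base) auto
    moreover have "f = g + fscale c (eta_word w)" by (simp add: g_def)
    ultimately show ?thesis using fn.span_add by metis
  qed (simp add: fn.span_zero)
qed

text \<open>Different representatives lie in different orbits, so their orbit sums have disjoint
  supports and evaluating a relation at \<open>w\<close> isolates one coefficient.\<close>

lemma free_T: "free_finite_rank (smul T) (carr T)"
proof -
  have fin: "finite (eta_word ` rep_words)"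
    using fin_words by (auto simp: rep_words_def)
  have "fn.independent (eta_word ` rep_words)"
    unfolding fn.dependent_finite[OF fin]
  proof safe
    fix c w assume w: "w \<in> rep_words" "c (eta_word w) \<noteq> 0"
      and s: "(\<Sum>x\<in>eta_word ` rep_words. fscale (c x) x) = 0"
    have W: "w \<in> words d E" "odd_distinct w" "rep_word w = w" using w by (auto simp: rep_words_def)
    have other: "x w = 0" if x: "x \<in> eta_word ` rep_words" "x \<noteq> eta_word w" for x
    proof (rule ccontr)
      assume nz: "x w \<noteq> 0"
      obtain v where v: "x = eta_word v" "v \<in> rep_words" using x(1) by blast
      have vD: "v \<in> words d E" "rep_word v = v" using v(2) by (simp_all add: rep_words_def)
      have "mset w = mset v" using eta_word_support(2)[OF vD(1)] nz v(1) by simp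
      then have "w = v" using rep_word_cong[of w v] W(3) vD(2) by simp
      then show False using v x(2) by simp
    qed
    have "0 = (\<Sum>x\<in>eta_word ` rep_words. fscale (c x) x) w" using s by simp
    also have "\<dots> = (\<Sum>x\<in>eta_word ` rep_words. if x = eta_word w then c (eta_word w) * eta_word w w else 0)"
      unfolding fsum_apply using other by (intro sum.cong) (auto simp: fscale_def)
    also have "\<dots> = c (eta_word w) * eta_word w w" using fin w(1) by simp
    finally show False using w(2) eta_word_self[OF W(1,2)] by (simp add: letter_fact_nonzero)
  qed
  moreover have "fn.span (eta_word ` rep_words) = Tset"
  proof
    show "fn.span (eta_word ` rep_words) \<subseteq> Tset"
      by (rule fn.span_minimal[OF _ Tset_subspace]) (auto simp: rep_words_def eta_word_Tset)
  qed (use Tset_span in blast)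
  ultimately show ?thesis
    unfolding free_finite_rank_def module_basis_def T_sel using fin by blast
qed

lemma Tset_eq_span: "Tset = fn.span (eta_word ` {w \<in> words d E. odd_distinct w})"
proof
  have "eta_word ` rep_words \<subseteq> eta_word ` {w \<in> words d E. odd_distinct w}"
    by (auto simp: rep_words_def)
  then show "Tset \<subseteq> fn.span (eta_word ` {w \<in> words d E. odd_distinct w})"
    using Tset_span fn.span_mono by blast
  show "fn.span (eta_word ` {w \<in> words d E. odd_distinct w}) \<subseteq> Tset"
    by (rule fn.span_minimal[OF _ Tset_subspace]) (auto simp: eta_word_Tset)
qed

text \<open>Connects the average with the sum over cosets in \<open>xi\<close>. The stabilizer fixes
  \<open>te w\<close> without sign, so all terms of a coset coincide, and their number is the order
  of the stabilizer.\<close>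

lemma avg_te_cosets:
  assumes w: "w \<in> words d E" "odd_distinct w"
    and H: "H = {\<sigma>. \<sigma> permutes {..<d} \<and> permute_list \<sigma> w = w}"
    and C: "C = {(\<lambda>\<tau>. \<tau> \<circ> \<sigma>) ` H |\<sigma>. \<sigma> permutes {..<d}}"
  shows "avg (te w) = fscale (of_nat (letter_fact (Ea \<union> Ec) w)) (\<Sum>K\<in>C. act (SOME \<sigma>. \<sigma> \<in> K) (te w))"
proof -
  have HL: "H = letter_perms (Ea \<union> Ec) w" unfolding H by (rule odd_distinct_stabilizer[OF w])
  have Hp: "\<tau> permutes {..<d}" if "\<tau> \<in> H" for \<tau> using that H by simp
  have tw: "te w \<in> carr V" by (rule te_carr[OF wordsD(1)[OF w(1)]])
  have fixH: "act \<tau> (te w) = te w" if "\<tau> \<in> H" for \<tau>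
    unfolding act_tens[OF homog_word[OF w(1)] Hp[OF that]] even_perm_crossing[OF w(1) that[unfolded HL]]
    using that H by simp
  have coset: "act (\<tau> \<circ> \<sigma>) (te w) = act \<sigma> (te w)" if "\<tau> \<in> H" "\<sigma> permutes {..<d}" for \<tau> \<sigma>
    using act_act[OF tw Hp[OF that(1)] that(2)] fixH[OF that(1)] by simp
  have idH: "id \<in> H" unfolding HL by (rule id_in_letter_perms)
  have union: "\<Union>C = {\<sigma>. \<sigma> permutes {..<d}}"
  proof (intro equalityI subsetI)
    fix \<sigma> assume "\<sigma> \<in> {\<sigma>. \<sigma> permutes {..<d}}"
    moreover have "\<sigma> \<in> (\<lambda>\<tau>. \<tau> \<circ> \<sigma>) ` H" using imageI[OF idH, of "\<lambda>\<tau>. \<tau> \<circ> \<sigma>"] by simp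
    ultimately show "\<sigma> \<in> \<Union>C" unfolding C by blast
  qed (auto simp: C intro: permutes_compose Hp)
  have disj: "K = K'" if K: "K \<in> C" "K' \<in> C" "\<rho> \<in> K" "\<rho> \<in> K'" for K K' \<rho>
  proof -
    have sub: "(\<lambda>\<tau>. \<tau> \<circ> \<sigma>) ` H \<subseteq> (\<lambda>\<tau>. \<tau> \<circ> \<sigma>') ` H"
      if e: "\<tau> \<in> H" "\<tau>' \<in> H" "\<tau> \<circ> \<sigma> = \<tau>' \<circ> \<sigma>'" for \<sigma> \<sigma>' \<tau> \<tau>'
    proof
      fix \<alpha> assume "\<alpha> \<in> (\<lambda>\<tau>. \<tau> \<circ> \<sigma>) ` H"
      then obtain \<beta> where \<beta>: "\<beta> \<in> H" "\<alpha> = \<beta> \<circ> \<sigma>" by blast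
      have "\<sigma> = inv \<tau> \<circ> (\<tau> \<circ> \<sigma>)"
        using permutes_inv_o(2)[OF Hp[OF e(1)]] by (simp flip: comp_assoc)
      then have "\<alpha> = (\<beta> \<circ> inv \<tau> \<circ> \<tau>') \<circ> \<sigma>'" unfolding \<beta>(2) e(3) by (simp add: comp_assoc)
      moreover have "\<beta> \<circ> inv \<tau> \<circ> \<tau>' \<in> H"
        using \<beta>(1) e unfolding HL by (intro comp_in_letter_perms inv_in_letter_perms)
      ultimately show "\<alpha> \<in> (\<lambda>\<tau>. \<tau> \<circ> \<sigma>') ` H" by blast
    qed
    obtain \<sigma> where \<sigma>: "K = (\<lambda>\<tau>. \<tau> \<circ> \<sigma>) ` H" using K(1) unfolding C by blast
    obtain \<sigma>' where \<sigma>': "K' = (\<lambda>\<tau>. \<tau> \<circ> \<sigma>') ` H" using K(2) unfolding C by blast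
    obtain \<tau> where \<tau>: "\<tau> \<in> H" "\<rho> = \<tau> \<circ> \<sigma>" using K(3) \<sigma> by blast
    obtain \<tau>' where \<tau>': "\<tau>' \<in> H" "\<rho> = \<tau>' \<circ> \<sigma>'" using K(4) \<sigma>' by blast
    have "\<tau> \<circ> \<sigma> = \<tau>' \<circ> \<sigma>'" using \<tau>(2) \<tau>'(2) by simp
    then show ?thesis unfolding \<sigma> \<sigma>'
      using sub[OF \<tau>(1) \<tau>'(1)] sub[OF \<tau>'(1) \<tau>(1)] by (metis equalityI)
  qed
  have finH: "finite H" unfolding HL by (rule finite_letter_perms)
  have inner: "(\<Sum>\<sigma>\<in>K. act \<sigma> (te w)) =
      fscale (of_nat (letter_fact (Ea \<union> Ec) w)) (act (SOME \<sigma>. \<sigma> \<in> K) (te w))" if K: "K \<in> C" for K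
  proof -
    obtain \<sigma> where \<sigma>: "\<sigma> permutes {..<d}" "K = (\<lambda>\<tau>. \<tau> \<circ> \<sigma>) ` H" using K C by blast
    have cst: "act \<rho> (te w) = act \<sigma> (te w)" if "\<rho> \<in> K" for \<rho>
      using that \<sigma> coset by auto
    have "\<sigma> \<in> K" using imageI[OF idH, of "\<lambda>\<tau>. \<tau> \<circ> \<sigma>"] \<sigma>(2) by simp
    then have "(SOME \<rho>. \<rho> \<in> K) \<in> K" by (rule someI[where P = "\<lambda>\<rho>. \<rho> \<in> K"])
    then have s: "act (SOME \<rho>. \<rho> \<in> K) (te w) = act \<sigma> (te w)" by (rule cst)
    have "inj_on (\<lambda>\<tau>. \<tau> \<circ> \<sigma>) H"
    proof (rule inj_onI)
      fix \<tau> \<tau>' assume "\<tau> \<circ> \<sigma> = \<tau>' \<circ> \<sigma>"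
      then have "\<tau> \<circ> (\<sigma> \<circ> inv \<sigma>) = \<tau>' \<circ> (\<sigma> \<circ> inv \<sigma>)" by (simp flip: comp_assoc)
      then show "\<tau> = \<tau>'" using permutes_inv_o(1)[OF \<sigma>(1)] by simp
    qed
    then have "card K = card H" unfolding \<sigma>(2) by (rule card_image)
    then have "card K = letter_fact (Ea \<union> Ec) w"
      unfolding HL using card_letter_perms[OF finite_UnI[OF finite_Ea finite_Ec]] by simp
    moreover have "(\<Sum>\<rho>\<in>K. act \<rho> (te w)) u = of_nat (card K) * act \<sigma> (te w) u" for u
      unfolding fsum_apply using cst by simp
    ultimately show ?thesis unfolding s by (simp add: fun_eq_iff fscale_def)
  qed
  have "avg (te w) = (\<Sum>\<sigma>\<in>\<Union>C. act \<sigma> (te w))" unfolding avg_def union ..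
  also have "\<dots> = (\<Sum>K\<in>C. \<Sum>\<sigma>\<in>K. act \<sigma> (te w))"
  proof -
    have "\<forall>K\<in>C. finite K" using finH by (auto simp: C)
    moreover have "\<forall>K\<in>C. \<forall>K'\<in>C. K \<noteq> K' \<longrightarrow> K \<inter> K' = {}" using disj by blast
    ultimately show ?thesis by (simp add: sum.Union_disjoint)
  qed
  also have "\<dots> = (\<Sum>K\<in>C. fscale (of_nat (letter_fact (Ea \<union> Ec) w)) (act (SOME \<sigma>. \<sigma> \<in> K) (te w)))"
    using inner by (rule sum.cong[OF refl])
  finally show ?thesis unfolding fn.scale_sum_right .
qed

end

section \<open>The symmetrizing form\<close>

text \<open>The trace form and its dual basis in abstract form. The perfect pairing of \<aa> with
  its complement is represented by \<open>star_Ec\<close>.\<close>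

locale symmetric_pair = divided_pair M E d Ea Ec
  for M :: "('k::{idom,ring_char_0}, 'm::ab_group_add) superalg" and E d Ea Ec +
  fixes \<theta> :: "'m \<Rightarrow> 'k" and star :: "'m \<Rightarrow> 'm"
  assumes \<theta>_linear: "linear_form (smul M) (carr M) \<theta>"
    and \<theta>_odd: "x \<in> odd_part M \<Longrightarrow> \<theta> x = 0"
    and \<theta>_commute: "x \<in> carr M \<Longrightarrow> y \<in> carr M \<Longrightarrow> \<theta> (mul M x y) = \<theta> (mul M y x)"
    and \<theta>_Ea: "e \<in> Ea \<Longrightarrow> \<theta> e = 0"
    and star_dual: "e \<in> E \<Longrightarrow> e' \<in> E \<Longrightarrow> \<theta> (mul M (star e) e') = (if e = e' then 1 else 0)"
    and star_parity: "e \<in> E \<Longrightarrow> star e \<in> (if e \<in> odd_part M then odd_part M else even_part M)"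
    and star_Ec: "e \<in> Ec \<Longrightarrow> star e \<in> sc.span Ea"
begin

definition \<Theta> :: "('m list \<Rightarrow> 'k) \<Rightarrow> 'k" where
  "\<Theta> f = (\<Sum>w\<in>words d E. f w * (\<Prod>i<d. \<theta> (w ! i)))"

text \<open>Meaningful on \<open>Tset\<close>, where the quotient exists by
  \<open>tT_\<Theta>\<close>; elsewhere the value of \<open>\<Theta>\<close> may fail to be a
  multiple of d!.\<close>

definition tT :: "('m list \<Rightarrow> 'k) \<Rightarrow> 'k" where
  "tT f = (THE c. of_nat (fact d) * c = \<Theta> f)"

lemma \<Theta>_add: "\<Theta> (f + g) = \<Theta> f + \<Theta> g"
  by (simp add: \<Theta>_def sum.distrib algebra_simps)

lemma \<Theta>_scale: "\<Theta> (fscale c f) = c * \<Theta> f"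
  by (simp add: \<Theta>_def fscale_def sum_distrib_left mult.assoc)

lemma \<Theta>_zero: "\<Theta> 0 = 0"
  by (simp add: \<Theta>_def)

lemma \<Theta>_sum: "\<Theta> (\<Sum>i\<in>I. f i) = (\<Sum>i\<in>I. \<Theta> (f i))"
proof (induction I rule: infinite_finite_induct)
  case (insert i I)
  then show ?case unfolding sum.insert[OF insert.hyps] \<Theta>_add by simp
qed (simp_all only: sum.infinite sum.empty \<Theta>_zero simp_thms)

lemma tmul_sum: "tmul f (\<Sum>i\<in>I. g i) = (\<Sum>i\<in>I. tmul f (g i))" "tmul (\<Sum>i\<in>I. g i) f = (\<Sum>i\<in>I. tmul (g i) f)"
proof -
  have "tmul f (\<Sum>i\<in>I. g i) = (\<Sum>i\<in>I. tmul f (g i)) \<and> tmul (\<Sum>i\<in>I. g i) f = (\<Sum>i\<in>I. tmul (g i) f)"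
  proof (induction I rule: infinite_finite_induct)
    case (insert i I)
    then show ?case unfolding sum.insert[OF insert.hyps] tmul_add by simp
  qed (simp_all only: sum.infinite sum.empty tmul_zero simp_thms)
  then show "tmul f (\<Sum>i\<in>I. g i) = (\<Sum>i\<in>I. tmul f (g i))" "tmul (\<Sum>i\<in>I. g i) f = (\<Sum>i\<in>I. tmul (g i) f)"
    by auto
qed

lemma \<Theta>_te:
  assumes xs: "xs \<in> words d (carr M)"
  shows "\<Theta> (te xs) = (\<Prod>i<d. \<theta> (xs ! i))"
proof -
  have m: "module ((*) :: 'k \<Rightarrow> 'k \<Rightarrow> 'k)" by unfold_locales (auto simp: algebra_simps)
  have split: "(\<Prod>j<d. \<theta> (us[i := z] ! j)) = \<theta> z * (\<Prod>j\<in>{..<d} - {i}. \<theta> (us ! j))"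
    if "us \<in> words d (carr M)" "i < d" for us i z
  proof -
    have "(\<Prod>j<d. \<theta> (us[i := z] ! j)) = \<theta> (us[i := z] ! i) * (\<Prod>j\<in>{..<d} - {i}. \<theta> (us[i := z] ! j))"
      using that by (subst prod.remove[of _ i]) auto
    also have "(\<Prod>j\<in>{..<d} - {i}. \<theta> (us[i := z] ! j)) = (\<Prod>j\<in>{..<d} - {i}. \<theta> (us ! j))"
      by (rule prod.cong) auto
    finally show ?thesis using that wordsD(1)[OF that(1)] by simp
  qed
  have "multilinear_on (smul M) (carr M) d (*) (\<lambda>us. \<Prod>i<d. \<theta> (us ! i))"
    by (rule multilinear_onI) (use \<theta>_linear in \<open>simp_all add: split linear_form_def distrib_right mult.assoc\<close>)
  from tens_expand_multilinear[OF Mul(1) basis finite_basis m this xs]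
  show ?thesis by (simp add: \<Theta>_def)
qed

text \<open>The product of the values does not depend on the order of the letters. A sign can occur
  only in the presence of an odd letter, and then the product is zero.\<close>

lemma \<Theta>_act:
  assumes f: "f \<in> carr V" and \<sigma>: "\<sigma> permutes {..<d}"
  shows "\<Theta> (act \<sigma> f) = \<Theta> f"
  using f
proof (induction f rule: V_induct)
  case (tens c u)
  note W = homog_word[OF tens]
  have "(\<Prod>i<d. \<theta> (permute_list \<sigma> u ! i)) = (\<Prod>i<d. \<theta> (u ! \<sigma> i))"
    using \<sigma> wordsD(1)[OF tens] by (intro prod.cong) (auto simp: permute_list_nth)
  also have "\<dots> = (\<Prod>i<d. \<theta> (u ! i))"
    using prod.permute[OF \<sigma>, of "\<lambda>i. \<theta> (u ! i)"] by (simp add: o_def)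
  finally have 1: "\<Theta> (te (permute_list \<sigma> u)) = \<Theta> (te u)"
    unfolding \<Theta>_te[OF word_carr[OF tens]] \<Theta>_te[OF permute_list_words[OF \<sigma> word_carr[OF tens]]] .
  have "crossing d \<sigma> (par u) * \<Theta> (te u) = \<Theta> (te u)"
  proof (cases "\<exists>i<d. par u i")
    case True
    then have "\<Theta> (te u) = 0" using \<theta>_odd unfolding \<Theta>_te[OF word_carr[OF tens]] by auto
    then show ?thesis by simp
  next
    case False
    then have "crossing d \<sigma> (par u) = (1::'k)" by (intro crossing_eq_1[OF \<sigma>]) auto
    then show ?thesis by simp
  qed
  then show ?case
    unfolding tensor_act_scale act_tens[OF W \<sigma>] \<Theta>_scale 1 by simp
qed (simp_all only: tensor_act_zero tensor_act_add \<Theta>_add)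

lemma \<Theta>_tmul_te:
  assumes "homog p xs" "homog q ys"
  shows "\<Theta> (tmul (te xs) (te ys)) = koszul d p q * (\<Prod>i<d. \<theta> (mul M (xs ! i) (ys ! i)))"
proof -
  note W = homog_mul[OF assms]
  have "\<Theta> (te (map2 (mul M) xs ys)) = (\<Prod>i<d. \<theta> (mul M (xs ! i) (ys ! i)))"
    unfolding \<Theta>_te[OF homogD(5)[OF W]]
    using homogD(1)[OF assms(1)] homogD(1)[OF assms(2)] by (intro prod.cong) auto
  then show ?thesis unfolding tmul_tens[OF assms] \<Theta>_scale by simp
qed

text \<open>If the parity patterns agree, the two Koszul signs coincide. If they differ at some
  position, the product there is odd and both sides vanish. So symmetry holds without super
  signs.\<close>

lemma \<Theta>_commute_te:
  assumes "homog p xs" "homog q ys"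
  shows "\<Theta> (tmul (te xs) (te ys)) = \<Theta> (tmul (te ys) (te xs))"
proof -
  have eq: "(\<Prod>i<d. \<theta> (mul M (xs ! i) (ys ! i))) = (\<Prod>i<d. \<theta> (mul M (ys ! i) (xs ! i)))"
    using homogD(3)[OF assms(1)] homogD(3)[OF assms(2)] by (intro prod.cong refl \<theta>_commute) auto
  show ?thesis
  proof (cases "\<forall>i<d. p i = q i")
    case True
    then have "koszul d p q = (koszul d q p :: 'k)" by (intro koszul_cong) auto
    then show ?thesis unfolding \<Theta>_tmul_te[OF assms] \<Theta>_tmul_te[OF assms(2,1)] eq by simp
  next
    case False
    then obtain i where i: "i < d" "p i \<noteq> q i" by blast
    have "map2 (mul M) xs ys ! i \<in> odd_part M" using homogD(2)[OF homog_mul[OF assms] i(1)] i(2) by simp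
    then have "\<theta> (mul M (xs ! i) (ys ! i)) = 0"
      using \<theta>_odd i homogD(1)[OF assms(1)] homogD(1)[OF assms(2)] by simp
    then have "(\<Prod>i<d. \<theta> (mul M (xs ! i) (ys ! i))) = 0"
      using i(1) by (intro prod_zero) auto
    then show ?thesis unfolding \<Theta>_tmul_te[OF assms] \<Theta>_tmul_te[OF assms(2,1)] eq[symmetric] by simp
  qed
qed

lemma \<Theta>_commute:
  assumes "f \<in> carr V" "g \<in> carr V"
  shows "\<Theta> (tmul f g) = \<Theta> (tmul g f)"
  using assms(1)
proof (induction f rule: V_induct)
  case (tens c u)
  have "\<Theta> (tmul (te u) g) = \<Theta> (tmul g (te u))"
    using assms(2)
  proof (induction g rule: V_induct)
    case (tens c v)
    show ?case
      unfolding tmul_scale \<Theta>_scale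
      using \<Theta>_commute_te[OF homog_word[OF \<open>u \<in> words d E\<close>] homog_word[OF \<open>v \<in> words d E\<close>]] by simp
  qed (simp_all only: tmul_zero tmul_add \<Theta>_add)
  then show ?case by (simp only: tmul_scale \<Theta>_scale)
qed (simp_all only: tmul_zero tmul_add \<Theta>_add)

lemma card_perms: "card {\<sigma>. \<sigma> permutes {..<d}} = fact d"
  by (simp add: card_permutations)

text \<open>For invariant \<open>x\<close>, multiplying by a permuted tensor amounts to permuting
  the product, and \<open>\<Theta>\<close> is invariant under permutations.\<close>

lemma \<Theta>_avg:
  assumes x: "x \<in> Inv" and z: "z \<in> carr V"
  shows "\<Theta> (tmul x (avg z)) = of_nat (fact d) * \<Theta> (tmul x z)"
proof -
  have "\<Theta> (tmul x (act \<sigma> z)) = \<Theta> (tmul x z)" if \<sigma>: "\<sigma> permutes {..<d}" for \<sigma>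
  proof -
    have xV: "x \<in> carr V" using x by (simp add: Inv_def)
    have "tmul x (act \<sigma> z) = act \<sigma> (tmul x z)"
      unfolding act_tmul[OF \<sigma> xV z] act_Inv[OF x \<sigma>] ..
    then show ?thesis using \<Theta>_act[OF tmul_carr \<sigma>] by simp
  qed
  then show ?thesis unfolding avg_def tmul_sum \<Theta>_sum by (simp add: card_perms)
qed

text \<open>The average of \<open>te v\<close> has value d! times the product. If \<open>v\<close>
  has a letter in \<open>Ea\<close>, both sides are zero; otherwise the factorial that separates
  \<open>avg (te v)\<close> from \<open>eta_word v\<close> is 1.\<close>

lemma \<Theta>_eta_word:
  assumes v: "v \<in> words d E"
  shows "\<Theta> (eta_word v) = of_nat (fact d) * (\<Prod>i<d. \<theta> (v ! i))"
proof -
  have tv: "te v \<in> carr V" using wordsD(1)[OF v] by (rule te_carr)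
  have "of_nat (letter_fact Ea v) * \<Theta> (eta_word v) = \<Theta> (avg (te v))"
    unfolding eta_word_avg[OF v, symmetric] \<Theta>_scale ..
  also have "\<dots> = of_nat (fact d) * \<Theta> (te v)"
    unfolding avg_def \<Theta>_sum using \<Theta>_act[OF tv] by (simp add: card_perms)
  finally have e: "of_nat (letter_fact Ea v) * \<Theta> (eta_word v) = of_nat (fact d) * (\<Prod>i<d. \<theta> (v ! i))"
    unfolding \<Theta>_te[OF word_carr[OF v]] .
  show ?thesis
  proof (cases "\<exists>i<d. v ! i \<in> Ea")
    case True
    then have 0: "(\<Prod>i<d. \<theta> (v ! i)) = 0" using \<theta>_Ea by (auto intro!: prod_zero)
    show ?thesis using e unfolding 0 by (simp add: letter_fact_nonzero)
  next
    case False
    have "c \<notin> set v" if "c \<in> Ea" for c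
      using False that wordsD(1)[OF v] by (auto simp: in_set_conv_nth)
    then have "letter_fact Ea v = 1"
      unfolding letter_fact_def by (intro prod.neutral) (simp add: count_eq_zero_iff[THEN iffD2])
    then show ?thesis using e by simp
  qed
qed

lemma tT_\<Theta>:
  assumes "f \<in> Tset"
  shows "of_nat (fact d) * tT f = \<Theta> f"
proof -
  \<comment> \<open>Tensors whose value is divisible by d! form a submodule, so the generators
    suffice.\<close>
  have "fn.subspace {f. of_nat (fact d) dvd \<Theta> f}"
    unfolding fn.subspace_def by (auto simp: \<Theta>_zero \<Theta>_add \<Theta>_scale)
  then have "Tset \<subseteq> {f. of_nat (fact d) dvd \<Theta> f}"
    unfolding Tset_eq_span by (intro fn.span_minimal) (auto simp: \<Theta>_eta_word)
  then have "of_nat (fact d) dvd \<Theta> f" using assms by blast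
  then obtain k where k: "of_nat (fact d) * k = \<Theta> f" by (metis dvdE)
  have "tT f = k"
    unfolding tT_def
  proof (rule the_equality)
    show "of_nat (fact d) * k = \<Theta> f" by (rule k)
    fix c assume "of_nat (fact d) * c = \<Theta> f"
    then have "of_nat (fact d) * c = of_nat (fact d) * k" using k by simp
    then show "c = k" by (simp add: of_nat_fact)
  qed
  then show ?thesis using k by simp
qed

lemma fact_cancel: "of_nat (fact d) * a = of_nat (fact d) * (b::'k) \<Longrightarrow> a = b"
  by (simp add: of_nat_fact)

lemma tT_linear: "linear_form fscale Tset tT"
  unfolding linear_form_def
proof (intro conjI ballI allI)
  fix x y assume xy: "x \<in> Tset" "y \<in> Tset"
  show "tT (x + y) = tT x + tT y"
    by (rule fact_cancel)
      (simp only: distrib_left tT_\<Theta> xy fn.subspace_add[OF Tset_subspace] \<Theta>_add)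
next
  fix c x assume x: "x \<in> Tset"
  show "tT (fscale c x) = c * tT x"
    by (rule fact_cancel)
      (simp only: tT_\<Theta> x fn.subspace_scale[OF Tset_subspace] \<Theta>_scale mult.left_commute[of _ c])
qed

lemma tT_eta_word:
  assumes "v \<in> words d E"
  shows "tT (eta_word v) = (\<Prod>i<d. \<theta> (v ! i))"
  by (rule fact_cancel) (simp only: tT_\<Theta>[OF eta_word_Tset] \<Theta>_eta_word assms)

lemma homog_star: "v \<in> words d E \<Longrightarrow> homog (par v) (map star v)"
  using star_parity wordsD(2)[of v E] by (auto simp: homog_def wordsD(1))

text \<open>Since \<open>star\<close> preserves parity, both factors have the parity pattern of
  \<open>v\<close>; this leaves a sign, which \<open>dual_coeff\<close> corrects.\<close>

lemma \<Theta>_star: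
  assumes v: "v \<in> words d E" and u: "u \<in> words d E"
  shows "\<Theta> (tmul (te (map star v)) (te u)) = (if v = u then koszul d (par v) (par v) else 0)"
proof -
  have "(\<Prod>i<d. \<theta> (mul M (map star v ! i) (u ! i))) = (\<Prod>i<d. if v ! i = u ! i then 1 else 0)"
    using wordsD[OF v] wordsD[OF u] star_dual by (intro prod.cong) auto
  also have "\<dots> = (if v = u then 1 else 0)"
  proof (cases "v = u")
    case False
    then obtain i where "i < d" "v ! i \<noteq> u ! i"
      using wordsD(1)[OF u] wordsD(1)[OF v] by (metis nth_equalityI)
    then have "(\<Prod>i<d. if v ! i = u ! i then 1 else (0::'k)) = 0" by (intro prod_zero) auto
    then show ?thesis using False by simp
  qed simp
  finally show ?thesis
    unfolding \<Theta>_tmul_te[OF homog_star[OF v] homog_word[OF u]] by auto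
qed

text \<open>Pairing with the tensor of the dual letters of \<open>v\<close> reads off the
  coefficient at \<open>v\<close> up to sign. This tensor need not lie in \<open>Tset\<close>, but
  its average does, and by \<open>\<Theta>_avg\<close> averaging only introduces the factor
  d!.\<close>

lemma tT_nondegenerate:
  assumes x: "x \<in> Tset" and z: "\<And>y. y \<in> Tset \<Longrightarrow> tT (tmul x y) = 0"
  shows "x = 0"
proof -
  note xV = Tset_carr[OF x]
  have "x v = 0" if v: "v \<in> words d E" for v
  proof -
    let ?s = "te (map star v)"
    have sV: "?s \<in> carr V" using wordsD(1)[OF v] by (intro te_carr) simp
    have "of_nat (fact d) * \<Theta> (tmul x ?s) = \<Theta> (tmul x (avg ?s))"
      by (rule \<Theta>_avg[OF Tset_Inv[OF x] sV, symmetric])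
    also have "\<dots> = 0"
      unfolding tT_\<Theta>[OF tmul_Tset[OF x avg_Tset[OF sV]], symmetric] z[OF avg_Tset[OF sV]] by simp
    finally have "\<Theta> (tmul ?s x) = 0" unfolding \<Theta>_commute[OF xV sV] by (simp add: of_nat_fact)
    moreover have "\<Theta> (tmul ?s x) = (\<Sum>u\<in>words d E. x u * \<Theta> (tmul ?s (te u)))"
      by (subst V_expand[OF xV]) (simp only: tmul_sum \<Theta>_sum tmul_scale \<Theta>_scale)
    moreover have "\<dots> = (\<Sum>u\<in>words d E. if u = v then x v * koszul d (par v) (par v) else 0)"
      by (intro sum.cong) (auto simp: \<Theta>_star[OF v])
    moreover have "\<dots> = x v * koszul d (par v) (par v)"
      using v fin_words by simp
    ultimately have "x v * (koszul d (par v) (par v) * koszul d (par v) (par v)) = 0"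
      by (simp flip: mult.assoc)
    then show ?thesis unfolding koszul_square by simp
  qed
  then show ?thesis using xV by (auto simp: V_carr fun_eq_iff)
qed

lemma koszul_self_permute:
  assumes "\<sigma> permutes {..<d}"
  shows "koszul d (\<lambda>i. p (\<sigma> i)) (\<lambda>i. p (\<sigma> i)) = (koszul d p p :: 'k)"
proof -
  have "crossing d \<sigma> (\<lambda>i. p i \<noteq> p i) = (1::'k)" by (rule crossing_eq_1[OF assms]) simp
  moreover have "koszul d (\<lambda>i. p (\<sigma> i)) (\<lambda>i. p (\<sigma> i)) * crossing d \<sigma> p * crossing d \<sigma> p =
      koszul d p p * (crossing d \<sigma> (\<lambda>i. p i \<noteq> p i) :: 'k)"
    by (rule koszul_permute[OF assms])
  moreover have "crossing d \<sigma> p * crossing d \<sigma> p = (1::'k)" by (rule crossing_square)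
  ultimately show ?thesis by (simp add: mult.assoc)
qed

lemma eta_word_permute:
  assumes v: "v \<in> words d E" and \<sigma>: "\<sigma> permutes {..<d}"
  shows "eta_word (permute_list \<sigma> v) = fscale (crossing d \<sigma> (par v)) (eta_word v)"
proof (rule eta_word_unique[OF permute_list_words[OF \<sigma> v], symmetric])
  have "letter_fact Ea (permute_list \<sigma> v) = letter_fact Ea v"
    using \<sigma> wordsD(1)[OF v] by (intro letter_fact_permute_list) simp
  then show "fscale (of_nat (letter_fact Ea (permute_list \<sigma> v))) (fscale (crossing d \<sigma> (par v)) (eta_word v)) =
      avg (te (permute_list \<sigma> v))"
    unfolding avg_te_permute[OF v \<sigma>] eta_word_avg[OF v, symmetric] fn.scale_scale
    by (simp only: mult.commute)
qed

section \<open>Representing a linear form by an element of the span\<close>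

context
  fixes \<phi> :: "('m list \<Rightarrow> 'k) \<Rightarrow> 'k"
  assumes \<phi>: "linear_form fscale Tset \<phi>"
begin

text \<open>The Koszul sign cancels the one in \<open>\<Theta>_star\<close>, and the factorial
  matches the relation between \<open>avg (te v)\<close> and \<open>eta_word v\<close>.\<close>

definition dual_coeff :: "'m list \<Rightarrow> 'k" where
  "dual_coeff v = koszul d (par v) (par v) * \<phi> (eta_word v) * of_nat (letter_fact Ea v)"

definition dual_elt :: "'m list \<Rightarrow> 'k" where
  "dual_elt = (\<Sum>v\<in>words d E. fscale (dual_coeff v) (te (map star v)))"

lemma dual_coeff_permute:
  assumes v: "v \<in> words d E" and \<sigma>: "\<sigma> permutes {..<d}"
  shows "dual_coeff (permute_list \<sigma> v) = crossing d \<sigma> (par v) * dual_coeff v"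
proof -
  have "koszul d (par (permute_list \<sigma> v)) (par (permute_list \<sigma> v)) = koszul d (\<lambda>i. par v (\<sigma> i)) (\<lambda>i. par v (\<sigma> i))"
    using \<sigma> wordsD(1)[OF v] by (intro koszul_cong) (auto simp: permute_list_nth)
  also have "\<dots> = (koszul d (par v) (par v) :: 'k)"
    by (rule koszul_self_permute[OF \<sigma>])
  finally have k: "koszul d (par (permute_list \<sigma> v)) (par (permute_list \<sigma> v)) = (koszul d (par v) (par v) :: 'k)" .
  have "\<phi> (eta_word (permute_list \<sigma> v)) = crossing d \<sigma> (par v) * \<phi> (eta_word v)"
    unfolding eta_word_permute[OF assms] using \<phi> eta_word_Tset[OF v] by (simp add: linear_form_def)
  moreover have "letter_fact Ea (permute_list \<sigma> v) = letter_fact Ea v"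
    using \<sigma> wordsD(1)[OF v] by (intro letter_fact_permute_list) simp
  ultimately show ?thesis unfolding dual_coeff_def k by simp
qed

text \<open>A permutation changes the coefficient and the tensor by the same sign, so it only
  rearranges the summands.\<close>

lemma dual_elt_Inv: "dual_elt \<in> Inv"
proof -
  have "act \<sigma> dual_elt = dual_elt" if \<sigma>: "\<sigma> permutes {..<d}" for \<sigma>
  proof -
    have "act \<sigma> dual_elt = (\<Sum>v\<in>words d E. fscale (dual_coeff (permute_list \<sigma> v)) (te (map star (permute_list \<sigma> v))))"
      unfolding dual_elt_def tensor_act_sum[OF fin_words]
    proof (rule sum.cong[OF refl])
      fix v assume v: "v \<in> words d E"
      have "permute_list \<sigma> (map star v) = map star (permute_list \<sigma> v)"
        using \<sigma> wordsD(1)[OF v] by (simp add: permute_list_map)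
      then show "act \<sigma> (fscale (dual_coeff v) (te (map star v))) =
          fscale (dual_coeff (permute_list \<sigma> v)) (te (map star (permute_list \<sigma> v)))"
        unfolding tensor_act_scale act_tens[OF homog_star[OF v] \<sigma>] dual_coeff_permute[OF v \<sigma>] fn.scale_scale
        by (simp only: mult.commute)
    qed
    also have "\<dots> = dual_elt"
      unfolding dual_elt_def
    proof (rule sum.reindex_bij_witness[of _ "permute_list (inv \<sigma>)" "permute_list \<sigma>"])
      fix v assume v: "v \<in> words d E"
      note i = permutes_inv[OF \<sigma>]
      show "permute_list (inv \<sigma>) (permute_list \<sigma> v) = v" "permute_list \<sigma> (permute_list (inv \<sigma>) v) = v"
        using \<sigma> i wordsD(1)[OF v] permutes_inv_o[OF \<sigma>]
        by (simp_all flip: permute_list_compose)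
      show "permute_list \<sigma> v \<in> words d E" "permute_list (inv \<sigma>) v \<in> words d E"
        using permute_list_words[OF \<sigma> v] permute_list_words[OF i v] by auto
    qed simp
    finally show ?thesis .
  qed
  moreover have "dual_elt \<in> carr V"
    unfolding dual_elt_def
    by (intro fn.subspace_sum[OF V_subspace] fn.subspace_scale[OF V_subspace] te_carr) (simp add: wordsD(1))
  ultimately show ?thesis by (simp add: Inv_def)
qed

text \<open>Orbit counting for pairs of a letter \<open>c\<close> of \<open>u\<close> and a letter
  \<open>e\<close> of \<open>v\<close>. If \<open>c\<close> lies in \<open>Ec\<close> and occurs in
  \<open>star e\<close>, then \<open>e\<close> lies in \<open>Ea\<close>; so the order of the
  stabilizer divides the factorial built into \<open>dual_coeff v\<close>.\<close>

lemma dual_elt_Tset: "dual_elt \<in> Tset"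
proof -
  have "of_nat (letter_fact Ec u) dvd dual_elt u" if u: "u \<in> words d E" for u
  proof -
    note lu = wordsD(1)[OF u]
    have "of_nat (letter_fact Ec u) dvd (\<Sum>v\<in>words d E. dual_coeff v * te (map star v) u)"
    proof (rule letter_fact_dvd_sum[OF finite_Ec finite_basis lu])
      fix \<sigma> v assume \<sigma>: "\<sigma> \<in> letter_perms Ec u" and v: "v \<in> words d E"
      note D = letter_permsD[OF \<sigma>, unfolded lu]
      have m: "map star (permute_list \<sigma> v) = permute_list \<sigma> (map star v)"
        using D(1) wordsD(1)[OF v] by (simp add: permute_list_map)
      have t: "te (permute_list \<sigma> (map star v)) u = te (map star v) u"
        using te_permute[OF homogD(1)[OF homog_star[OF v]] lu D(1)] D(2) by simp
      have "crossing d \<sigma> (par v) * te (map star v) u = te (map star v) u"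
      proof (cases "te (map star v) u = 0")
        case False
        \<comment> \<open>An odd letter of \<open>v\<close> faces an odd letter of \<open>u\<close>,
          whose position \<sigma> fixes.\<close>
        have "\<sigma> i = i" if "i < d" "par v i" for i
        proof -
          have "u ! i \<in> odd_part M" using te_parity(2)[OF homog_star[OF v] False that(1)] that(2) by simp
          then have "u ! i \<notin> Ec" using odd_iff wordsD(2)[OF u that(1)] by auto
          then show ?thesis using D(4) that by simp
        qed
        then have "crossing d \<sigma> (par v) = (1::'k)" by (rule crossing_eq_1[OF D(1)])
        then show ?thesis by simp
      qed simp
      then show "dual_coeff (permute_list \<sigma> v) * te (map star (permute_list \<sigma> v)) u =
          dual_coeff v * te (map star v) u"
        unfolding m t dual_coeff_permute[OF v D(1)] by (simp add: mult.assoc mult.left_commute)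
    next
      fix v assume v: "v \<in> words d E"
      note lv = wordsD(1)[OF v]
      show "of_nat (letter_fact (Ec \<times> E) (zip u v)) dvd dual_coeff v * te (map star v) u"
      proof (cases "te (map star v) u = 0")
        case False
        have "letter_fact (Ec \<times> E) (zip u v) = letter_fact (Ec \<times> Ea) (zip u v)"
        proof (rule letter_fact_restrict)
          show "finite (Ec \<times> E)" using finite_Ec finite_basis by simp
          show "Ec \<times> Ea \<subseteq> Ec \<times> E" using Ea_E by auto
          fix y assume "y \<in> Ec \<times> E - Ec \<times> Ea"
          then obtain c e where y: "y = (c, e)" "c \<in> Ec" "e \<in> E" "e \<notin> Ea" by auto
          show "count (mset (zip u v)) y \<le> 1"
          \<comment> \<open>Such a pair does not occur at all, so one position already gives a
            contradiction: \<open>e\<close> is even, hence in \<open>Ec\<close>, and then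
            \<open>star e\<close> has no coordinate in \<open>Ec\<close>.\<close>
          proof (rule count_le_1I, rule ccontr)
            fix i assume i: "i < length (zip u v)" "zip u v ! i = y"
            then have id: "i < d" "u ! i = c" "v ! i = e" using lu lv y(1) by auto
            have "c \<in> even_part M" using y(2) even_E by auto
            then have "c \<notin> odd_part M" using odd_iff[of c] y(2) Ec_E by auto
            then have "e \<notin> odd_part M"
              using te_parity(2)[OF homog_star[OF v] False id(1)] id by simp
            then have "e \<in> Ec" using odd_iff y by auto
            moreover have "sc.representation E (star e) c \<noteq> 0"
              using te_nonzero_rep[OF _ False id(1)] id lv by simp
            ultimately have "c \<in> Ea" using representation_span_Ea[OF star_Ec] by blast
            then show False using y(2) disjoint by auto
          qed
        qed
        also have "\<dots> dvd letter_fact Ea (map snd (zip u v))"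
          by (rule letter_fact_map_dvd) (auto simp: finite_Ea finite_Ec)
        also have "map snd (zip u v) = v" using lu lv by simp
        finally have "(of_nat (letter_fact (Ec \<times> E) (zip u v)) :: 'k) dvd of_nat (letter_fact Ea v)"
          by (rule of_nat_dvd)
        then show ?thesis unfolding dual_coeff_def by (simp add: dvd_mult dvd_mult2)
      qed simp
    qed
    then show ?thesis by (simp add: dual_elt_def fsum_apply fscale_def)
  qed
  then show ?thesis using dual_elt_Inv by (simp add: Tset_def)
qed

text \<open>After multiplication by d! and by the factorial for \<open>Ea\<close>, the left side is
  the pairing with \<open>avg (te w)\<close>, which \<open>\<Theta>_avg\<close> and
  \<open>\<Theta>_star\<close> evaluate; both integers are cancelled at the end.\<close>

lemma tT_dual_elt_eta_word:
  assumes w: "w \<in> words d E"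
  shows "tT (tmul dual_elt (eta_word w)) = \<phi> (eta_word w)"
proof -
  note x = dual_elt_Tset
  have tw: "te w \<in> carr V" using wordsD(1)[OF w] by (rule te_carr)
  have "\<Theta> (tmul dual_elt (te w)) = (\<Sum>v\<in>words d E. dual_coeff v * \<Theta> (tmul (te (map star v)) (te w)))"
    by (simp only: dual_elt_def tmul_sum \<Theta>_sum tmul_scale \<Theta>_scale)
  also have "\<dots> = (\<Sum>v\<in>words d E. if v = w then dual_coeff w * koszul d (par w) (par w) else 0)"
    by (intro sum.cong refl) (simp add: \<Theta>_star w)
  also have "\<dots> = dual_coeff w * koszul d (par w) (par w)" using w fin_words by simp
  also have "\<dots> = (koszul d (par w) (par w) * koszul d (par w) (par w)) * (of_nat (letter_fact Ea w) * \<phi> (eta_word w))"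
    unfolding dual_coeff_def by (simp only: ac_simps)
  finally have e: "\<Theta> (tmul dual_elt (te w)) = of_nat (letter_fact Ea w) * \<phi> (eta_word w)"
    unfolding koszul_square by simp
  have "of_nat (letter_fact Ea w) * (of_nat (fact d) * tT (tmul dual_elt (eta_word w))) =
      \<Theta> (tmul dual_elt (avg (te w)))"
    unfolding tT_\<Theta>[OF tmul_Tset[OF x eta_word_Tset[OF w]]] eta_word_avg[OF w, symmetric] tmul_scale \<Theta>_scale ..
  also have "\<dots> = of_nat (fact d) * (of_nat (letter_fact Ea w) * \<phi> (eta_word w))"
    unfolding \<Theta>_avg[OF Tset_Inv[OF x] tw] e ..
  finally have "of_nat (fact d) * (of_nat (letter_fact Ea w) * tT (tmul dual_elt (eta_word w))) =
      of_nat (fact d) * (of_nat (letter_fact Ea w) * \<phi> (eta_word w))"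
    by (simp only: mult.left_commute)
  from fact_cancel[OF this] show ?thesis by (simp add: letter_fact_nonzero)
qed

lemma tT_dual_elt:
  assumes "y \<in> Tset"
  shows "tT (tmul dual_elt y) = \<phi> y"
proof -
  note T = tT_linear[unfolded linear_form_def] and P = \<phi>[unfolded linear_form_def]
  have zero: "tT 0 = 0" "\<phi> 0 = 0"
    using T P fn.subspace_0[OF Tset_subspace] by (metis fn.scale_zero_left mult_zero_left)+
  have "fn.subspace {y \<in> Tset. tT (tmul dual_elt y) = \<phi> y}"
    unfolding fn.subspace_def mem_Collect_eq
  proof (intro conjI ballI allI, goal_cases)
    case 2 show ?case unfolding tmul_zero using zero by simp
  next
    case (3 x y) then show ?case using fn.subspace_add[OF Tset_subspace] by simp
  next
    case (4 x y) then show ?case unfolding tmul_add using T P tmul_Tset[OF dual_elt_Tset] by simp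
  next
    case (5 c x) then show ?case using fn.subspace_scale[OF Tset_subspace] by simp
  next
    case (6 c x) then show ?case unfolding tmul_scale using T P tmul_Tset[OF dual_elt_Tset] by simp
  qed (rule fn.subspace_0[OF Tset_subspace])
  then have "Tset \<subseteq> {y \<in> Tset. tT (tmul dual_elt y) = \<phi> y}"
    by (subst Tset_eq_span, intro fn.span_minimal) (auto simp: eta_word_Tset tT_dual_elt_eta_word)
  then show ?thesis using assms by blast
qed

end

text \<open>Over a domain, an injective map between free modules of equal finite rank need not be
  surjective. Injectivity comes from \<open>tT_nondegenerate\<close>, surjectivity from the explicit
  elements \<open>dual_elt\<close>.\<close>

theorem tT_symmetrizing: "symmetrizing_form T tT"
proof -
  note L = tT_linear[unfolded linear_form_def]
  have odd: "tT x = 0" if x: "x \<in> odd_part V \<inter> Tset" for x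
  proof -
    have "x w * (\<Prod>i<d. \<theta> (w ! i)) = 0" if w: "w \<in> words d E" for w
    proof (cases "x w = 0")
      case False
      then have "odd (odd_count M w)" using x by (auto simp: V_odd)
      then have "{i. i < length w \<and> w ! i \<in> odd_part M} \<noteq> {}" unfolding odd_count_def by force
      then show ?thesis using \<theta>_odd wordsD(1)[OF w] by auto
    qed simp
    then have "\<Theta> x = 0" unfolding \<Theta>_def by (rule sum.neutral[OF ballI])
    then show ?thesis using tT_\<Theta>[of x] x by (simp add: of_nat_fact)
  qed
  have comm: "tT (tmul x y) = tT (tmul y x)" if "x \<in> Tset" "y \<in> Tset" for x y
    by (rule fact_cancel) (simp only: tT_\<Theta> tmul_Tset that \<Theta>_commute[OF Tset_carr[OF that(1)] Tset_carr[OF that(2)]])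
  have "central_form T tT"
    unfolding central_form_def using superalgebra_T free_T tT_linear odd comm unfolding T_sel by blast
  moreover have "bij_betw (\<lambda>x. \<lambda>y\<in>Tset. tT (tmul x y)) Tset (dual_module fscale Tset)"
    unfolding bij_betw_def
  proof
    show "inj_on (\<lambda>x. \<lambda>y\<in>Tset. tT (tmul x y)) Tset"
    proof (rule inj_onI)
      fix x x' assume x: "x \<in> Tset" "x' \<in> Tset"
        and eq: "(\<lambda>y\<in>Tset. tT (tmul x y)) = (\<lambda>y\<in>Tset. tT (tmul x' y))"
      have "tT (tmul (x - x') y) = 0" if y: "y \<in> Tset" for y
      proof -
        have e: "tT (tmul x y) = tT (tmul x' y)" using fun_cong[OF eq, of y] y by simp
        have d: "x - x' \<in> Tset" by (rule fn.subspace_diff[OF Tset_subspace x])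
        have "tmul x y = tmul (x - x') y + tmul x' y"
          unfolding tmul_add[symmetric] by simp
        then have "tT (tmul x y) = tT (tmul (x - x') y) + tT (tmul x' y)"
          using L tmul_Tset[OF d y] tmul_Tset[OF x(2) y] by simp
        then show ?thesis using e by simp
      qed
      then have "x - x' = 0" by (rule tT_nondegenerate[OF fn.subspace_diff[OF Tset_subspace x]])
      then show "x = x'" by simp
    qed
    show "(\<lambda>x. \<lambda>y\<in>Tset. tT (tmul x y)) ` Tset = dual_module fscale Tset"
    proof (intro equalityI subsetI)
      fix g assume "g \<in> (\<lambda>x. \<lambda>y\<in>Tset. tT (tmul x y)) ` Tset"
      then obtain x where x: "x \<in> Tset" "g = (\<lambda>y\<in>Tset. tT (tmul x y))" by blast
      show "g \<in> dual_module fscale Tset"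
        unfolding dual_module_def linear_form_def x(2)
        using L tmul_Tset[OF x(1)] fn.subspace_add[OF Tset_subspace] fn.subspace_scale[OF Tset_subspace]
        by (simp add: tmul_add tmul_scale)
    next
      fix \<phi> assume p: "\<phi> \<in> dual_module fscale Tset"
      then have lin: "linear_form fscale Tset \<phi>" and ext: "\<phi> \<in> extensional Tset"
        by (auto simp: dual_module_def)
      have "\<phi> = (\<lambda>y\<in>Tset. tT (tmul (dual_elt \<phi>) y))"
        using ext tT_dual_elt[OF lin] by (auto simp: extensional_def fun_eq_iff)
      then show "\<phi> \<in> (\<lambda>x. \<lambda>y\<in>Tset. tT (tmul x y)) ` Tset"
        using dual_elt_Tset[OF lin] by blast
    qed
  qed
  ultimately show ?thesis unfolding symmetrizing_form_def T_sel by blast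
qed

end

section \<open>Bases and matrix units\<close>

lemma module_basis_direct_sum:
  assumes m: "module s" and E: "module_basis s X E" and F: "module_basis s Y F" and Z: "direct_sum Z X Y"
  shows "module_basis s Z (E \<union> F)" "E \<inter> F = {}"
proof -
  interpret module s by fact
  have ind: "independent E" "independent F" and sp: "span E = X" "span F = Y"
    using E F by (auto simp: module_basis_def)
  have XY: "X \<inter> Y = {0}" "Z = {x + y |x y. x \<in> X \<and> y \<in> Y}" using Z by (auto simp: direct_sum_def)
  have "x = 0" if "x \<in> E" "x \<in> F" for x
    using that span_base[of x E] span_base[of x F] sp XY(1) by blast
  then show disj: "E \<inter> F = {}" using ind dependent_zero by blast
  have indep: "u v = 0"
    if t: "finite t" "t \<subseteq> E \<union> F" "(\<Sum>v\<in>t. s (u v) v) = 0" "v \<in> t" for t u v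
  proof -
    have "(\<Sum>v\<in>t. s (u v) v) = (\<Sum>v\<in>t \<inter> E. s (u v) v) + (\<Sum>v\<in>t - E. s (u v) v)"
      using t(1) by (rule sum.Int_Diff)
    then have e: "(\<Sum>v\<in>t \<inter> E. s (u v) v) = - (\<Sum>v\<in>t - E. s (u v) v)"
      using t(3) by (simp add: eq_neg_iff_add_eq_0)
    have 1: "(\<Sum>v\<in>t \<inter> E. s (u v) v) \<in> span E"
      by (intro span_sum span_scale span_base) auto
    have 2: "(\<Sum>v\<in>t - E. s (u v) v) \<in> span F"
      using t(2) by (intro span_sum span_scale span_base) auto
    have "(\<Sum>v\<in>t \<inter> E. s (u v) v) \<in> X \<inter> Y"
      using 1 2 e span_neg sp by auto
    then have 0: "(\<Sum>v\<in>t \<inter> E. s (u v) v) = 0" using XY(1) by blast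
    then have zero: "(\<Sum>v\<in>t - E. s (u v) v) = 0" using e by simp
    show ?thesis
    proof (cases "v \<in> E")
      case True
      then show ?thesis using independentD[OF ind(1) _ _ 0, of v] t by auto
    next
      case False
      then show ?thesis using independentD[OF ind(2) _ _ zero, of v] t by auto
    qed
  qed
  have "independent (E \<union> F)" unfolding independent_explicit_module using indep by blast
  moreover have "span (E \<union> F) = Z" unfolding span_Un sp XY(2) ..
  ultimately show "module_basis s Z (E \<union> F)" by (simp add: module_basis_def)
qed

text \<open>Finite rank provides some finite basis, while the given \<open>B\<close> is arbitrary.
  The finitely many elements of \<open>B\<close> needed to express \<open>E\<close> already span,
  and by independence \<open>B\<close> has no others.\<close>

lemma module_basis_finite:
  assumes m: "module s" and E: "finite E" "module_basis s X E" and B: "module_basis s X B"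
  shows "finite B"
proof -
  interpret module s by fact
  have sp: "span E = X" "independent B" "span B = X" using E B by (auto simp: module_basis_def)
  define F where "F = (\<Union>e\<in>E. {b. representation B e b \<noteq> 0})"
  have finF: "finite F" unfolding F_def using E(1) finite_representation by blast
  have FB: "F \<subseteq> B" unfolding F_def using representation_ne_zero by blast
  have "e \<in> span F" if e: "e \<in> E" for e
  proof -
    have "e \<in> span B" using e sp span_base by blast
    then have "(\<Sum>b | representation B e b \<noteq> 0. s (representation B e b) b) = e"
      by (rule sum_nonzero_representation_eq[OF sp(2)])
    moreover have "(\<Sum>b | representation B e b \<noteq> 0. s (representation B e b) b) \<in> span F"
      using e by (intro span_sum span_scale span_base) (auto simp: F_def)
    ultimately show ?thesis by simp
  qed
  then have spF: "span B \<subseteq> span F" unfolding sp(3) sp(1)[symmetric] by (intro span_minimal) auto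
  have "b \<in> F" if b: "b \<in> B" for b
  proof -
    have "b \<in> span F" using spF b span_base by blast
    then have "representation F b b = representation B b b"
      using representation_extend[OF sp(2) _ FB] by simp
    then have "representation F b b = 1" using representation_basis[OF sp(2) b] by simp
    then show ?thesis using representation_ne_zero[of F b b] by simp
  qed
  then show ?thesis by (intro finite_subset[OF subsetI finF])
qed

lemma linear_form_sum:
  assumes m: "module s" and X: "module.subspace s X" and f: "linear_form s X f"
    and x: "\<And>i. i \<in> I \<Longrightarrow> x i \<in> X"
  shows "f (\<Sum>i\<in>I. x i) = (\<Sum>i\<in>I. f (x i))"
proof -
  interpret module s by fact
  have 0: "f 0 = 0"
    using f subspace_0[OF X] unfolding linear_form_def by (metis mult_zero_left scale_zero_left)
  show ?thesis using x
  proof (induction I rule: infinite_finite_induct)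
    case (insert i I)
    then have "x i \<in> X" "(\<Sum>i\<in>I. x i) \<in> X" using subspace_sum[OF X, of I x] by auto
    then show ?case using insert f by (simp add: linear_form_def)
  qed (simp_all add: 0)
qed

lemma munit_eq_iff: "b \<noteq> 0 \<Longrightarrow> munit b r s = munit b' r' s' \<longleftrightarrow> b = b' \<and> r = r' \<and> s = s'"
  by (auto simp: munit_def vec_eq_iff)

lemma mul_munit:
  assumes A: "superalgebra A" and x: "x \<in> carr A" and y: "y \<in> carr A"
  shows "mul (mat_superalg A) (munit x r s) (munit y r' s' :: 'a::ab_group_add^'n::finite^'n) =
    (if s = r' then munit (mul A x y) r s' else 0)"
proof -
  interpret module "smul A" using superalgebraD(1)[OF A] .
  note D = superalgebraD[OF A]
  have z: "0 \<in> carr A" by (rule subspace_0[OF D(2)])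
  have m0: "mul A 0 u = 0" "mul A u 0 = 0" if "u \<in> carr A" for u
    using D(9)[of 0 u 0] D(10)[of u 0 0] that z by auto
  have "(\<Sum>k\<in>UNIV. mul A (munit x r s $ i $ k) (munit y r' s' $ k $ j)) =
      (\<Sum>k\<in>UNIV. if k = s then (if i = r \<and> s = r' \<and> j = s' then mul A x y else 0) else 0)" for i j
    using x y z by (intro sum.cong) (auto simp: munit_nth m0)
  then show ?thesis
    by (simp add: mat_superalg_def vec_eq_iff munit_nth)
qed

definition trace_form :: "('a \<Rightarrow> 'k::comm_ring_1) \<Rightarrow> 'a^'n::finite^'n \<Rightarrow> 'k" where
  "trace_form t X = (\<Sum>i\<in>UNIV. t (X $ i $ i))"

lemma trace_form_munit: "t 0 = 0 \<Longrightarrow> trace_form t (munit x r s) = (if r = s then t x else 0)"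
proof -
  assume "t 0 = 0"
  then have "trace_form t (munit x r s) = (\<Sum>i\<in>UNIV. if i = r then (if r = s then t x else 0) else 0)"
    unfolding trace_form_def by (intro sum.cong) (auto simp: munit_nth)
  then show ?thesis by simp
qed

text \<open>\<open>symmetrizing\<close> provides some complement that pairs perfectly with \<aa>;
  \<open>perfect\<close> says this of the complement that underlies the given basis.\<close>

locale symmetric_good_pair =
  fixes A :: "('k::{idom,ring_char_0}, 'a::ab_group_add) superalg"
    and \<aa> \<cc> Ba Bc B1 :: "'a set" and t :: "'a \<Rightarrow> 'k"
  assumes unital: "unital_good_pair A \<aa>"
    and free: "free_finite_rank (smul A) (carr A)"
    and symmetrizing: "pair_symmetrizing_form A \<aa> t"
    and pbasis: "pair_basis A \<aa> \<cc> Ba Bc B1"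
    and perfect: "perfect_pairing A t \<aa> \<cc>"
begin

abbreviation "B \<equiv> Ba \<union> Bc \<union> B1"

lemma superalg_A: "superalgebra A"
  using unital by (simp add: unital_good_pair_def good_pair_def)

lemmas D = superalgebraD[OF superalg_A]

sublocale a: module "smul A" using D(1) .

lemma bases: "module_basis (smul A) \<aa> Ba" "module_basis (smul A) \<cc> Bc" "module_basis (smul A) (odd_part A) B1"
  and complement: "direct_sum (even_part A) \<aa> \<cc>"
  using pbasis by (auto simp: pair_basis_def pair_complement_def)

lemma even_basis: "module_basis (smul A) (even_part A) (Ba \<union> Bc)" "Ba \<inter> Bc = {}"
  using module_basis_direct_sum[OF D(1) bases(1,2) complement] by auto

lemma basis_B: "module_basis (smul A) (carr A) B" "(Ba \<union> Bc) \<inter> B1 = {}"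
  using module_basis_direct_sum[OF D(1) even_basis(1) bases(3) D(5)] by auto

lemma finite_B: "finite B"
  using free module_basis_finite[OF D(1) _ _ basis_B(1)] by (auto simp: free_finite_rank_def)

lemma B_subsets: "Ba \<subseteq> \<aa>" "Bc \<subseteq> \<cc>" "Ba \<union> Bc \<subseteq> even_part A" "B1 \<subseteq> odd_part A" "B \<subseteq> carr A"
proof -
  have "F \<subseteq> X" if "module_basis (smul A) X F" for F X
    using that a.span_superset[of F] by (simp add: module_basis_def)
  from this[OF bases(1)] this[OF bases(2)] this[OF even_basis(1)] this[OF bases(3)] this[OF basis_B(1)]
  show "Ba \<subseteq> \<aa>" "Bc \<subseteq> \<cc>" "Ba \<union> Bc \<subseteq> even_part A" "B1 \<subseteq> odd_part A" "B \<subseteq> carr A" .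
qed

lemma parts_carr: "x \<in> even_part A \<Longrightarrow> x \<in> carr A" "x \<in> odd_part A \<Longrightarrow> x \<in> carr A"
  using homogeneous_in_carr[OF superalg_A] by auto

lemma a_even: "x \<in> \<aa> \<Longrightarrow> x \<in> even_part A"
  using unital by (auto simp: unital_good_pair_def good_pair_def)

lemma B_nonzero: "b \<in> B \<Longrightarrow> b \<noteq> 0"
  using basis_B(1) a.dependent_zero by (auto simp: module_basis_def)

lemma t_linear: "linear_form (smul A) (carr A) t" and t_odd: "x \<in> odd_part A \<Longrightarrow> t x = 0"
  and t_commute: "x \<in> carr A \<Longrightarrow> y \<in> carr A \<Longrightarrow> t (mul A x y) = t (mul A y x)"
  and t_dual: "bij_betw (\<lambda>x. \<lambda>y\<in>carr A. t (mul A x y)) (carr A) (dual_module (smul A) (carr A))"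
  and t_aa: "x \<in> \<aa> \<Longrightarrow> y \<in> \<aa> \<Longrightarrow> t (mul A x y) = 0"
  using symmetrizing by (simp_all add: pair_symmetrizing_form_def symmetrizing_form_def central_form_def)

lemma t_zero: "t 0 = 0"
  using t_odd a.subspace_0[OF D(4)] by blast

text \<open>The value at \<open>x\<close> is that of the product of the unit with \<open>x\<close>;
  the unit lies in \<aa>, and \<aa> is isotropic.\<close>

lemma t_a: "x \<in> \<aa> \<Longrightarrow> t x = 0"
proof -
  assume x: "x \<in> \<aa>"
  obtain e where e: "e \<in> \<aa>" "\<forall>x\<in>carr A. mul A e x = x"
    using unital by (auto simp: unital_good_pair_def)
  then show "t x = 0" using t_aa[OF e(1) x] x a_even parts_carr by auto
qed

lemma representation_linear:
  assumes F: "module_basis (smul A) X F"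
  shows "(\<lambda>y\<in>X. a.representation F y b) \<in> dual_module (smul A) X"
proof -
  have F': "a.independent F" "a.span F = X" using F by (auto simp: module_basis_def)
  have "x + y \<in> X" "smul A c x \<in> X" if "x \<in> X" "y \<in> X" for x y c
    using that a.span_add a.span_scale unfolding F'(2)[symmetric] by auto
  then show ?thesis
    using F' by (auto simp: dual_module_def linear_form_def a.representation_add a.representation_scale)
qed

text \<open>For \<open>b\<close> in \<open>Bc\<close> the pairing with the complement gives an
  element of \<aa>; it is dual on all of \<open>B\<close>, as isotropy takes care of
  \<open>Ba\<close> and parity of \<open>B1\<close>. For other \<open>b\<close> the form on the
  whole algebra gives \<open>x\<close>, and the component of \<open>x\<close> with the parity of
  \<open>b\<close> is still dual because the form vanishes on odd elements.\<close>

lemma dual_basis: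
  assumes b: "b \<in> B"
  obtains x where "\<And>b'. b' \<in> B \<Longrightarrow> t (mul A x b') = (if b = b' then 1 else 0)"
    "x \<in> (if b \<in> B1 then odd_part A else even_part A)" "b \<in> Bc \<Longrightarrow> x \<in> \<aa>"
proof (cases "b \<in> Bc")
  case True
  let ?g = "\<lambda>y\<in>\<cc>. a.representation Bc y b"
  have "?g \<in> (\<lambda>x. \<lambda>y\<in>\<cc>. t (mul A x y)) ` \<aa>"
    using perfect representation_linear[OF bases(2)] by (auto simp: perfect_pairing_def bij_betw_def)
  then obtain x where x: "x \<in> \<aa>" "?g = (\<lambda>y\<in>\<cc>. t (mul A x y))" by blast
  have c: "t (mul A x b') = (if b = b' then 1 else 0)" if b': "b' \<in> Bc" for b'
  proof -
    have ind: "a.independent Bc" using bases(2) by (simp add: module_basis_def)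
    have "t (mul A x b') = a.representation Bc b' b"
      using fun_cong[OF x(2), of b'] b' B_subsets(2) by auto
    then show ?thesis using a.representation_basis[OF ind b'] by simp
  qed
  show ?thesis
  proof (rule that)
    show "x \<in> \<aa>" by (rule x(1))
    have "b \<notin> B1" using True basis_B(2) by blast
    then show "x \<in> (if b \<in> B1 then odd_part A else even_part A)" using a_even[OF x(1)] by simp
    fix b' assume "b' \<in> B"
    then consider "b' \<in> Ba" | "b' \<in> Bc" | "b' \<in> B1" by blast
    then show "t (mul A x b') = (if b = b' then 1 else 0)"
    proof cases
      case 1
      then show ?thesis using t_aa[OF x(1)] B_subsets(1) True even_basis(2) by auto
    next
      case 2
      then show ?thesis by (rule c)
    next
      case 3
      then have "mul A x b' \<in> odd_part A" using B_subsets(4) a_even[OF x(1)] by (intro D(13)) auto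
      then show ?thesis using t_odd 3 True basis_B(2) by auto
    qed
  qed
next
  case False
  have ind: "a.independent B" using basis_B(1) by (simp add: module_basis_def)
  let ?g = "\<lambda>y\<in>carr A. a.representation B y b"
  have "?g \<in> (\<lambda>x. \<lambda>y\<in>carr A. t (mul A x y)) ` carr A"
    using t_dual representation_linear[OF basis_B(1)] by (auto simp: bij_betw_def)
  then obtain x where x: "x \<in> carr A" "?g = (\<lambda>y\<in>carr A. t (mul A x y))" by blast
  have c: "t (mul A x b') = (if b = b' then 1 else 0)" if b': "b' \<in> B" for b'
  proof -
    have "t (mul A x b') = a.representation B b' b"
      using fun_cong[OF x(2), of b'] b' B_subsets(5) by auto
    then show ?thesis using a.representation_basis[OF ind b'] by simp
  qed
  obtain x0 x1 where x01: "x = x0 + x1" "x0 \<in> even_part A" "x1 \<in> odd_part A"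
    using x(1) D(5) by (auto simp: direct_sum_def)
  have tx: "t (mul A x y) = t (mul A x0 y) + t (mul A x1 y)" if "y \<in> carr A" for y
  proof -
    have "mul A x y = mul A x0 y + mul A x1 y" "mul A x0 y \<in> carr A" "mul A x1 y \<in> carr A"
      using x01 that parts_carr by (auto intro: D(6) D(7))
    then show ?thesis using t_linear by (simp add: linear_form_def)
  qed
  have even1: "t (mul A x1 y) = 0" if "y \<in> even_part A" for y
    using t_odd D(14)[OF x01(3) that] by simp
  have odd0: "t (mul A x0 y) = 0" if "y \<in> odd_part A" for y
    using t_odd D(13)[OF x01(2) that] by simp
  show ?thesis
  proof (rule that[of "if b \<in> B1 then x1 else x0"])
    show "(if b \<in> B1 then x1 else x0) \<in> (if b \<in> B1 then odd_part A else even_part A)"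
      using x01 by simp
    show "(if b \<in> B1 then x1 else x0) \<in> \<aa>" if "b \<in> Bc" using that False by simp
    fix b' assume b': "b' \<in> B"
    have b'c: "b' \<in> carr A" using b' B_subsets(5) by auto
    show "t (mul A (if b \<in> B1 then x1 else x0) b') = (if b = b' then 1 else 0)"
    proof (cases "b' \<in> B1")
      case True
      then have o: "b' \<in> odd_part A" using B_subsets(4) by auto
      show ?thesis using c[OF b'] tx[OF b'c] odd0[OF o] True by auto
    next
      case False
      then have e: "b' \<in> even_part A" using b' B_subsets(3) by auto
      show ?thesis using c[OF b'] tx[OF b'c] even1[OF e] False by auto
    qed
  qed
qed

end

section \<open>The generalized Schur superalgebra\<close>

context symmetric_good_pair
begin

text \<open>Under the trace form, the matrix unit with entry \<open>b\<close> at (r, s) is dual to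
  the one at (s, r) whose entry is dual to \<open>b\<close>. The properties of \<open>star\<close>
  are inherited from the entries.\<close>

lemma mat_symmetric_pair:
  "\<exists>star. symmetric_pair (mat_superalg A :: ('k, 'a^'n::finite^'n) superalg) (mat_basis B)
     (mat_basis Ba) (mat_basis Bc) (trace_form t) star"
proof -
  let ?M = "mat_superalg A :: ('k, 'a^'n^'n) superalg"
  have M: "superalgebra ?M" by (rule superalgebra_mat[OF superalg_A])
  interpret m: module "smul ?M" by (rule superalgebraD(1)[OF M])
  have sel: "carr ?M = {X. \<forall>i j. X $ i $ j \<in> carr A}" "even_part ?M = {X. \<forall>i j. X $ i $ j \<in> even_part A}"
    "odd_part ?M = {X. \<forall>i j. X $ i $ j \<in> odd_part A}"
    "smul ?M c X = (\<chi> i j. smul A c (X $ i $ j))"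
    "mul ?M X Y = (\<chi> i j. \<Sum>k\<in>UNIV. mul A (X $ i $ k) (Y $ k $ j))" for c X Y
    by (simp_all add: mat_superalg_def)
  have zero: "0 \<in> even_part A" "0 \<in> odd_part A"
    using a.subspace_0[OF D(3)] a.subspace_0[OF D(4)] by auto
  have munit_parity: "munit x r s \<in> even_part ?M \<longleftrightarrow> x \<in> even_part A"
    "munit x r s \<in> odd_part ?M \<longleftrightarrow> x \<in> odd_part A" for x r s
    using zero by (auto simp: sel munit_nth)
  have basisI: "munit b r s \<in> mat_basis F" if "b \<in> F" for b r s F
    using that by (auto simp: mat_basis_def)
  have basisE: "\<exists>b r s. b \<in> F \<and> e = munit b r s" if "e \<in> mat_basis F" for e :: "'a^'n^'n" and F
    using that by (auto simp: mat_basis_def)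
  have eo: "b \<notin> odd_part A" if "b \<in> Ba \<union> Bc" for b
    using that B_subsets(3) B_nonzero[of b] D(5) by (auto simp: direct_sum_def)
  have oe: "b \<notin> even_part A" if "b \<in> B1" for b
    using that B_subsets(4) B_nonzero[of b] D(5) by (auto simp: direct_sum_def)
  have span: "munit z r s \<in> m.span (mat_basis Ba)" if "z \<in> a.span Ba" for z r s
    using that
  proof (induction rule: a.span_induct_alt)
    case base
    have "munit 0 r s = (0 :: 'a^'n^'n)" by (simp add: munit_def vec_eq_iff)
    then show ?case using m.span_zero by simp
  next
    case (step c x y)
    have "munit (smul A c x + y) r s = smul ?M c (munit x r s) + munit y r s"
      by (simp add: sel vec_eq_iff munit_nth)
    then show ?case using step by (simp add: m.span_add m.span_scale m.span_base basisI)
  qed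
  have spanBa: "a.span Ba = \<aa>" using bases(1) by (simp add: module_basis_def)
  have closed: "mul A x y \<in> \<aa>" if "x \<in> \<aa>" "y \<in> \<aa>" for x y
    using unital that by (auto simp: unital_good_pair_def good_pair_def)
  have star: "\<exists>x. (\<forall>e'\<in>mat_basis B. trace_form t (mul ?M x e') = (if e = e' then 1 else 0)) \<and>
      x \<in> (if e \<in> odd_part ?M then odd_part ?M else even_part ?M) \<and>
      (e \<in> mat_basis Bc \<longrightarrow> x \<in> m.span (mat_basis Ba))" if E: "e \<in> mat_basis B" for e
  proof -
    obtain b r s where e: "b \<in> B" "e = munit b r s" using basisE[OF E] by blast
    obtain x where x: "\<And>b'. b' \<in> B \<Longrightarrow> t (mul A x b') = (if b = b' then 1 else 0)"
      "x \<in> (if b \<in> B1 then odd_part A else even_part A)" "b \<in> Bc \<Longrightarrow> x \<in> \<aa>"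
      using dual_basis[OF e(1)] by blast
    have xc: "x \<in> carr A" using x(2) parts_carr by (auto split: if_splits)
    show ?thesis
    proof (intro exI[of _ "munit x s r"] conjI ballI impI)
      fix e' :: "'a^'n^'n" assume "e' \<in> mat_basis B"
      then obtain b' r' s' where e': "b' \<in> B" "e' = munit b' r' s'" using basisE by blast
      have "e = e' \<longleftrightarrow> b = b' \<and> r = r' \<and> s = s'"
        unfolding e(2) e'(2) by (rule munit_eq_iff[OF B_nonzero[OF e(1)]])
      moreover have "b' \<in> carr A" using e'(1) B_subsets(5) by auto
      moreover have "trace_form t (0 :: 'a^'n^'n) = 0" by (simp add: trace_form_def t_zero)
      ultimately show "trace_form t (mul ?M (munit x s r) e') = (if e = e' then 1 else 0)"
        unfolding e'(2) by (auto simp: mul_munit[OF superalg_A xc] trace_form_munit t_zero x(1)[OF e'(1)])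
    next
      have "e \<in> odd_part ?M \<longleftrightarrow> b \<in> B1"
        unfolding e(2) munit_parity using e(1) eo B_subsets(4) by auto
      then show "munit x s r \<in> (if e \<in> odd_part ?M then odd_part ?M else even_part ?M)"
        using x(2) by (auto simp: munit_parity split: if_splits)
    next
      assume "e \<in> mat_basis Bc"
      then obtain b' r' s' where "b' \<in> Bc" "e = munit b' r' s'" using basisE by blast
      then have "b \<in> Bc" using munit_eq_iff[OF B_nonzero[OF e(1)]] e(2) by metis
      then show "munit x s r \<in> m.span (mat_basis Ba)" using span x(3) spanBa by simp
    qed
  qed
  then obtain star where star: "\<And>e. e \<in> mat_basis B \<Longrightarrow>
      (\<forall>e'\<in>mat_basis B. trace_form t (mul ?M (star e) e') = (if e = e' then 1 else 0)) \<and>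
      star e \<in> (if e \<in> odd_part ?M then odd_part ?M else even_part ?M) \<and>
      (e \<in> mat_basis Bc \<longrightarrow> star e \<in> m.span (mat_basis Ba))"
    by metis
  have t_sum: "t (\<Sum>i\<in>I. x i) = (\<Sum>i\<in>I. t (x i))" if "\<And>i. x i \<in> carr A" for I :: "'n set" and x
    using that by (rule linear_form_sum[OF D(1,2) t_linear])
  have "symmetric_pair ?M (mat_basis B) (mat_basis Ba) (mat_basis Bc) (trace_form t) star"
  proof unfold_locales
    show "superalgebra ?M" by (rule M)
    show "module_basis (smul ?M) (carr ?M) (mat_basis B)" "finite (mat_basis B :: ('a^'n^'n) set)"
      by (rule module_basis_mat[OF superalg_A basis_B(1) finite_B])+
    show "mat_basis B \<subseteq> even_part ?M \<union> odd_part ?M"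
      using B_subsets(3,4) by (auto simp: mat_basis_def munit_parity)
    show "mat_basis B \<inter> even_part ?M = mat_basis Ba \<union> mat_basis Bc"
      using B_subsets(3) oe by (fastforce simp: mat_basis_def munit_parity)
    have "b \<in> Bc" if "b \<in> Ba" "munit b r s = munit b' r' s'" "b' \<in> Bc" for b b' and r s r' s' :: 'n
      using that B_nonzero[of b] by (auto simp: munit_eq_iff)
    then show "mat_basis Ba \<inter> mat_basis Bc = ({} :: ('a^'n^'n) set)"
      using even_basis(2) by (auto simp: mat_basis_def)
    show "mul ?M x y \<in> m.span (mat_basis Ba)" if xy: "x \<in> mat_basis Ba" "y \<in> mat_basis Ba" for x y
    proof -
      obtain a r s where x: "a \<in> Ba" "x = munit a r s" using basisE[OF xy(1)] by blast
      obtain a' r' s' where y: "a' \<in> Ba" "y = munit a' r' s'" using basisE[OF xy(2)] by blast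
      have "a \<in> carr A" "a' \<in> carr A" using x y B_subsets(5) by auto
      moreover have "mul A a a' \<in> a.span Ba" using x y B_subsets(1) closed by (auto simp: spanBa)
      ultimately show ?thesis
        unfolding x(2) y(2) by (auto simp: mul_munit[OF superalg_A] intro: span m.span_zero)
    qed
    show "linear_form (smul ?M) (carr ?M) (trace_form t)"
      using t_linear by (simp add: linear_form_def trace_form_def sel sum.distrib sum_distrib_left)
    show "trace_form t x = 0" if "x \<in> odd_part ?M" for x
      using that t_odd by (simp add: trace_form_def sel)
    show "trace_form t (mul ?M x y) = trace_form t (mul ?M y x)" if "x \<in> carr ?M" "y \<in> carr ?M" for x y
    proof -
      have c: "x $ i $ j \<in> carr A" "y $ i $ j \<in> carr A" for i j using that by (auto simp: sel)
      have "trace_form t (mul ?M x y) = (\<Sum>i\<in>UNIV. \<Sum>k\<in>UNIV. t (mul A (x $ i $ k) (y $ k $ i)))"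
        using c by (simp add: trace_form_def sel t_sum D(6))
      also have "\<dots> = (\<Sum>k\<in>UNIV. \<Sum>i\<in>UNIV. t (mul A (x $ i $ k) (y $ k $ i)))" by (rule sum.swap)
      also have "\<dots> = (\<Sum>k\<in>UNIV. \<Sum>i\<in>UNIV. t (mul A (y $ k $ i) (x $ i $ k)))"
        using c by (intro sum.cong refl t_commute)
      also have "\<dots> = trace_form t (mul ?M y x)"
        using c by (simp add: trace_form_def sel t_sum D(6))
      finally show ?thesis .
    qed
    show "trace_form t e = 0" if "e \<in> mat_basis Ba" for e :: "'a^'n^'n"
      using that B_subsets(1) t_a by (auto simp: mat_basis_def trace_form_munit t_zero)
    show "trace_form t (mul ?M (star e) e') = (if e = e' then 1 else 0)"
      if "e \<in> mat_basis B" "e' \<in> mat_basis B" for e e'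
      using star[OF that(1)] that(2) by blast
    show "star e \<in> (if e \<in> odd_part ?M then odd_part ?M else even_part ?M)" if "e \<in> mat_basis B" for e
      using star[OF that] by blast
    show "star e \<in> m.span (mat_basis Ba)" if "e \<in> mat_basis Bc" for e
      using star[of e] that by (auto simp: mat_basis_def)
  qed
  then show ?thesis by blast
qed

text \<open>Triples become words of matrix units by \<open>word\<close>: \<open>Tri\<close> turns
  into \<open>odd_distinct\<close>, the stabilizers agree, and \<open>triple_fact\<close> turns into
  \<open>letter_fact\<close>. Basis elements are nonzero, so a matrix unit determines its entry and
  its position.\<close>

lemma T_symmetrizing:
  fixes d :: nat
  defines "T \<equiv> (T_superalg A B Bc d :: ('k, ('a^'n::finite^'n) list \<Rightarrow> 'k) superalg)"
  shows "\<exists>tT. symmetrizing_form T tT \<and>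
     (\<forall>b r s. (b, r, s) \<in> Tri A B d \<longrightarrow>
        tT (eta A B Bc d b r s) = (if r = s then prod_list (map t b) else 0))"
proof -
  let ?M = "mat_superalg A :: ('k, 'a^'n^'n) superalg"
  obtain star where "symmetric_pair ?M (mat_basis B) (mat_basis Ba) (mat_basis Bc) (trace_form t) star"
    using mat_symmetric_pair by blast
  then interpret S: symmetric_pair ?M "mat_basis B" d "mat_basis Ba" "mat_basis Bc" "trace_form t" star .
  define word where "word b r s = map (\<lambda>(b, r, s). munit b r s :: 'a^'n^'n) (zip b (zip r s))" for b r s
  have Tri: "length b = d" "length r = d" "length s = d" "b \<in> words d B" "\<And>i. i < d \<Longrightarrow> b ! i \<in> B"
    "length (word b r s) = d" "\<And>i. i < d \<Longrightarrow> word b r s ! i = munit (b ! i) (r ! i) (s ! i)"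
    if "(b, r, s) \<in> Tri A B d" for b and r s :: "'n list"
  proof -
    show l: "length b = d" "length r = d" "length s = d" and w: "b \<in> words d B"
      using that by (auto simp: Tri_def words_def)
    show "length (word b r s) = d" "\<And>i. i < d \<Longrightarrow> word b r s ! i = munit (b ! i) (r ! i) (s ! i)"
      using l by (simp_all add: word_def)
    show "\<And>i. i < d \<Longrightarrow> b ! i \<in> B" using w by (rule S.wordsD(2))
  qed
  have zero_even: "0 \<in> even_part A" by (rule a.subspace_0[OF D(3)])
  have even: "munit x r s \<in> even_part ?M \<longleftrightarrow> x \<in> even_part A" for x r s
    using zero_even by (auto simp: mat_superalg_def munit_nth)
  have word: "word b r s \<in> words d (mat_basis B)" "S.odd_distinct (word b r s)"
    if T: "(b, r, s) \<in> Tri A B d" for b r s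
  proof -
    show "word b r s \<in> words d (mat_basis B)"
    proof -
      have "word b r s ! i \<in> mat_basis B" if "i < d" for i
        unfolding mat_basis_def using Tri(5,7)[OF T that] by blast
      then show ?thesis using Tri(6)[OF T] by (auto simp: words_def in_set_conv_nth)
    qed
    show "S.odd_distinct (word b r s)"
      unfolding S.odd_distinct_def
    proof (intro allI impI, elim conjE)
      fix i j assume ij: "i < d" "j < d" "i \<noteq> j" "word b r s ! i = word b r s ! j"
      then have "(b ! i, r ! i, s ! i) = (b ! j, r ! j, s ! j)"
        using Tri(7)[OF T] by (simp add: munit_eq_iff[OF B_nonzero[OF Tri(5)[OF T ij(1)]]])
      then have "b ! i \<in> even_part A" using T ij unfolding Tri_def by (auto simp del: prod.inject)
      then show "word b r s ! i \<in> even_part ?M" using Tri(7)[OF T ij(1)] even by simp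
    qed
  qed
  have count: "count (mset (word b r s)) (munit x p q) = triple_count b r s x p q"
    if T: "(b, r, s) \<in> Tri A B d" for b r s x p q
  proof -
    have "word b r s ! i = munit x p q \<longleftrightarrow> (b ! i, r ! i, s ! i) = (x, p, q)" if i: "i < d" for i
      unfolding Tri(7)[OF T i] prod.inject by (rule munit_eq_iff[OF B_nonzero[OF Tri(5)[OF T i]]])
    then show ?thesis
      unfolding count_mset_card triple_count_def Tri(1)[OF T] Tri(6)[OF T]
      by (intro arg_cong[where f = card]) blast
  qed
  have fact_eq: "triple_fact Bc b r s = letter_fact (mat_basis Bc) (word b r s)"
    if T: "(b, r, s) \<in> Tri A B d" for b r s
  proof -
    have mb: "mat_basis Bc = (\<lambda>(x, p, q). munit x p q :: 'a^'n^'n) ` (Bc \<times> UNIV \<times> UNIV)"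
      by (fastforce simp: mat_basis_def image_iff)
    have inj: "inj_on (\<lambda>(x, p, q). munit x p q :: 'a^'n^'n) (Bc \<times> UNIV \<times> UNIV)"
      using B_nonzero by (auto simp: inj_on_def munit_eq_iff)
    show ?thesis
      unfolding letter_fact_def mb prod.reindex[OF inj] triple_fact_def
      by (simp add: prod.cartesian_product case_prod_unfold count[OF T])
  qed
  have eta: "eta A B Bc d b r s = S.eta_word (word b r s)" if T: "(b, r, s) \<in> Tri A B d" for b r s
  \<comment> \<open>After multiplication by the factorial for \<open>Ea\<close>, both sides are the
    order of the stabilizer times \<open>xi\<close>.\<close>
  proof (rule S.eta_word_unique[OF word(1)[OF T]])
    define H where "H = {\<sigma>. \<sigma> permutes {..<d} \<and> permute_list \<sigma> (word b r s) = word b r s}"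
    have "permute_list \<sigma> (word b r s) = word b r s \<longleftrightarrow>
        permute_list \<sigma> b = b \<and> permute_list \<sigma> r = r \<and> permute_list \<sigma> s = s" if \<sigma>: "\<sigma> permutes {..<d}" for \<sigma>
    proof -
      have \<sigma>d: "\<sigma> i < d" if "i < d" for i using permutes_in_image[OF \<sigma>] that by simp
      have "word b r s ! \<sigma> i = word b r s ! i \<longleftrightarrow> b ! \<sigma> i = b ! i \<and> r ! \<sigma> i = r ! i \<and> s ! \<sigma> i = s ! i"
        if "i < d" for i
        unfolding Tri(7)[OF T that] Tri(7)[OF T \<sigma>d[OF that]]
        by (rule munit_eq_iff[OF B_nonzero[OF Tri(5)[OF T \<sigma>d[OF that]]]])
      then show ?thesis using \<sigma> Tri(1-3,6)[OF T] by (auto simp: permute_list_eq_iff)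
    qed
    then have stab: "triple_stab d b r s = H" by (auto simp: triple_stab_def H_def)
    have xi: "xi A B d b r s = (\<Sum>K\<in>stab_cosets d b r s. S.act (SOME \<sigma>. \<sigma> \<in> K) (S.te (word b r s)))"
      unfolding xi_def xi_tensor_def word_def ..
    have "S.avg (S.te (word b r s)) =
        fscale (of_nat (letter_fact (mat_basis Ba \<union> mat_basis Bc) (word b r s))) (xi A B d b r s)"
      unfolding xi stab_cosets_def stab by (rule S.avg_te_cosets[OF word[OF T] H_def refl])
    then show "fscale (of_nat (letter_fact (mat_basis Ba) (word b r s))) (eta A B Bc d b r s) =
        S.avg (S.te (word b r s))"
      unfolding eta_def fact_eq[OF T] S.fn.scale_scale S.letter_fact_even by simp
  qed
  have surj: "\<exists>b r s. (b, r, s) \<in> Tri A B d \<and> w = word b r s"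
    if w: "w \<in> words d (mat_basis B)" "S.odd_distinct w" for w
  proof -
    have "\<exists>x p q. x \<in> B \<and> w ! i = munit x p q" if "i < d" for i
      using S.wordsD(2)[OF w(1) that] unfolding mat_basis_def by blast
    then obtain f g h where fgh: "\<And>i. i < d \<Longrightarrow> f i \<in> B \<and> w ! i = munit (f i) (g i) (h i)" by metis
    have lw: "length w = d" by (rule S.wordsD(1)[OF w(1)])
    have "f i \<in> even_part A" if "i < d" "j < d" "i \<noteq> j" "f i = f j" "g i = g j" "h i = h j" for i j
    proof -
      have "w ! i = w ! j" using fgh that by simp
      then have "w ! i \<in> even_part ?M" using w(2) that unfolding S.odd_distinct_def by blast
      then show ?thesis using fgh[OF that(1)] even by simp
    qed
    moreover have "f ` {0..<d} \<subseteq> B" using fgh by (intro image_subsetI) simp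
    ultimately have "(map f [0..<d], map g [0..<d], map h [0..<d]) \<in> Tri A B d"
      by (simp add: Tri_def words_def)
    moreover have "w = word (map f [0..<d]) (map g [0..<d]) (map h [0..<d])"
      using fgh lw by (auto simp: word_def intro!: nth_equalityI)
    ultimately show ?thesis by blast
  qed
  have "{eta A B Bc d b r s |b r (s :: 'n list). (b, r, s) \<in> Tri A B d} =
      S.eta_word ` {w \<in> words d (mat_basis B). S.odd_distinct w}"
  proof (intro equalityI subsetI)
    fix x assume "x \<in> {eta A B Bc d b r s |b r (s :: 'n list). (b, r, s) \<in> Tri A B d}"
    then obtain b r and s :: "'n list" where "(b, r, s) \<in> Tri A B d" "x = eta A B Bc d b r s" by blast
    then show "x \<in> S.eta_word ` {w \<in> words d (mat_basis B). S.odd_distinct w}"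
      using eta word by blast
  next
    fix x assume "x \<in> S.eta_word ` {w \<in> words d (mat_basis B). S.odd_distinct w}"
    then obtain w where w: "w \<in> words d (mat_basis B)" "S.odd_distinct w" "x = S.eta_word w" by blast
    obtain b r s where T: "(b, r, s) \<in> Tri A B d" "w = word b r s" using surj[OF w(1,2)] by blast
    have "x = eta A B Bc d b r s" unfolding w(3) T(2) by (rule eta[OF T(1), symmetric])
    then show "x \<in> {eta A B Bc d b r s |b r (s :: 'n list). (b, r, s) \<in> Tri A B d}"
      using T(1) by blast
  qed
  then have span: "module.span fscale {eta A B Bc d b r s |b r (s :: 'n list). (b, r, s) \<in> Tri A B d} = S.Tset"
    by (simp only: S.Tset_eq_span)
  \<comment> \<open>The parity parts of \<open>T_superalg\<close> are cut down to the invariants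
    before they are cut down to the span.\<close>
  have "S.Inv \<inter> S.Tset = S.Tset" by (auto simp: S.Tset_def)
  then have "T = S.T"
    unfolding T_def T_superalg_def span S.T_def schur_superalg_def tensor_invariants_def
      S.Inv_def[symmetric] sub_superalg_def by (simp add: Int_assoc)
  moreover have "S.tT (eta A B Bc d b r s) = (if r = s then prod_list (map t b) else 0)"
    if T: "(b, r, s) \<in> Tri A B d" for b and r s :: "'n list"
  proof -
    have "S.tT (eta A B Bc d b r s) = (\<Prod>i<d. if r ! i = s ! i then t (b ! i) else 0)"
      unfolding eta[OF T] S.tT_eta_word[OF word(1)[OF T]]
      by (intro prod.cong) (simp_all add: Tri(7)[OF T] trace_form_munit t_zero)
    also have "\<dots> = (if r = s then prod_list (map t b) else 0)"
    proof (cases "r = s")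
      case True
      then show ?thesis
        using Tri(1)[OF T] by (simp add: prod.list_conv_set_nth atLeast0LessThan)
    next
      case False
      then obtain i where "i < d" "r ! i \<noteq> s ! i" using Tri(2,3)[OF T] by (metis nth_equalityI)
      then have "(\<Prod>i<d. if r ! i = s ! i then t (b ! i) else 0) = 0" by (intro prod_zero) auto
      then show ?thesis using False by simp
    qed
    finally show ?thesis .
  qed
  ultimately show ?thesis using S.tT_symmetrizing by auto
qed

end

theorem theorem4:
  fixes A :: "('k::{idom,ring_char_0}, 'a::ab_group_add) superalg"
    and \<aa> \<cc> B\<aa> B\<cc> B1 :: "'a set"
    and t :: "'a \<Rightarrow> 'k"
    and d :: nat
  assumes "unital_good_pair A \<aa>"
    and "free_finite_rank (smul A) (carr A)"
    and "pair_symmetrizing_form A \<aa> t"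
    and "pair_basis A \<aa> \<cc> B\<aa> B\<cc> B1"
    and "perfect_pairing A t \<aa> \<cc>"
  defines "T \<equiv> (T_superalg A (B\<aa> \<union> B\<cc> \<union> B1) B\<cc> d :: ('k, ('a^'n::finite^'n) list \<Rightarrow> 'k) superalg)"
  shows "symmetric_superalgebra T \<and>
    (\<exists>tT. symmetrizing_form T tT \<and>
       (\<forall>b r s. (b, r, s) \<in> Tri A (B\<aa> \<union> B\<cc> \<union> B1) d \<longrightarrow>
          tT (eta A (B\<aa> \<union> B\<cc> \<union> B1) B\<cc> d b r s) = (if r = s then prod_list (map t b) else 0)))"
proof -
  interpret symmetric_good_pair A \<aa> \<cc> B\<aa> B\<cc> B1 t
    using assms(1-5) by unfold_locales
  show ?thesis
    unfolding T_def symmetric_superalgebra_def using T_symmetrizing[of d] by blast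
qed

end
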